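(* Let $J_n=I_n+N$ be the $n\times n$ ($n\ge2$) Jordan block with eigenvalue $1$. Then a bijection $F:(\mathbb R^n,D_{J_n})\to(\mathbb R^n,D_{J_n})$ is a quasisymmetric map if and only if there are constants $a_0\ne0,\ a_1,\dots,a_{n-2}\in\mathbb R$, a vector $v\in\mathbb R^n$ and a Lipschitz map $C:\mathbb R\to\mathbb R$ such that $$F(x)=(a_0I_n+a_1N+\cdots+a_{n-2}N^{n-2})x+v+\tilde C(x)$$ for all $x=(x_1,\dots,x_n)^T\in\mathbb R^n$, where $\tilde C(x)=(C(x_n),0,\dots,0)^T$.
   Context: $N$ is the $n\times n$ matrix with $1$'s on the superdiagonal and $0$'s elsewhere; $T$ denotes transpose. $D_{J_n}$ is the quasimetric on $\mathbb R^n$ defined by $D_{J_n}(x,x)=0$ and, for $x\ne y$, $D_{J_n}(x,y)=e^t$ where $t$ is the smallest real number with $|e^{-tJ_n}(x-y)|=1$, $|\cdot|$ being the Euclidean norm. "Lipschitz" for $C$ is with respect to the usual distance on $\mathbb R$. A bijection $F:X\to Y$ between quasimetric spaces is $\eta$-quasisymmetric, for a homeomorphism $\eta:[0,\infty)\to[0,\infty)$, if $\frac{\rho(F(x),F(y))}{\rho(F(x),F(z))}\le\eta\left(\frac{\rho(x,y)}{\rho(x,z)}\right)$ for all distinct triples $x,y,z\in X$; it is quasisymmetric if it is $\eta$-quasisymmetric for some $\eta$. *)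

theory Defs
  imports "HOL-Analysis.Analysis" "Jordan_Normal_Form.Jordan_Normal_Form"
begin

unbundle no vec_syntax

text \<open>
  \<open>\<real>\<^sup>n\<close> is \<open>carrier_vec n :: real Matrix.vec set\<close>. Coordinates are numbered from \<open>0\<close>,
  so the first and last coordinates \<open>x\<^sub>1\<close> and \<open>x\<^sub>n\<close> of \<open>x\<close> are \<open>x $ 0\<close> and \<open>x $ (n - 1)\<close>.
\<close>

definition euclid_norm :: "real Matrix.vec \<Rightarrow> real" where
  "euclid_norm x = sqrt (\<Sum>i<dim_vec x. (x $ i)\<^sup>2)"

definition superdiag :: "nat \<Rightarrow> real mat" where
  "superdiag n = mat n n (\<lambda>(i, j). if j = Suc i then 1 else 0)"

definition J :: "nat \<Rightarrow> real mat" where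
  "J n = 1\<^sub>m n + superdiag n"

lemma J_eq_jordan_block: "J n = jordan_block n 1"
  by (rule eq_matI) (auto simp: J_def superdiag_def jordan_block_def)

text \<open>The matrix exponential \<open>\<Sum>k. A\<^sup>k / k!\<close>, summed entrywise; meant for square \<open>A\<close>.\<close>

definition mat_exp :: "real mat \<Rightarrow> real mat" where
  "mat_exp A = mat (dim_row A) (dim_row A) (\<lambda>(i, j). \<Sum>k. (A ^\<^sub>m k) $$ (i, j) / fact k)"

definition D :: "real mat \<Rightarrow> real Matrix.vec \<Rightarrow> real Matrix.vec \<Rightarrow> real" where
  "D A x y =
    (if x = y then 0
     else exp (LEAST t. euclid_norm (mat_exp ((- t) \<cdot>\<^sub>m A) *\<^sub>v (x - y)) = 1))"

definition eta_quasisymmetric ::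
  "(real \<Rightarrow> real) \<Rightarrow> 'a set \<Rightarrow> ('a \<Rightarrow> 'a \<Rightarrow> real) \<Rightarrow> 'b set \<Rightarrow> ('b \<Rightarrow> 'b \<Rightarrow> real) \<Rightarrow> ('a \<Rightarrow> 'b) \<Rightarrow> bool"
where
  "eta_quasisymmetric \<eta> X \<rho> Y \<sigma> F \<longleftrightarrow>
    bij_betw F X Y \<and>
    (\<exists>\<eta>'. homeomorphism {0..} {0..} \<eta> \<eta>') \<and>
    (\<forall>x\<in>X. \<forall>y\<in>X. \<forall>z\<in>X. x \<noteq> y \<longrightarrow> x \<noteq> z \<longrightarrow> y \<noteq> z \<longrightarrow>
      \<sigma> (F x) (F y) / \<sigma> (F x) (F z) \<le> \<eta> (\<rho> x y / \<rho> x z))"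

definition quasisymmetric ::
  "'a set \<Rightarrow> ('a \<Rightarrow> 'a \<Rightarrow> real) \<Rightarrow> 'b set \<Rightarrow> ('b \<Rightarrow> 'b \<Rightarrow> real) \<Rightarrow> ('a \<Rightarrow> 'b) \<Rightarrow> bool"
where
  "quasisymmetric X \<rho> Y \<sigma> F \<longleftrightarrow> (\<exists>\<eta>. eta_quasisymmetric \<eta> X \<rho> Y \<sigma> F)"

text \<open>\<open>a\<^sub>0 I + a\<^sub>1 N + \<dots> + a\<^sub>m N\<^sup>m\<close> for the \<open>n \<times> n\<close> superdiagonal matrix \<open>N\<close>, summed entrywise
  because \<open>mat\<close> is not an instance of \<open>comm_monoid_add\<close>.\<close>

definition superdiag_poly :: "nat \<Rightarrow> nat \<Rightarrow> (nat \<Rightarrow> real) \<Rightarrow> real mat" where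
  "superdiag_poly n m a = mat n n (\<lambda>(i, j). \<Sum>k\<le>m. a k * (superdiag n ^\<^sub>m k) $$ (i, j))"

definition C_tilde :: "nat \<Rightarrow> (real \<Rightarrow> real) \<Rightarrow> real Matrix.vec \<Rightarrow> real Matrix.vec" where
  "C_tilde n C x = Matrix.vec n (\<lambda>i. if i = 0 then C (x $ (n - 1)) else 0)"

end

theory Submission
  imports Defs "HOL-Library.Function_Algebras"
begin

text \<open>
  Write \<open>e\<^sup>s\<^sup>N\<close> as \<open>nexp n s\<close> and \<open>D(x,y)\<close> as \<open>rho n (x - y)\<close>, so that \<open>rho n v \<le> r\<close> iff
  the Euclidean norm of \<open>nexp n (- ln r) v\<close> is at most \<open>r\<close>.

  A quasisymmetric map \<open>F\<close> preserves the hyperplanes \<open>x\<^sub>n = const\<close>. At scale \<open>\<delta> = e\<^sup>-\<^sup>T\<close>, a column of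
  steps of length \<open>\<delta>\<close> in the slanted direction \<open>e\<^sup>-\<^sup>T\<^sup>N e\<^sub>n\<close> travels a fixed distance parallel to the
  hyperplane in only about \<open>1 / (\<delta> T)\<close> steps. If the last coordinate \<open>u\<close> of \<open>F\<close> varied along a
  hyperplane, then disjoint columns would make the sum of the \<open>n\<close>-th powers of the oscillations of
  \<open>u\<close> on disjoint \<open>\<delta>\<close>-balls unbounded as \<open>T \<rightarrow> \<infinity>\<close>; but this sum is bounded by the volume of the
  image. Comparing points on parallel hyperplanes and counting separated points inside one
  hyperplane then makes \<open>F\<close> Lipschitz for \<open>D\<close>.

  Cutting a segment into pieces of size \<open>e\<^sup>-\<^sup>T\<close> turns this into: \<open>e\<^sup>T\<^sup>N F e\<^sup>-\<^sup>T\<^sup>N\<close> is Lipschitz up to an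
  additive error \<open>e\<^sup>-\<^sup>T\<close>, uniformly in \<open>T \<ge> 0\<close>. Letting \<open>T \<rightarrow> \<infinity>\<close> forces the last coordinate of \<open>F\<close> to be affine
  with some slope \<open>a\<^sub>0\<close> and \<open>F - a\<^sub>0 I\<close> to be invariant under translations in the first coordinate, so
  that it descends to \<open>\<real>\<^sup>n\<^sup>-\<^sup>1\<close>; induction on \<open>n\<close> gives the stated form.
\<close>

text \<open>Why slanted steps are cheap: \<open>\<delta> e^(-TN) e_n\<close> with \<delta> = e^-T
  has gauge exactly \<delta>, yet its coordinate d places before the last has size
  \<open>\<delta> T^d / d!\<close>. So m of order \<open>1/(\<delta> T^d)\<close> steps cross a
  fixed distance there. About \<delta>^(1-n) starting points in the other coordinates and
  \<open>1/(m \<delta>)\<close> in the last give separated columns. If u changes by a fixed amount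
  along each, the power mean inequality bounds the sum of n-th powers below by a constant times
  \<open>(m \<delta>)^-n\<close>, which tends to infinity.

  D is only a quasimetric, so lengths of chains in D carry little information. Chaining is possible
  only for the last coordinate, which is 1-Lipschitz for D, and for a norm at a fixed scale.

  The Lipschitz bound is linear because a hyperplane has homogeneous dimension n-1 both in the
  source and in the image, so that packing numbers compare with equal exponents.

  The function C survives because each step of the induction removes the first source coordinate and
  the last image coordinate; in dimension 1 an arbitrary Lipschitz function of \<open>x_n\<close>
  with values in the first coordinate is left.\<close>

section \<open>The unipotent flow\<close>

text \<open>Padding with zeros turns the hyperplane \<open>x\<^sub>n = 0\<close> of \<open>\<real>\<^sup>n\<close> into \<open>\<real>\<^sup>n\<^sup>-\<^sup>1\<close> itself.\<close>

definition Rn :: "nat \<Rightarrow> (nat \<Rightarrow> real) set" where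
  "Rn n = {x. \<forall>i\<ge>n. x i = 0}"

text \<open>On padded sequences N is the left shift. It is nilpotent on \<open>Rn n\<close>, so the
  exponential series stops at \<open>k < n\<close>.\<close>

definition nexp :: "nat \<Rightarrow> real \<Rightarrow> (nat \<Rightarrow> real) \<Rightarrow> nat \<Rightarrow> real" where
  "nexp n s x = (\<lambda>i. \<Sum>k<n. s ^ k / fact k * x (i + k))"

definition nrm :: "nat \<Rightarrow> (nat \<Rightarrow> real) \<Rightarrow> real" where
  "nrm n x = L2_set x {..<n}"

definition basis :: "nat \<Rightarrow> nat \<Rightarrow> real" where
  "basis j = (\<lambda>i. if i = j then 1 else 0)"

definition scale :: "real \<Rightarrow> (nat \<Rightarrow> real) \<Rightarrow> nat \<Rightarrow> real" where
  "scale c x = (\<lambda>i. c * x i)"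

lemma scale_apply [simp]: "scale c x i = c * x i"
  by (simp add: scale_def)

lemma basis_same [simp]: "basis j j = 1"
  by (simp add: basis_def)

lemma Rn_zero [simp]: "0 \<in> Rn n"
  and Rn_add [simp]: "x \<in> Rn n \<Longrightarrow> y \<in> Rn n \<Longrightarrow> x + y \<in> Rn n"
  and Rn_diff [simp]: "x \<in> Rn n \<Longrightarrow> y \<in> Rn n \<Longrightarrow> x - y \<in> Rn n"
  and Rn_uminus [simp]: "x \<in> Rn n \<Longrightarrow> - x \<in> Rn n"
  and Rn_scale [simp]: "x \<in> Rn n \<Longrightarrow> scale c x \<in> Rn n"
  and Rn_nexp [simp]: "x \<in> Rn n \<Longrightarrow> nexp m s x \<in> Rn n"
  and Rn_basis [simp]: "j < n \<Longrightarrow> basis j \<in> Rn n"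
  by (auto simp: Rn_def nexp_def basis_def)

lemma Rn_mono: "x \<in> Rn m \<Longrightarrow> m \<le> n \<Longrightarrow> x \<in> Rn n"
  by (auto simp: Rn_def)

lemma Rn_eq_iff:
  assumes "x \<in> Rn n" "y \<in> Rn n"
  shows "x = y \<longleftrightarrow> (\<forall>i<n. x i = y i)"
proof
  assume *: "\<forall>i<n. x i = y i"
  show "x = y"
  proof
    fix i show "x i = y i" using assms * by (cases "i < n") (auto simp: Rn_def)
  qed
qed auto

lemma nexp_add: "nexp n s (x + y) = nexp n s x + nexp n s y"
  by (auto simp: nexp_def fun_eq_iff sum.distrib algebra_simps)

lemma nexp_diff: "nexp n s (x - y) = nexp n s x - nexp n s y"
  by (auto simp: nexp_def fun_eq_iff sum_subtractf algebra_simps)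

lemma nexp_uminus: "nexp n s (- x) = - nexp n s x"
  by (auto simp: nexp_def fun_eq_iff sum_negf)

lemma nexp_scale: "nexp n s (scale c x) = scale c (nexp n s x)"
  by (auto simp: nexp_def fun_eq_iff sum_distrib_left algebra_simps)

lemma nexp_zero [simp]: "nexp n s 0 = 0"
  by (auto simp: nexp_def fun_eq_iff)

lemma nexp_at_0 [simp]:
  assumes "x \<in> Rn n" shows "nexp n 0 x = x"
proof
  fix i
  have "nexp n 0 x i = (\<Sum>k<n. if k = 0 then x i else 0)"
    unfolding nexp_def by (intro sum.cong) (auto simp: power_0_left)
  then show "nexp n 0 x i = x i"
    using assms by (auto simp: sum.delta Rn_def)
qed

lemma nexp_eq_larger:
  assumes "x \<in> Rn m" "m \<le> n" shows "nexp n s x = nexp m s x"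
proof
  fix i
  show "nexp n s x i = nexp m s x i"
    unfolding nexp_def using assms
    by (intro sum.mono_neutral_right) (auto simp: Rn_def)
qed

lemma nexp_nexp:
  assumes "x \<in> Rn n"
  shows "nexp n s (nexp n t x) = nexp n (s + t) x"
proof
  fix i
  define A where "A = (\<lambda>k l. s ^ k / fact k * (t ^ l / fact l) * x (i + (k + l)))"
  have zero: "A k l = 0" if "n \<le> k + l" for k l
    using assms that by (auto simp: A_def Rn_def)
  have "nexp n s (nexp n t x) i = (\<Sum>k<n. \<Sum>l<n. A k l)"
    unfolding nexp_def A_def by (simp add: sum_distrib_left algebra_simps)
  also have "\<dots> = (\<Sum>(k,l)\<in>{..<n} \<times> {..<n}. A k l)"
    by (simp add: sum.cartesian_product)
  also have "\<dots> = (\<Sum>(k,l)\<in>{(k,l). k + l < n}. A k l)"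
    by (intro sum.mono_neutral_right) (auto simp: not_less, meson zero not_less)
  also have "\<dots> = (\<Sum>m<n. \<Sum>k\<le>m. A k (m - k))"
    by (rule sum.triangle_reindex)
  also have "\<dots> = (\<Sum>m<n. (s + t) ^ m / fact m * x (i + m))"
  proof (rule sum.cong[OF refl])
    fix m
    have "(\<Sum>k\<le>m. A k (m - k)) = (\<Sum>k\<le>m. of_nat (m choose k) * s ^ k * t ^ (m - k)) / fact m * x (i + m)"
      unfolding A_def sum_divide_distrib sum_distrib_right
      by (intro sum.cong) (auto simp: binomial_fact field_simps)
    then show "(\<Sum>k\<le>m. A k (m - k)) = (s + t) ^ m / fact m * x (i + m)"
      by (simp add: binomial_ring)
  qed
  finally show "nexp n s (nexp n t x) i = nexp n (s + t) x i"
    by (simp add: nexp_def)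
qed

lemma nexp_inverse: "x \<in> Rn n \<Longrightarrow> nexp n s (nexp n (- s) x) = x"
  "x \<in> Rn n \<Longrightarrow> nexp n (- s) (nexp n s x) = x"
  by (simp_all add: nexp_nexp)

lemma nexp_eq_0_iff: "x \<in> Rn n \<Longrightarrow> nexp n s x = 0 \<longleftrightarrow> x = 0"
  by (metis nexp_inverse(2) nexp_zero)

lemma nexp_top:
  assumes "\<And>i. i > l \<Longrightarrow> x i = 0" "n > 0" shows "nexp n s x l = x l"
proof -
  have "nexp n s x l = (\<Sum>k<n. if k = 0 then x l else 0)"
    unfolding nexp_def using assms by (intro sum.cong) auto
  then show ?thesis using assms by (auto simp: sum.delta)
qed

lemma nexp_last:
  assumes "x \<in> Rn n" "n > 0" shows "nexp n s x (n - 1) = x (n - 1)"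
  using assms by (intro nexp_top) (auto simp: Rn_def)

lemma nexp_basis:
  assumes "j < n"
  shows "nexp n s (basis j) i = (if i \<le> j then s ^ (j - i) / fact (j - i) else 0)"
proof -
  have "nexp n s (basis j) i = (\<Sum>k<n. if k = j - i \<and> i \<le> j then s ^ k / fact k else 0)"
    unfolding nexp_def basis_def by (intro sum.cong) auto
  also have "\<dots> = (if i \<le> j then s ^ (j - i) / fact (j - i) else 0)"
    using assms by (auto simp: sum.delta)
  finally show ?thesis .
qed

lemma nrm_nonneg [simp]: "nrm n x \<ge> 0"
  by (simp add: nrm_def L2_set_nonneg)

lemma nrm_zero [simp]: "nrm n 0 = 0"
  by (simp add: nrm_def L2_set_def)

lemma nrm_triangle: "nrm n (x + y) \<le> nrm n x + nrm n y"
  unfolding nrm_def using L2_set_triangle_ineq[of x y "{..<n}"] by (simp add: plus_fun_def)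

lemma nrm_uminus [simp]: "nrm n (- x) = nrm n x"
  by (simp add: nrm_def L2_set_def)

lemma nrm_triangle_diff: "nrm n (x - y) \<le> nrm n x + nrm n y"
  using nrm_triangle[of n x "- y"] by (simp only: nrm_uminus diff_conv_add_uminus)

lemma nrm_scale: "nrm n (scale c x) = \<bar>c\<bar> * nrm n x"
  by (simp add: nrm_def L2_set_def power_mult_distrib real_sqrt_mult flip: sum_distrib_left)

lemma abs_le_nrm: "i < n \<Longrightarrow> \<bar>x i\<bar> \<le> nrm n x"
  unfolding nrm_def using member_le_L2_set[of "{..<n}" i "\<lambda>i. \<bar>x i\<bar>"]
  by (simp add: L2_set_def)

lemma nrm_le_sum: "nrm n x \<le> (\<Sum>i<n. \<bar>x i\<bar>)"
  unfolding nrm_def by (rule L2_set_le_sum_abs)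

lemma nrm_le_bound:
  assumes "\<And>i. i < n \<Longrightarrow> \<bar>x i\<bar> \<le> c" shows "nrm n x \<le> real n * c"
  using nrm_le_sum[of n x] sum_mono[of "{..<n}" "\<lambda>i. \<bar>x i\<bar>" "\<lambda>_. c"] assms by simp

lemma nrm_eq_0_iff: "x \<in> Rn n \<Longrightarrow> nrm n x = 0 \<longleftrightarrow> x = 0"
  by (auto simp: nrm_def L2_set_eq_0_iff Rn_eq_iff[of _ n])

lemma nrm_pos: "x \<in> Rn n \<Longrightarrow> x \<noteq> 0 \<Longrightarrow> nrm n x > 0"
  using nrm_eq_0_iff[of x n] nrm_nonneg[of n x] by linarith

lemma nrm_eq_larger:
  assumes "x \<in> Rn m" "m \<le> n" shows "nrm n x = nrm m x"
proof -
  have "(\<Sum>i<n. (x i)\<^sup>2) = (\<Sum>i<m. (x i)\<^sup>2)"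
    using assms by (intro sum.mono_neutral_right) (auto simp: Rn_def)
  then show ?thesis by (simp add: nrm_def L2_set_def)
qed

lemma nrm_basis [simp]: "j < n \<Longrightarrow> nrm n (basis j) = 1"
  by (simp add: nrm_def L2_set_def basis_def if_distrib[of "\<lambda>x. x\<^sup>2"] cong: if_cong)

text \<open>The entries of \<open>e^(sN)\<close> are polynomials in s, so any positive exponential
  rate bounds them. The rate 1/2, from \<open>(|s|/2)^k / k! \<le> e^(|s|/2)\<close>, leaves room
  for the factor e^-t in \<open>decay\<close> to win.\<close>

lemma abs_nexp_le:
  assumes x: "x \<in> Rn n"
  shows "\<bar>nexp n s x i\<bar> \<le> 2 ^ n * exp (\<bar>s\<bar> / 2) * (real n * nrm n x)"
proof -
  have bnd: "\<bar>s ^ k / fact k * x (i + k)\<bar> \<le> 2 ^ n * exp (\<bar>s\<bar> / 2) * nrm n x" if k: "k < n" for k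
  proof -
    have "(\<bar>s\<bar> / 2) ^ k / fact k \<le> exp (\<bar>s\<bar> / 2)"
    proof -
      have "(\<Sum>j\<in>{k}. inverse (fact j) * (\<bar>s\<bar> / 2) ^ j) \<le> (\<Sum>j. inverse (fact j) * (\<bar>s\<bar> / 2) ^ j)"
        by (rule sum_le_suminf[OF summable_exp]) auto
      also have "\<dots> = exp (\<bar>s\<bar> / 2)"
        unfolding exp_def by (simp only: real_scaleR_def)
      finally show ?thesis by (simp only: sum.insert sum.empty finite.emptyI divide_inverse mult.commute) simp
    qed
    then have "\<bar>s\<bar> ^ k / fact k \<le> 2 ^ k * exp (\<bar>s\<bar> / 2)"
      by (simp add: power_divide field_simps)
    also have "\<dots> \<le> 2 ^ n * exp (\<bar>s\<bar> / 2)"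
      using k by (intro mult_right_mono power_increasing) auto
    finally have a: "\<bar>s ^ k / fact k\<bar> \<le> 2 ^ n * exp (\<bar>s\<bar> / 2)"
      by (simp add: power_abs)
    have b: "\<bar>x (i + k)\<bar> \<le> nrm n x"
      using x abs_le_nrm[of "i + k" n x] by (cases "i + k < n") (auto simp: Rn_def)
    show ?thesis unfolding abs_mult by (rule mult_mono[OF a b]) auto
  qed
  have "\<bar>nexp n s x i\<bar> \<le> (\<Sum>k<n. \<bar>s ^ k / fact k * x (i + k)\<bar>)"
    unfolding nexp_def by (rule sum_abs)
  also have "\<dots> \<le> (\<Sum>k<n. 2 ^ n * exp (\<bar>s\<bar> / 2) * nrm n x)"
    by (rule sum_mono) (use bnd in auto)
  finally show ?thesis by (simp add: algebra_simps)
qed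

lemma nrm_nexp_le:
  assumes "x \<in> Rn n"
  shows "nrm n (nexp n s x) \<le> (real n)\<^sup>2 * 2 ^ n * exp (\<bar>s\<bar> / 2) * nrm n x"
  using nrm_le_bound[of n "nexp n s x", OF abs_nexp_le[OF assms]]
  by (simp add: power2_eq_square algebra_simps)

section \<open>The quasimetric as a gauge\<close>

lemma DERIV_nexp:
  assumes "x \<in> Rn n"
  shows "((\<lambda>s. nexp n s x i) has_real_derivative nexp n s x (Suc i)) (at s)"
proof (cases n)
  case 0
  then show ?thesis by (simp add: nexp_def)
next
  case (Suc m)
  have "((\<lambda>s. nexp n s x i) has_real_derivative
      (\<Sum>k<n. real k * s ^ (k - 1) / fact k * x (i + k))) (at s)"
    unfolding nexp_def by (auto intro!: derivative_eq_intros sum.cong)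
  also have "(\<Sum>k<n. real k * s ^ (k - 1) / fact k * x (i + k)) =
      (\<Sum>k<m. real (Suc k) * s ^ k / fact (Suc k) * x (i + Suc k))"
    unfolding Suc by (subst sum.lessThan_Suc_shift) simp
  also have "\<dots> = (\<Sum>k<m. s ^ k / fact k * x (Suc i + k))"
    by (intro sum.cong) (auto simp: divide_simps)
  also have "\<dots> = nexp n s x (Suc i)"
    using assms by (simp add: nexp_def Suc Rn_def)
  finally show ?thesis .
qed

text \<open>This is the Euclidean norm of \<open>e^(-tJ) x\<close>: I and N commute, so the
  exponential splits.\<close>

definition decay :: "nat \<Rightarrow> (nat \<Rightarrow> real) \<Rightarrow> real \<Rightarrow> real" where
  "decay n x t = exp (- t) * nrm n (nexp n (- t) x)"

lemma decay_eq_sqrt: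
  "decay n x t = sqrt (\<Sum>i<n. (exp (- t) * nexp n (- t) x i)\<^sup>2)"
proof -
  have "(\<Sum>i<n. (exp (- t) * nexp n (- t) x i)\<^sup>2) = (exp (- t))\<^sup>2 * (\<Sum>i<n. (nexp n (- t) x i)\<^sup>2)"
    by (simp add: power_mult_distrib sum_distrib_left)
  then show ?thesis
    by (simp only: real_sqrt_mult) (simp add: decay_def nrm_def L2_set_def)
qed

text \<open>The symmetric part of \<open>J\<^sub>n\<close> is positive definite.\<close>

lemma sum_shift_pos:
  fixes w :: "nat \<Rightarrow> real"
  assumes "w \<in> Rn n" "w \<noteq> 0"
  shows "(\<Sum>i<n. w i * (w i + w (Suc i))) > 0"
proof -
  obtain m where n: "n = Suc m"
    using assms by (cases n) (auto simp: Rn_def fun_eq_iff)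
  have wn: "w n = 0" using assms by (auto simp: Rn_def)
  have shift: "(\<Sum>i<n. (w (Suc i))\<^sup>2) = (\<Sum>i<n. (w i)\<^sup>2) - (w 0)\<^sup>2"
    using sum.lessThan_Suc_shift[of "\<lambda>i. (w i)\<^sup>2" n] wn by simp
  have "2 * (\<Sum>i<n. w i * (w i + w (Suc i)))
      = (\<Sum>i<n. (w i + w (Suc i))\<^sup>2) + (\<Sum>i<n. (w i)\<^sup>2) - (\<Sum>i<n. (w (Suc i))\<^sup>2)"
    by (simp add: sum_distrib_left power2_eq_square algebra_simps flip: sum.distrib sum_subtractf)
  also have "\<dots> = (\<Sum>i<n. (w i + w (Suc i))\<^sup>2) + (w 0)\<^sup>2"
    using shift by simp
  finally have eq: "2 * (\<Sum>i<n. w i * (w i + w (Suc i))) = (\<Sum>i<n. (w i + w (Suc i))\<^sup>2) + (w 0)\<^sup>2" .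
  have nonneg: "(\<Sum>i<n. (w i + w (Suc i))\<^sup>2) \<ge> 0" by (intro sum_nonneg) auto
  have "(\<Sum>i<n. (w i + w (Suc i))\<^sup>2) + (w 0)\<^sup>2 \<noteq> 0"
  proof
    assume "(\<Sum>i<n. (w i + w (Suc i))\<^sup>2) + (w 0)\<^sup>2 = 0"
    then have "w 0 = 0" and "(\<Sum>i<n. (w i + w (Suc i))\<^sup>2) = 0"
      using nonneg by (smt (verit) zero_le_power2 power2_eq_iff zero_eq_power2)+
    then have eq0: "\<forall>i<n. w i + w (Suc i) = 0"
      by (subst (asm) sum_nonneg_eq_0_iff) auto
    have "i \<le> n \<Longrightarrow> w i = 0" for i
    proof (induction i)
      case (Suc i)
      then show ?case
        using eq0[rule_format, of i] by simp
    qed (use \<open>w 0 = 0\<close> in simp)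
    then have "w = 0"
      using assms by (auto simp: Rn_def fun_eq_iff) (metis nat_le_linear)
    then show False using assms by simp
  qed
  then show ?thesis using eq nonneg by (smt (verit) zero_le_power2)
qed

text \<open>With \<open>w = e^(-tJ) x\<close>, the derivative of the squared norm of w is -2 times
  the inner product of w and Jw, negative by \<open>sum_shift_pos\<close>. So the norm takes the
  value 1 only once, and \<open>LEAST\<close> in the quasimetric merely selects this time.\<close>

lemma decay_strict_antimono:
  assumes x: "x \<in> Rn n" "x \<noteq> 0" and "s < t"
  shows "decay n x t < decay n x s"
proof -
  define w where "w = (\<lambda>t i. exp (- t) * nexp n (- t) x i)"
  have Dw: "((\<lambda>t. w t i) has_real_derivative - (w t i + w t (Suc i))) (at t)" for t i
    unfolding w_def
    by (rule derivative_eq_intros DERIV_chain2[where f="\<lambda>s. nexp n s x i", OF DERIV_nexp[OF x(1)]] refl)+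
       (simp add: algebra_simps)
  have D: "((\<lambda>t. \<Sum>i<n. (w t i)\<^sup>2) has_real_derivative
      (\<Sum>i<n. 2 * w t i * - (w t i + w t (Suc i)))) (at t)" for t
    by (rule derivative_eq_intros Dw refl)+ (simp add: algebra_simps)
  have "(\<Sum>i<n. (w t i)\<^sup>2) < (\<Sum>i<n. (w s i)\<^sup>2)"
  proof (rule DERIV_neg_imp_decreasing[OF \<open>s < t\<close>])
    fix u
    have wu: "w u = scale (exp (- u)) (nexp n (- u) x)" by (auto simp: w_def)
    have "w u \<in> Rn n" unfolding wu using x by simp
    moreover have "w u \<noteq> 0"
      unfolding wu using nexp_eq_0_iff[OF x(1), of "- u"] x(2) by (auto simp: fun_eq_iff)
    ultimately have "(\<Sum>i<n. w u i * (w u i + w u (Suc i))) > 0" by (rule sum_shift_pos)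
    then have "(\<Sum>i<n. 2 * w u i * - (w u i + w u (Suc i))) < 0"
      by (simp add: mult.assoc sum_negf sum_distrib_left[symmetric] del: minus_add_distrib)
    then show "\<exists>y. ((\<lambda>t. \<Sum>i<n. (w t i)\<^sup>2) has_real_derivative y) (at u) \<and> y < 0"
      using D by blast
  qed
  then show ?thesis unfolding decay_eq_sqrt w_def by simp
qed

lemma decay_less_iff:
  assumes x: "x \<in> Rn n" "x \<noteq> 0"
  shows "decay n x s < decay n x t \<longleftrightarrow> t < s"
  using decay_strict_antimono[OF assms] by (metis linorder_less_linear order_less_asym)

lemma continuous_on_decay:
  assumes "x \<in> Rn n" shows "continuous_on A (decay n x)"
proof -
  have "isCont (\<lambda>t. nexp n (- t) x i) t" for i t
    by (rule DERIV_isCont[OF DERIV_chain2[OF DERIV_nexp[OF assms]]]) (auto intro!: derivative_eq_intros)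
  then have "continuous_on A (\<lambda>t. nexp n (- t) x i)" for i
    by (simp add: continuous_at_imp_continuous_on)
  then show ?thesis unfolding decay_eq_sqrt
    by (auto intro!: continuous_intros)
qed

lemma decay_le:
  assumes "x \<in> Rn n" "t \<ge> 0"
  shows "decay n x t \<le> (real n)\<^sup>2 * 2 ^ n * exp (- t / 2) * nrm n x"
proof -
  have "decay n x t \<le> exp (- t) * ((real n)\<^sup>2 * 2 ^ n * exp (\<bar>- t\<bar> / 2) * nrm n x)"
    unfolding decay_def by (intro mult_left_mono nrm_nexp_le assms) auto
  also have "\<dots> = (real n)\<^sup>2 * 2 ^ n * (exp (- t) * exp (t / 2)) * nrm n x"
    using assms by simp
  also have "exp (- t) * exp (t / 2) = exp (- t / 2)"
    by (simp flip: exp_add)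
  finally show ?thesis .
qed

lemma exp_neg_half_bound:
  fixes c :: real
  assumes "c > 0" "t = 2 * \<bar>ln c\<bar>" shows "c * exp (- t / 2) \<le> 1"
proof -
  have "c * exp (- t / 2) = exp (ln c) * exp (- \<bar>ln c\<bar>)" using assms by simp
  also have "\<dots> = exp (ln c - \<bar>ln c\<bar>)" by (simp flip: exp_add)
  finally show ?thesis by simp
qed

lemma ex_decay_le_1:
  assumes x: "x \<in> Rn n"
  shows "\<exists>t\<ge>0. decay n x t \<le> 1"
proof -
  define c where "c = (real n)\<^sup>2 * 2 ^ n * nrm n x + 1"
  have c: "c > 0" unfolding c_def by (smt (verit) mult_nonneg_nonneg nrm_nonneg zero_le_power2 zero_le_power)
  define t where "t = 2 * \<bar>ln c\<bar>"
  have "decay n x t \<le> (real n)\<^sup>2 * 2 ^ n * exp (- t / 2) * nrm n x"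
    by (rule decay_le[OF x]) (simp add: t_def)
  also have "\<dots> \<le> c * exp (- t / 2)"
    by (simp add: c_def algebra_simps)
  also have "\<dots> \<le> 1" using exp_neg_half_bound[OF c t_def] .
  finally show ?thesis by (intro exI[of _ t]) (auto simp: t_def)
qed

lemma ex_decay_ge_1:
  assumes x: "x \<in> Rn n" "x \<noteq> 0"
  shows "\<exists>t\<le>0. decay n x t \<ge> 1"
proof -
  define C where "C = (real n)\<^sup>2 * 2 ^ n"
  define c where "c = C / nrm n x + 1"
  have c: "c > 0" unfolding c_def C_def by (smt (verit) divide_nonneg_nonneg mult_nonneg_nonneg nrm_nonneg zero_le_power2 zero_le_power)
  define t where "t = 2 * \<bar>ln c\<bar>"
  have t: "t \<ge> 0" by (simp add: t_def)
  have pos: "nrm n x > 0" using nrm_pos[OF x] .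
  have "nrm n x = nrm n (nexp n (- t) (nexp n t x))"
    using x by (simp add: nexp_nexp)
  also have "\<dots> \<le> C * exp (t / 2) * nrm n (nexp n t x)"
    using nrm_nexp_le[of "nexp n t x" n "- t"] x t by (simp add: C_def)
  also have "C * exp (t / 2) * nrm n (nexp n t x) = C * exp (- t / 2) * decay n x (- t)"
  proof -
    have "exp (- t / 2) * decay n x (- t) = exp (- t / 2 + t) * nrm n (nexp n t x)"
      unfolding exp_add decay_def by simp
    also have "- t / 2 + t = t / 2" by simp
    finally show ?thesis by (simp add: algebra_simps)
  qed
  also have "C * exp (- t / 2) \<le> nrm n x"
  proof -
    have "C \<le> c * nrm n x" using pos by (simp add: c_def field_simps)
    then have "C * exp (- t / 2) \<le> c * exp (- t / 2) * nrm n x"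
      by (simp add: algebra_simps)
    also have "\<dots> \<le> 1 * nrm n x"
      using exp_neg_half_bound[OF c t_def] by (intro mult_right_mono) auto
    finally show ?thesis by simp
  qed
  then have "C * exp (- t / 2) * decay n x (- t) \<le> nrm n x * decay n x (- t)"
    by (intro mult_right_mono) (auto simp: decay_def)
  finally have "1 \<le> decay n x (- t)" using pos by simp
  then show ?thesis using t by (intro exI[of _ "- t"]) auto
qed

lemma ex_decay_eq_1:
  assumes x: "x \<in> Rn n" "x \<noteq> 0"
  shows "\<exists>t. decay n x t = 1"
proof -
  obtain s t where "t \<ge> 0" "decay n x t \<le> 1" "s \<le> 0" "decay n x s \<ge> 1"
    using ex_decay_le_1[OF x(1)] ex_decay_ge_1[OF x] by blast
  then show ?thesis
    using IVT2'[of "decay n x" t 1 s] continuous_on_decay[OF x(1)] by force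
qed

definition rho :: "nat \<Rightarrow> (nat \<Rightarrow> real) \<Rightarrow> real" where
  "rho n x = (if x = 0 then 0 else exp (LEAST t. decay n x t = 1))"

lemma rho_zero [simp]: "rho n 0 = 0"
  by (simp add: rho_def)

lemma rho_nonneg [simp]: "rho n x \<ge> 0"
  by (simp add: rho_def)

lemma rho_eq_0_iff [simp]: "rho n x = 0 \<longleftrightarrow> x = 0"
  by (simp add: rho_def)

lemma rho_pos_iff [simp]: "rho n x > 0 \<longleftrightarrow> x \<noteq> 0"
  by (simp add: rho_def)

lemma decay_ln_rho:
  assumes x: "x \<in> Rn n" "x \<noteq> 0"
  shows "decay n x (ln (rho n x)) = 1"
proof -
  obtain t where t: "decay n x t = 1" using ex_decay_eq_1[OF x] by blast
  have "(LEAST t. decay n x t = 1) = t"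
    by (rule Least_equality[of "\<lambda>t. decay n x t = 1", OF t]) (metis decay_less_iff[OF x] t not_le order_less_irrefl)
  then show ?thesis using x t by (simp add: rho_def)
qed

lemma rho_le_iff:
  assumes x: "x \<in> Rn n" and r: "r > 0"
  shows "rho n x \<le> r \<longleftrightarrow> nrm n (nexp n (- ln r) x) \<le> r"
proof (cases "x = 0")
  case False
  have "rho n x \<le> r \<longleftrightarrow> ln (rho n x) \<le> ln r"
    using False r by simp
  also have "\<dots> \<longleftrightarrow> decay n x (ln r) \<le> 1"
    using decay_less_iff[OF x False, of "ln (rho n x)" "ln r"] decay_ln_rho[OF x False] by (simp flip: not_less)
  also have "\<dots> \<longleftrightarrow> nrm n (nexp n (- ln r) x) \<le> r"
    using r by (simp add: decay_def exp_minus field_simps)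
  finally show ?thesis .
qed (use r in simp)

lemma nrm_nexp_rho:
  assumes x: "x \<in> Rn n" "x \<noteq> 0"
  shows "nrm n (nexp n (- ln (rho n x)) x) = rho n x"
  using decay_ln_rho[OF x] x by (simp add: decay_def exp_minus field_simps)

lemma rho_uminus [simp]: "rho n (- x) = rho n x"
  by (simp add: rho_def decay_def nexp_uminus)

lemma rho_commute: "rho n (x - y) = rho n (y - x)"
  using rho_uminus[of n "x - y"] by simp

lemma rho_eqI:
  assumes x: "x \<in> Rn n" and r: "r > 0" and eq: "nrm n (nexp n (- ln r) x) = r"
  shows "rho n x = r"
proof -
  have "x \<noteq> 0" using eq r by auto
  have "decay n x (ln r) = 1" using eq r by (simp add: decay_def exp_minus)
  then have "ln (rho n x) = ln r"
    using decay_less_iff[OF x \<open>x \<noteq> 0\<close>] decay_ln_rho[OF x \<open>x \<noteq> 0\<close>]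
    by (metis linorder_less_linear order_less_irrefl)
  then show ?thesis using r \<open>x \<noteq> 0\<close> by simp
qed

text \<open>\<open>r e^((ln r) N) = e^((ln r) J)\<close> is the dilation that matches rho. It builds
  the vectors of prescribed gauge used below, in particular the slanted step, with r = e^-T.\<close>

lemma rho_dilate:
  assumes "w \<in> Rn n" "nrm n w = 1" "r > 0"
  shows "rho n (scale r (nexp n (ln r) w)) = r"
  using assms by (intro rho_eqI) (auto simp: nexp_scale nexp_nexp nrm_scale)

text \<open>A shear does not change the last nonzero coordinate, so the bound on it is free of
  logarithms. Bounds on the coordinates before it would involve powers of \<open>ln r\<close>. The
  separation estimates rest on this.\<close>

lemma abs_top_le_rho:
  assumes x: "x \<in> Rn n" and top: "\<And>i. i > l \<Longrightarrow> x i = 0"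
  shows "\<bar>x l\<bar> \<le> rho n x"
proof (cases "x = 0 \<or> l \<ge> n")
  case True
  then show ?thesis using x by (auto simp: Rn_def)
next
  case False
  have "\<bar>nexp n (- ln (rho n x)) x l\<bar> \<le> rho n x"
    using abs_le_nrm[of l n "nexp n (- ln (rho n x)) x"] nrm_nexp_rho[OF x] False by auto
  then show ?thesis using nexp_top[OF top] False by simp
qed

lemma abs_last_le_rho:
  assumes "x \<in> Rn n" shows "\<bar>x (n - 1)\<bar> \<le> rho n x"
  using assms by (intro abs_top_le_rho) (auto simp: Rn_def)

lemma rho_eq_larger:
  assumes "x \<in> Rn m" "m \<le> n" shows "rho n x = rho m x"
proof -
  have "decay n x t = decay m x t" for t
    using nexp_eq_larger[OF assms, of "- t"] nrm_eq_larger[of "nexp m (- t) x" m n] assms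
    by (simp add: decay_def)
  then show ?thesis by (simp add: rho_def)
qed

text \<open>Passing from radius r to \<open>e^t r\<close> applies a further shear by t, whose norm
  is at most a constant times e^(t/2), while the radius gains e^t. Hence t = 2 |ln C| absorbs the
  constant C.\<close>

lemma rho_le_of_nrm:
  assumes "c \<ge> 0"
  shows "\<exists>K\<ge>1. \<forall>x\<in>Rn n. \<forall>r>0. nrm n (nexp n (- ln r) x) \<le> c * r \<longrightarrow> rho n x \<le> K * r"
proof -
  define C where "C = (real n)\<^sup>2 * 2 ^ n * c + 1"
  have C: "C > 0" "C \<ge> 1" using assms by (auto simp: C_def intro: add_nonneg_pos)
  define t where "t = 2 * \<bar>ln C\<bar>"
  have t: "t \<ge> 0" by (simp add: t_def)
  show ?thesis
  proof (intro exI[of _ "exp t"] conjI ballI allI impI)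
    show "1 \<le> exp t" using t by simp
    fix x r assume x: "x \<in> Rn n" and r: "(0::real) < r" and le: "nrm n (nexp n (- ln r) x) \<le> c * r"
    have "nexp n (- ln (exp t * r)) x = nexp n (- t) (nexp n (- ln r) x)"
      using x r by (simp add: nexp_nexp ln_mult)
    then have "nrm n (nexp n (- ln (exp t * r)) x) \<le> (real n)\<^sup>2 * 2 ^ n * exp (t / 2) * nrm n (nexp n (- ln r) x)"
      using nrm_nexp_le[of "nexp n (- ln r) x" n "- t"] x t by simp
    also have "\<dots> \<le> (real n)\<^sup>2 * 2 ^ n * exp (t / 2) * (c * r)"
      by (intro mult_left_mono le) auto
    also have "\<dots> \<le> C * exp (t / 2) * r"
      using r by (simp add: C_def algebra_simps)
    also have "C * exp (t / 2) = C * exp (- t / 2) * exp t"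
    proof -
      have "exp (t / 2) = exp (- t / 2 + t)" by simp
      then show ?thesis by (simp only: exp_add mult.assoc)
    qed
    also have "\<dots> * r \<le> 1 * exp t * r"
      using exp_neg_half_bound[OF C(1) t_def] r by (intro mult_right_mono) auto
    finally show "rho n x \<le> exp t * r"
      using x r by (subst rho_le_iff) auto
  qed
qed

lemma nrm_le_of_rho:
  assumes "c > 0"
  shows "\<exists>K\<ge>1. \<forall>x\<in>Rn n. \<forall>r>0. rho n x \<le> c * r \<longrightarrow> nrm n (nexp n (- ln r) x) \<le> K * r"
proof -
  define K where "K = (real n)\<^sup>2 * 2 ^ n * exp (\<bar>ln c\<bar> / 2) * c + 1"
  have K: "K \<ge> 1" using assms by (simp add: K_def)
  have "nrm n (nexp n (- ln r) x) \<le> K * r" if x: "x \<in> Rn n" and r: "r > 0" and le: "rho n x \<le> c * r" for x r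
  proof -
    have "nexp n (- ln r) x = nexp n (ln c) (nexp n (- ln (c * r)) x)"
      using x r assms by (simp add: nexp_nexp ln_mult)
    then have "nrm n (nexp n (- ln r) x) \<le> (real n)\<^sup>2 * 2 ^ n * exp (\<bar>ln c\<bar> / 2) * nrm n (nexp n (- ln (c * r)) x)"
      using nrm_nexp_le[of "nexp n (- ln (c * r)) x" n "ln c"] x by simp
    also have "\<dots> \<le> (real n)\<^sup>2 * 2 ^ n * exp (\<bar>ln c\<bar> / 2) * (c * r)"
      using le x r assms by (intro mult_left_mono) (auto simp flip: rho_le_iff)
    also have "\<dots> \<le> K * r" using r by (simp add: K_def algebra_simps)
    finally show ?thesis .
  qed
  then show ?thesis using K by blast
qed

lemma rho_quasi_triangle:
  "\<exists>M\<ge>1. \<forall>x\<in>Rn n. \<forall>y\<in>Rn n. rho n (x + y) \<le> M * max (rho n x) (rho n y)"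
proof -
  obtain K where K: "K \<ge> 1" "\<And>x r. x \<in> Rn n \<Longrightarrow> r > 0 \<Longrightarrow> nrm n (nexp n (- ln r) x) \<le> 2 * r \<Longrightarrow> rho n x \<le> K * r"
    using rho_le_of_nrm[of 2 n] by auto
  have "rho n (x + y) \<le> K * max (rho n x) (rho n y)" if xy: "x \<in> Rn n" "y \<in> Rn n" for x y
  proof (cases "x = 0 \<and> y = 0")
    case False
    define r where "r = max (rho n x) (rho n y)"
    have r: "r > 0" using False by (auto simp: r_def less_max_iff_disj)
    have "rho n x \<le> r" "rho n y \<le> r" by (auto simp: r_def)
    then have "nrm n (nexp n (- ln r) x) \<le> r" "nrm n (nexp n (- ln r) y) \<le> r"
      using xy r by (auto simp: rho_le_iff)
    then have "nrm n (nexp n (- ln r) (x + y)) \<le> 2 * r"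
      using nrm_triangle[of n "nexp n (- ln r) x" "nexp n (- ln r) y"] by (simp add: nexp_add)
    then show ?thesis using K(2)[of "x + y" r] xy r by (simp add: r_def)
  qed simp
  then show ?thesis using K(1) by blast
qed

section \<open>Volume by counting grid points\<close>

text \<open>Choose the coordinates from the last to the first: each time the window is already known
  and holds l integers. The induction peels off coordinate 0, on which no window depends. This is
  the discrete form of the fact that unipotent triangular maps preserve volume.\<close>

lemma card_triangular_box:
  fixes c :: "nat \<Rightarrow> (nat \<Rightarrow> int) \<Rightarrow> int" and l :: nat
  assumes "\<And>i z z'. (\<And>j. j > i \<Longrightarrow> z j = z' j) \<Longrightarrow> c i z = c i z'"
  defines "B \<equiv> \<lambda>n c. {z. (\<forall>i\<ge>n. z i = 0) \<and> (\<forall>i<n. c i z \<le> z i \<and> z i < c i z + int l)}"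
  shows "finite (B n c) \<and> card (B n c) = l ^ n"
  using assms(1)
proof (induction n arbitrary: c)
  case 0
  have "B 0 c = {\<lambda>_. 0}" by (auto simp: B_def)
  then show ?case by simp
next
  case (Suc n)
  define c' where "c' = (\<lambda>i y. c (Suc i) (case_nat 0 y))"
  have c': "c' i z = c' i z'" if "\<And>j. j > i \<Longrightarrow> z j = z' j" for i z z'
  proof -
    have "case_nat 0 z j = case_nat 0 z' j" if "j > Suc i" for j
      using \<open>\<And>j. j > i \<Longrightarrow> z j = z' j\<close> that by (cases j) auto
    then show ?thesis unfolding c'_def by (rule Suc.prems)
  qed
  have indep: "c i (case_nat k y) = c i (case_nat 0 y)" for i k y
  proof (rule Suc.prems)
    show "case_nat k y j = case_nat 0 y j" if "j > i" for j
      using that by (cases j) auto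
  qed
  have "finite (B n c') \<and> card (B n c') = l ^ n"
    by (rule Suc.IH, rule c', blast)
  then have fin: "finite (B n c')" and card: "card (B n c') = l ^ n" by auto
  define I where "I = (\<lambda>y. {c 0 (case_nat 0 y)..<c 0 (case_nat 0 y) + int l})"
  have "bij_betw (\<lambda>(y, k). case_nat k y) (Sigma (B n c') I) (B (Suc n) c)"
  proof (rule bij_betw_byWitness[where f' = "\<lambda>z. (\<lambda>i. z (Suc i), z 0)"])
    show "\<forall>z\<in>B (Suc n) c. (\<lambda>(y, k). case_nat k y) (\<lambda>i. z (Suc i), z 0) = z"
      by (auto simp: fun_eq_iff split: nat.splits)
    show "(\<lambda>(y, k). case_nat k y) ` Sigma (B n c') I \<subseteq> B (Suc n) c"
    proof clarify
      fix y k assume y: "y \<in> B n c'" and k: "k \<in> I y"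
      have "case_nat k y i = 0" if "i \<ge> Suc n" for i
        using y that by (cases i) (auto simp: B_def)
      moreover have "c i (case_nat k y) \<le> case_nat k y i \<and> case_nat k y i < c i (case_nat k y) + int l"
        if "i < Suc n" for i
      proof (cases i)
        case 0
        then show ?thesis using k indep[of 0 k y] by (simp add: I_def)
      next
        case (Suc j)
        then show ?thesis using y that indep[of "Suc j" k y] by (simp add: B_def c'_def)
      qed
      ultimately show "case_nat k y \<in> B (Suc n) c" unfolding B_def by blast
    qed
    show "(\<lambda>z. (\<lambda>i. z (Suc i), z 0)) ` B (Suc n) c \<subseteq> Sigma (B n c') I"
    proof clarify
      fix z assume z: "z \<in> B (Suc n) c"
      have "case_nat (z 0) (\<lambda>i. z (Suc i)) = z" by (auto simp: fun_eq_iff split: nat.splits)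
      then have "c i (case_nat 0 (\<lambda>i. z (Suc i))) = c i z" for i
        using indep[of i "z 0" "\<lambda>i. z (Suc i)"] by simp
      then show "(\<lambda>i. z (Suc i)) \<in> B n c' \<and> z 0 \<in> I (\<lambda>i. z (Suc i))"
        using z by (auto simp: B_def I_def c'_def)
    qed
  qed auto
  then have "finite (B (Suc n) c) \<and> card (B (Suc n) c) = card (Sigma (B n c') I)"
    using fin bij_betw_finite bij_betw_same_card
    by (metis (no_types, lifting) I_def finite_SigmaI finite_atLeastLessThan_int)
  also have "card (Sigma (B n c') I) = l ^ Suc n"
    using fin card by (simp add: card_SigmaI I_def)
  finally show ?case .
qed

text \<open>The points of the grid e Z^n in a cube about y of half-width w, sheared as at scale r.
  The width is kept apart from r so that such a cube can be fitted both inside a gauge ball and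
  around one.\<close>

definition grid_box :: "nat \<Rightarrow> real \<Rightarrow> real \<Rightarrow> real \<Rightarrow> (nat \<Rightarrow> real) \<Rightarrow> (nat \<Rightarrow> int) set" where
  "grid_box n e r w y = {z. (\<forall>i\<ge>n. z i = 0) \<and>
     (\<forall>i<n. \<bar>nexp n (- ln r) ((\<lambda>i. e * real_of_int (z i)) - y) i\<bar> \<le> w)}"

lemma card_grid_box:
  assumes e: "e > 0"
  shows "finite (grid_box n e r w y)"
    and "real l \<le> 2 * w / e \<Longrightarrow> l ^ n \<le> card (grid_box n e r w y)"
    and "2 * w / e + 1 \<le> real l \<Longrightarrow> card (grid_box n e r w y) \<le> l ^ n"
proof -
  \<comment> \<open>Coordinate i of the sheared vector is \<open>e z_i - \<phi> i z\<close>, and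
    \<open>\<phi> i z\<close> involves only the coordinates of z after i. Hence the box is
    triangular.\<close>
  define \<phi> where "\<phi> = (\<lambda>i (z :: nat \<Rightarrow> int).
    y i - (\<Sum>k\<in>{1..<n}. (- ln r) ^ k / fact k * (e * real_of_int (z (i + k)) - y (i + k))))"
  define c where "c = (\<lambda>i z. \<lceil>(\<phi> i z - w) / e\<rceil>)"
  define B where "B = (\<lambda>l. {z. (\<forall>i\<ge>n. z i = 0) \<and> (\<forall>i<n. c i z \<le> z i \<and> z i < c i z + int l)})"
  have "c i z = c i z'" if "\<And>j. j > i \<Longrightarrow> z j = z' j" for i z z'
  proof -
    have "\<phi> i z = \<phi> i z'" unfolding \<phi>_def using that by (intro arg_cong2[where f="(-)"] sum.cong refl) simp
    then show ?thesis by (simp add: c_def)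
  qed
  then have B: "finite (B l)" "card (B l) = l ^ n" for l
    using card_triangular_box[of c n l] unfolding B_def by blast+
  have split: "nexp n (- ln r) ((\<lambda>i. e * real_of_int (z i)) - y) i = e * z i - \<phi> i z" if "n > 0" for z i
  proof -
    have "{..<n} = insert 0 {1..<n}" using that by auto
    then show ?thesis by (simp add: nexp_def \<phi>_def)
  qed
  have box: "grid_box n e r w y = {z. (\<forall>i\<ge>n. z i = 0) \<and>
     (\<forall>i<n. (\<phi> i z - w) / e \<le> z i \<and> z i \<le> (\<phi> i z - w) / e + 2 * w / e)}"
  proof -
    have "\<bar>e * real_of_int (z i) - \<phi> i z\<bar> \<le> w \<longleftrightarrow>
        (\<phi> i z - w) / e \<le> z i \<and> z i \<le> (\<phi> i z - w) / e + 2 * w / e" for i z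
    proof -
      have "(\<phi> i z - w) / e + 2 * w / e = (\<phi> i z + w) / e" by (simp flip: add_divide_distrib)
      then show ?thesis
        using e by (simp only: pos_le_divide_eq pos_divide_le_eq abs_le_iff) (auto simp: algebra_simps)
    qed
    then show ?thesis unfolding grid_box_def by (auto simp: split)
  qed
  have upper: "grid_box n e r w y \<subseteq> B l" if l: "2 * w / e + 1 \<le> real l" for l
  proof -
    have "c i z \<le> z i \<and> z i < c i z + int l"
      if "(\<phi> i z - w) / e \<le> z i" "z i \<le> (\<phi> i z - w) / e + 2 * w / e" for i z
      using that l unfolding c_def by linarith
    then show ?thesis unfolding box B_def by blast
  qed
  have lower: "B l \<subseteq> grid_box n e r w y" if l: "real l \<le> 2 * w / e" for l
  proof -
    have "(\<phi> i z - w) / e \<le> z i \<and> z i \<le> (\<phi> i z - w) / e + 2 * w / e"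
      if "c i z \<le> z i" "z i < c i z + int l" for i z
      using that l unfolding c_def by linarith
    then show ?thesis unfolding box B_def by blast
  qed
  show fin: "finite (grid_box n e r w y)"
    using upper[of "nat \<lceil>2 * w / e + 1\<rceil>"] B(1) finite_subset by (metis real_nat_ceiling_ge)
  show "l ^ n \<le> card (grid_box n e r w y)" if "real l \<le> 2 * w / e"
    using card_mono[OF fin lower[OF that]] B by simp
  show "card (grid_box n e r w y) \<le> l ^ n" if "2 * w / e + 1 \<le> real l"
    using card_mono[OF B(1) upper[OF that]] B by simp
qed

text \<open>Shears preserve volume, so a gauge ball of radius r has volume of order r^n. The balls
  of radius \<open>r g / (2M)\<close> about the points are disjoint by the quasi-triangle inequality
  and lie in the ball of radius \<open>M R\<close> about p; it remains to compare volumes, as grid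
  counts. Unequal radii are allowed because they will be oscillations of f at different
  places.\<close>

lemma weighted_packing:
  assumes n: "n > 0"
  shows "\<exists>C\<ge>1. \<forall>(G :: 'a set) y r R p. finite G \<longrightarrow> p \<in> Rn n \<longrightarrow> 0 \<le> R \<longrightarrow>
    (\<forall>g\<in>G. y g \<in> Rn n \<and> 0 < r g \<and> r g \<le> R \<and> rho n (y g - p) \<le> R) \<longrightarrow>
    (\<forall>g\<in>G. \<forall>h\<in>G. g \<noteq> h \<longrightarrow> r g \<le> rho n (y g - y h)) \<longrightarrow>
    (\<Sum>g\<in>G. r g ^ n) \<le> C * R ^ n"
proof -
  obtain M where M: "M \<ge> 1" "\<And>x y. x \<in> Rn n \<Longrightarrow> y \<in> Rn n \<Longrightarrow> rho n (x + y) \<le> M * max (rho n x) (rho n y)"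
    using rho_quasi_triangle[of n] by blast
  define c where "c = 1 / (2 * M)"
  have c: "c > 0" "c \<le> 1" "M * c < 1" using M(1) by (auto simp: c_def field_simps)
  define K where "K = 4 * M * real n / c"
  have "1 * 1 \<le> M * real n" using M(1) n by (intro mult_mono) auto
  then have K: "K \<ge> 1" using c by (simp add: K_def)
  have "(\<Sum>g\<in>G. r g ^ n) \<le> K ^ n * R ^ n"
    if G: "finite G" and p: "p \<in> Rn n" and R0: "0 \<le> R"
      and yr: "\<And>g. g \<in> G \<Longrightarrow> y g \<in> Rn n \<and> 0 < r g \<and> r g \<le> R \<and> rho n (y g - p) \<le> R"
      and sep: "\<And>g h. g \<in> G \<Longrightarrow> h \<in> G \<Longrightarrow> g \<noteq> h \<Longrightarrow> r g \<le> rho n (y g - y h)"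
    for G :: "'a set" and y r R p
  proof (cases "G = {}")
    case True
    then show ?thesis using K R0 by simp
  next
    case False
    then have R: "R > 0" using yr by force
    \<comment> \<open>This half-width puts the sheared cube inside the gauge ball of radius
      \<open>c r\<close>, since the norm is at most n times the largest coordinate.\<close>
    define w where "w = (\<lambda>g. c * r g / n)"
    \<comment> \<open>One mesh for all cubes, no larger than R or any half-width, so that rounding
      side lengths to integers costs only a factor 2.\<close>
    define e where "e = Min (insert R (w ` G))"
    have w: "w g > 0" if "g \<in> G" for g using that yr c n by (simp add: w_def)
    have e: "e > 0" using G R w by (auto simp: e_def)
    have ew: "e \<le> w g" if "g \<in> G" for g using that G by (auto simp: e_def)
    have eR: "e \<le> R" using G by (auto simp: e_def)
    have MR: "M * R > 0" "e \<le> M * R" using M(1) R eR by (auto intro: order_trans[OF eR])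
    define Q where "Q = (\<lambda>g. grid_box n e (c * r g) (w g) (y g))"
    define pt where "pt = (\<lambda>(z :: nat \<Rightarrow> int) i. e * real_of_int (z i))"
    have pt: "pt z \<in> Rn n" if "\<forall>i\<ge>n. z i = 0" for z using that by (auto simp: pt_def Rn_def)
    have near: "pt z \<in> Rn n \<and> rho n (pt z - y g) \<le> c * r g" if "g \<in> G" "z \<in> Q g" for g z
    proof -
      have z: "pt z \<in> Rn n" using that pt by (auto simp: Q_def grid_box_def)
      have "nrm n (nexp n (- ln (c * r g)) (pt z - y g)) \<le> real n * w g"
        using that by (intro nrm_le_bound) (auto simp: Q_def grid_box_def pt_def)
      also have "\<dots> = c * r g" using n by (simp add: w_def)
      finally show ?thesis using z that yr c by (subst rho_le_iff) auto
    qed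
    have disj: "Q g \<inter> Q h = {}" if gh: "g \<in> G" "h \<in> G" "g \<noteq> h" for g h
    proof (rule ccontr)
      assume "Q g \<inter> Q h \<noteq> {}"
      then obtain z where z: "z \<in> Q g" "z \<in> Q h" by blast
      have "rho n (y g - y h) = rho n ((pt z - y h) + - (pt z - y g))" by simp
      also have "\<dots> \<le> M * max (rho n (pt z - y h)) (rho n (- (pt z - y g)))"
        using near z gh yr by (intro M(2)) auto
      also have "\<dots> \<le> M * max (c * r h) (c * r g)"
        using near z gh M(1) unfolding rho_uminus by (intro mult_left_mono max.mono) auto
      also have "\<dots> = M * c * max (r h) (r g)" using c M(1) by (auto simp: max_def mult.assoc)
      also have "\<dots> < 1 * max (r h) (r g)"
        using c yr gh by (intro mult_strict_right_mono) (auto simp: less_max_iff_disj)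
      also have "\<dots> \<le> rho n (y g - y h)"
        using sep[OF gh] sep[OF gh(2,1) gh(3)[symmetric]] rho_commute[of n "y h" "y g"] by simp
      finally show False by simp
    qed
    have sub: "(\<Union>g\<in>G. Q g) \<subseteq> grid_box n e (M * R) (M * R) p"
    proof clarify
      fix g z assume g: "g \<in> G" "z \<in> Q g"
      have "rho n (pt z - p) = rho n ((pt z - y g) + (y g - p))" by simp
      also have "\<dots> \<le> M * max (rho n (pt z - y g)) (rho n (y g - p))"
        using near g yr p by (intro M(2)) auto
      also have "\<dots> \<le> M * R"
      proof -
        have "c * r g \<le> 1 * R" using yr[OF g(1)] c by (intro mult_mono) auto
        then show ?thesis using near[OF g] yr g M(1) by (intro mult_left_mono) auto
      qed
      finally have "nrm n (nexp n (- ln (M * R)) (pt z - p)) \<le> M * R"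
        using MR near[OF g] p by (subst (asm) rho_le_iff) auto
      then have "\<forall>i<n. \<bar>nexp n (- ln (M * R)) (pt z - p) i\<bar> \<le> M * R"
        using abs_le_nrm order_trans by blast
      then show "z \<in> grid_box n e (M * R) (M * R) p"
        using g by (auto simp: grid_box_def Q_def pt_def)
    qed
    have low: "(w g / e) ^ n \<le> real (card (Q g))" if "g \<in> G" for g
    proof -
      define l where "l = nat \<lfloor>2 * w g / e\<rfloor>"
      have ge1: "1 \<le> w g / e" using ew[OF that] e by simp
      have "w g / e \<le> real l" "real l \<le> 2 * w g / e" using ge1 unfolding l_def by linarith+
      then have "(w g / e) ^ n \<le> real l ^ n" using ge1 by (intro power_mono) auto
      also have "\<dots> \<le> real (card (Q g))"
        using card_grid_box(2)[OF e, of l "w g" n "c * r g" "y g"] \<open>real l \<le> _\<close>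
        unfolding Q_def by (metis of_nat_le_iff of_nat_power)
      finally show ?thesis .
    qed
    have high: "real (card (grid_box n e (M * R) (M * R) p)) \<le> (4 * M * R / e) ^ n"
    proof -
      define l where "l = nat \<lceil>2 * (M * R) / e + 1\<rceil>"
      have ge1: "1 \<le> M * R / e" using MR(2) e by simp
      have "real l \<le> 4 * M * R / e" "2 * (M * R) / e + 1 \<le> real l" using ge1 unfolding l_def by linarith+
      then have "real (card (grid_box n e (M * R) (M * R) p)) \<le> real l ^ n"
        using card_grid_box(3)[OF e, of "M * R" l n "M * R" p] by (metis of_nat_le_iff of_nat_power)
      also have "\<dots> \<le> (4 * M * R / e) ^ n" using \<open>real l \<le> _\<close> by (intro power_mono) auto
      finally show ?thesis .
    qed
    have "(\<Sum>g\<in>G. (w g / e) ^ n) \<le> (\<Sum>g\<in>G. real (card (Q g)))" by (intro sum_mono low)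
    also have "\<dots> = real (card (\<Union>g\<in>G. Q g))"
      using G disj card_grid_box(1)[OF e] by (subst card_UN_disjoint) (auto simp: Q_def)
    also have "\<dots> \<le> real (card (grid_box n e (M * R) (M * R) p))"
      using card_mono[OF card_grid_box(1)[OF e] sub] by simp
    also note high
    finally have "(\<Sum>g\<in>G. (w g / e) ^ n) \<le> (4 * M * R / e) ^ n" .
    moreover have "(w g / e) ^ n = r g ^ n * (c / (n * e)) ^ n" for g
      by (simp add: w_def field_simps flip: power_mult_distrib)
    moreover have "4 * M * R / e = K * R * (c / (n * e))"
      using c n by (simp add: K_def)
    then have "(4 * M * R / e) ^ n = (K ^ n * R ^ n) * (c / (n * e)) ^ n"
      by (simp only: power_mult_distrib)
    moreover have "(c / (n * e)) ^ n > 0" using c n e by simp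
    ultimately show ?thesis by (simp add: mult_le_cancel_right_pos flip: sum_distrib_right)
  qed
  note main = this
  show ?thesis
  proof (intro exI[of _ "K ^ n"] conjI allI impI)
    show "1 \<le> K ^ n" using K by simp
    fix G :: "'a set" and y r R p
    assume *: "finite G" "p \<in> Rn n" "(0::real) \<le> R"
      "\<forall>g\<in>G. y g \<in> Rn n \<and> 0 < r g \<and> r g \<le> R \<and> rho n (y g - p) \<le> R"
      "\<forall>g\<in>G. \<forall>h\<in>G. g \<noteq> h \<longrightarrow> r g \<le> rho n (y g - y h)"
    show "(\<Sum>g\<in>G. r g ^ n) \<le> K ^ n * R ^ n"
      by (rule main[OF *(1-3)]) (use *(4-5) in blast)+
  qed
qed

section \<open>Preservation of the hyperplanes\<close>

lemma rho_bounded: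
  assumes "c \<ge> 0"
  shows "\<exists>K\<ge>1. \<forall>v\<in>Rn n. (\<forall>i<n. \<bar>v i\<bar> \<le> c) \<longrightarrow> rho n v \<le> K"
proof -
  obtain K where K: "K \<ge> 1" "\<forall>x\<in>Rn n. \<forall>r>0. nrm n (nexp n (- ln r) x) \<le> (real n * c) * r \<longrightarrow> rho n x \<le> K * r"
    using rho_le_of_nrm[of "real n * c" n] assms by auto
  have "rho n v \<le> K" if "v \<in> Rn n" "\<forall>i<n. \<bar>v i\<bar> \<le> c" for v
    using K(2)[rule_format, of v 1] nrm_le_bound[of n v c] that by simp
  then show ?thesis using K(1) by blast
qed

lemma rho_small:
  assumes "r > 0"
  shows "\<exists>e>0. \<forall>v\<in>Rn n. (\<forall>i<n. \<bar>v i\<bar> \<le> e) \<longrightarrow> rho n v \<le> r"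
proof -
  define C where "C = (real n)\<^sup>2 * 2 ^ n * exp (\<bar>ln r\<bar> / 2) * real n + 1"
  have C: "C > 0" by (auto simp: C_def intro: add_nonneg_pos)
  have "rho n v \<le> r" if v: "v \<in> Rn n" and le: "\<forall>i<n. \<bar>v i\<bar> \<le> r / C" for v
  proof -
    have "nrm n (nexp n (- ln r) v) \<le> (real n)\<^sup>2 * 2 ^ n * exp (\<bar>ln r\<bar> / 2) * nrm n v"
      using nrm_nexp_le[OF v, of "- ln r"] by simp
    also have "\<dots> \<le> (real n)\<^sup>2 * 2 ^ n * exp (\<bar>ln r\<bar> / 2) * (real n * (r / C))"
      using le by (intro mult_left_mono nrm_le_bound) auto
    also have "\<dots> = (C - 1) * r / C" by (simp add: C_def)
    also have "\<dots> \<le> r" using C assms by (simp add: field_simps)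
    finally show ?thesis using v assms by (simp add: rho_le_iff)
  qed
  then show ?thesis using C assms by (intro exI[of _ "r / C"]) auto
qed

text \<open>The power mean inequality, from Bernoulli's inequality for \<open>R j / b\<close> with
  \<open>b = S / m\<close>: the linear lower bounds add up to at least m.\<close>

lemma sum_power_ge:
  fixes R :: "nat \<Rightarrow> real"
  assumes m: "m > 0" and R: "\<And>j. j < m \<Longrightarrow> R j \<ge> 0" and S: "S > 0" "S \<le> (\<Sum>j<m. R j)"
  shows "real m * (S / real m) ^ n \<le> (\<Sum>j<m. R j ^ n)"
proof -
  define b where "b = S / real m"
  have b: "b > 0" using m S by (simp add: b_def)
  have "real m + real n * (S / b - real m) \<le> real m + real n * ((\<Sum>j<m. R j) / b - real m)"
    using S b by (intro add_left_mono mult_left_mono diff_right_mono divide_right_mono) auto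
  also have "\<dots> = (\<Sum>j<m. 1 + real n * (R j / b - 1))"
    by (simp add: sum.distrib sum_subtractf sum_divide_distrib flip: sum_distrib_left)
  also have "\<dots> \<le> (\<Sum>j<m. (R j / b) ^ n)"
  proof (rule sum_mono)
    fix j assume "j \<in> {..<m}"
    then have "R j / b - 1 \<ge> -1" using R b by simp
    then show "1 + real n * (R j / b - 1) \<le> (R j / b) ^ n"
      using Bernoulli_inequality[of "R j / b - 1" n] by simp
  qed
  also have "\<dots> = (\<Sum>j<m. R j ^ n) / b ^ n"
    by (simp add: power_divide sum_divide_distrib)
  finally have "real m \<le> (\<Sum>j<m. R j ^ n) / b ^ n" using b m S by (simp add: b_def)
  then show ?thesis using b by (simp add: b_def[symmetric] field_simps)
qed

lemma half_le_nat_floor: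
  fixes x :: real
  assumes "1 \<le> x" shows "x / 2 \<le> real (nat \<lfloor>x\<rfloor>)" "real (nat \<lfloor>x\<rfloor>) \<le> x"
proof -
  have "real (nat \<lfloor>x\<rfloor>) = of_int \<lfloor>x\<rfloor>" using assms by simp
  note eq = this
  have "1 \<le> \<lfloor>x\<rfloor>" using assms by simp
  then have "1 \<le> real_of_int \<lfloor>x\<rfloor>" by simp
  then show "x / 2 \<le> real (nat \<lfloor>x\<rfloor>)" unfolding eq by linarith
  show "real (nat \<lfloor>x\<rfloor>) \<le> x" unfolding eq by linarith
qed

text \<open>All that is used of the gauge function \<eta>: its boundedness on compact sets, for f,
  and its smallness near 0, for the inverse, both turn into this condition. Large c are needed
  because quasi-triangle constants and sizes of regions enter as c.\<close>

definition weakly_qs :: "nat \<Rightarrow> ((nat \<Rightarrow> real) \<Rightarrow> nat \<Rightarrow> real) \<Rightarrow> bool" where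
  "weakly_qs n f \<longleftrightarrow> (\<forall>c. \<exists>H\<ge>1. \<forall>x\<in>Rn n. \<forall>y\<in>Rn n. \<forall>z\<in>Rn n.
     rho n (y - x) \<le> c * rho n (z - x) \<longrightarrow> rho n (f y - f x) \<le> H * rho n (f z - f x))"

lemma weakly_qsE:
  assumes "weakly_qs n f"
  obtains H where "H \<ge> 1" "\<And>x y z. x \<in> Rn n \<Longrightarrow> y \<in> Rn n \<Longrightarrow> z \<in> Rn n \<Longrightarrow>
     rho n (y - x) \<le> c * rho n (z - x) \<Longrightarrow> rho n (f y - f x) \<le> H * rho n (f z - f x)"
  using assms unfolding weakly_qs_def by meson

text \<open>The hypotheses are symmetric in f and its inverse g, so whatever is proved for f also
  holds for g by \<open>qs_pair_inverse\<close>.\<close>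

locale qs_pair =
  fixes n :: nat and f g :: "(nat \<Rightarrow> real) \<Rightarrow> nat \<Rightarrow> real"
  assumes n: "n \<ge> 2"
    and f_Rn [simp]: "x \<in> Rn n \<Longrightarrow> f x \<in> Rn n"
    and g_Rn [simp]: "x \<in> Rn n \<Longrightarrow> g x \<in> Rn n"
    and g_f [simp]: "x \<in> Rn n \<Longrightarrow> g (f x) = x"
    and f_g [simp]: "x \<in> Rn n \<Longrightarrow> f (g x) = x"
    and qs_f: "weakly_qs n f"
    and qs_g: "weakly_qs n g"
begin

lemma qs_pair_inverse: "qs_pair n g f"
  using n qs_f qs_g by unfold_locales auto

lemma f_inj: "x \<in> Rn n \<Longrightarrow> y \<in> Rn n \<Longrightarrow> f x = f y \<longleftrightarrow> x = y"
  by (metis g_f)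

lemma rho_basis_0 [simp]: "rho n (basis 0) = 1"
  using rho_dilate[of "basis 0" n 1] n by (simp add: scale_def)

text \<open>Quasisymmetry of g does the work. If f x were farther than a from f p, the distance of
  \<open>f w\<close> from \<open>f p\<close>, for the fixed point \<open>w = p + e_1\<close>, would
  be at most \<open>t / a\<close> times that of f x; then
  \<open>1 = rho n (w - p) \<le> H rho n (x - p)\<close> keeps x away from p.\<close>

lemma f_continuous:
  assumes p: "p \<in> Rn n" and a: "a > 0"
  shows "\<exists>e>0. \<forall>x\<in>Rn n. (\<forall>i<n. \<bar>x i - p i\<bar> \<le> e) \<longrightarrow> rho n (f x - f p) \<le> a"
proof -
  define w where "w = p + basis 0"
  have w: "w \<in> Rn n" using p n by (simp add: w_def)
  define t where "t = rho n (f w - f p)"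
  obtain H where H: "H \<ge> 1" "\<And>x y z. x \<in> Rn n \<Longrightarrow> y \<in> Rn n \<Longrightarrow> z \<in> Rn n \<Longrightarrow>
     rho n (y - x) \<le> (t / a) * rho n (z - x) \<Longrightarrow> rho n (g y - g x) \<le> H * rho n (g z - g x)"
    using weakly_qsE[OF qs_g, where c = "t / a"] by blast
  obtain e where e: "e > 0" "\<forall>v\<in>Rn n. (\<forall>i<n. \<bar>v i\<bar> \<le> e) \<longrightarrow> rho n v \<le> 1 / (2 * H)"
    using rho_small[of "1 / (2 * H)" n] H(1) by auto
  have "rho n (f x - f p) \<le> a" if x: "x \<in> Rn n" and close: "\<forall>i<n. \<bar>x i - p i\<bar> \<le> e" for x
  proof (rule ccontr)
    assume "\<not> rho n (f x - f p) \<le> a"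
    then have "t * a \<le> t * rho n (f x - f p)" by (intro mult_left_mono) (auto simp: t_def)
    then have "rho n (f w - f p) \<le> (t / a) * rho n (f x - f p)"
      using a by (simp add: t_def field_simps)
    then have "rho n (w - p) \<le> H * rho n (x - p)"
      using H(2)[of "f p" "f w" "f x"] x p w by simp
    then have "1 \<le> H * rho n (x - p)" by (simp add: w_def)
    also have "\<dots> \<le> H * (1 / (2 * H))"
      using e(2) close x p H(1) by (intro mult_left_mono) auto
    finally show False using H(1) by simp
  qed
  then show ?thesis using e(1) by blast
qed

lemma f_last_continuous:
  assumes p: "p \<in> Rn n" and a: "a > 0"
  shows "\<exists>e>0. \<forall>x\<in>Rn n. (\<forall>i<n. \<bar>x i - p i\<bar> \<le> e) \<longrightarrow> \<bar>f x (n - 1) - f p (n - 1)\<bar> \<le> a"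
proof -
  obtain e where "e > 0" and e: "\<forall>x\<in>Rn n. (\<forall>i<n. \<bar>x i - p i\<bar> \<le> e) \<longrightarrow> rho n (f x - f p) \<le> a"
    using f_continuous[OF assms] by blast
  moreover have "\<bar>f x (n - 1) - f p (n - 1)\<bar> \<le> rho n (f x - f p)" if "x \<in> Rn n" for x
    using abs_last_le_rho[of "f x - f p" n] that p by simp
  ultimately show ?thesis by (meson order_trans)
qed

text \<open>Consecutive points of a column need to match only in the coordinates \<open>\<ge> k\<close>, on which the last
  coordinate of \<open>f\<close> depends; the coordinates \<open>< k\<close> can be kept fixed. This keeps the columns in a
  bounded region, although the shear moves the lower coordinates much further than coordinate \<open>k\<close>.\<close>

lemma last_coord_step:
  assumes k: "Suc k < n"
    and indep: "\<And>x y. x \<in> Rn n \<Longrightarrow> y \<in> Rn n \<Longrightarrow> (\<And>i. i \<ge> k \<Longrightarrow> x i = y i) \<Longrightarrow> f x (n - 1) = f y (n - 1)"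
    and "x' \<in> Rn n" "y' \<in> Rn n" and agree: "\<And>i. i \<ge> Suc k \<Longrightarrow> x' i = y' i"
  shows "f x' (n - 1) = f y' (n - 1)"
proof (rule ccontr)
  define u where "u = (\<lambda>x. f x (n - 1))"
  assume "f x' (n - 1) \<noteq> f y' (n - 1)"
  define p where "p = x'"
  define s where "s = y' k - p k"
  \<comment> \<open>Below k the points x' and y' may differ, but by \<open>indep\<close> this does
    not affect u. So y' is replaced by a point that differs from p in coordinate k only.\<close>
  define q where "q = p + scale s (basis k)"
  have p: "p \<in> Rn n" and q: "q \<in> Rn n" using assms by (auto simp: p_def q_def)
  have "q i = y' i" if "i \<ge> k" for i
    using agree[of i] that by (cases "i = k") (auto simp: q_def s_def p_def basis_def)
  then have "u q = f y' (n - 1)" using indep q assms unfolding u_def by blast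
  then have upq: "u p \<noteq> u q" using \<open>f x' _ \<noteq> _\<close> by (simp add: u_def p_def)
  have s: "s \<noteq> 0" using upq by (auto simp: q_def scale_def plus_fun_def)
  define \<alpha> where "\<alpha> = \<bar>u q - u p\<bar>"
  have \<alpha>: "\<alpha> > 0" using upq by (simp add: \<alpha>_def)
  obtain \<epsilon> where \<epsilon>: "\<epsilon> > 0"
    and \<epsilon>p: "\<And>x. x \<in> Rn n \<Longrightarrow> (\<And>i. i < n \<Longrightarrow> \<bar>x i - p i\<bar> \<le> \<epsilon>) \<Longrightarrow> \<bar>u x - u p\<bar> \<le> \<alpha> / 4"
    and \<epsilon>q: "\<And>x. x \<in> Rn n \<Longrightarrow> (\<And>i. i < n \<Longrightarrow> \<bar>x i - q i\<bar> \<le> \<epsilon>) \<Longrightarrow> \<bar>u x - u q\<bar> \<le> \<alpha> / 4"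
  proof -
    obtain e1 e2 where "e1 > 0" "e2 > 0"
      "\<forall>x\<in>Rn n. (\<forall>i<n. \<bar>x i - p i\<bar> \<le> e1) \<longrightarrow> \<bar>u x - u p\<bar> \<le> \<alpha> / 4"
      "\<forall>x\<in>Rn n. (\<forall>i<n. \<bar>x i - q i\<bar> \<le> e2) \<longrightarrow> \<bar>u x - u q\<bar> \<le> \<alpha> / 4"
      using f_last_continuous[OF p, of "\<alpha> / 4"] f_last_continuous[OF q, of "\<alpha> / 4"] \<alpha>
      unfolding u_def by auto
    then show ?thesis by (intro that[of "min e1 e2"]) auto
  qed
  define d where "d = n - 1 - k"
  have d: "d \<ge> 1" using k by (simp add: d_def)
  \<comment> \<open>The power of -1 cancels the sign of \<open>(-T)^d\<close>, so that each step
    moves coordinate k from p towards q.\<close>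
  define \<sigma> :: real where "\<sigma> = sgn s * (-1) ^ d"
  have \<sigma>: "\<bar>\<sigma>\<bar> = 1" using s by (auto simp: \<sigma>_def abs_mult power_abs sgn_if)
  obtain M where M: "M \<ge> 1" "\<And>x y. x \<in> Rn n \<Longrightarrow> y \<in> Rn n \<Longrightarrow> rho n (x + y) \<le> M * max (rho n x) (rho n y)"
    using rho_quasi_triangle[of n] by blast
  obtain H1 where H1: "H1 \<ge> 1" "\<And>x y z. x \<in> Rn n \<Longrightarrow> y \<in> Rn n \<Longrightarrow> z \<in> Rn n \<Longrightarrow>
     rho n (y - x) \<le> 1 * rho n (z - x) \<Longrightarrow> rho n (f y - f x) \<le> H1 * rho n (f z - f x)"
    using weakly_qsE[OF qs_f, where c = "1"] by blast
  obtain c0 where c0: "c0 \<ge> 1" "\<And>v. v \<in> Rn n \<Longrightarrow> (\<And>i. i < n \<Longrightarrow> \<bar>v i\<bar> \<le> \<bar>s\<bar> + \<epsilon>) \<Longrightarrow> rho n v \<le> c0"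
    using rho_bounded[of "\<bar>s\<bar> + \<epsilon>" n] \<epsilon> by auto
  obtain H2 where H2: "H2 \<ge> 1" "\<And>x y z. x \<in> Rn n \<Longrightarrow> y \<in> Rn n \<Longrightarrow> z \<in> Rn n \<Longrightarrow>
     rho n (y - x) \<le> (M * c0) * rho n (z - x) \<Longrightarrow> rho n (f y - f x) \<le> H2 * rho n (f z - f x)"
    using weakly_qsE[OF qs_f, where c = "M * c0"] by blast
  \<comment> \<open>A bound for the image of the whole region of the columns: every point within
    \<open>M c0\<close> of p is compared with \<open>p + e_1\<close>, which is at distance
    1.\<close>
  define R0 where "R0 = H2 * rho n (f (p + basis 0) - f p)"
  have R0_nonneg: "R0 \<ge> 0" using H2(1) by (simp add: R0_def)
  have R0: "rho n (f x - f p) \<le> R0" if "x \<in> Rn n" "rho n (x - p) \<le> M * c0" for x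
    unfolding R0_def using H2(2)[of p x "p + basis 0"] that p n by simp
  obtain C where C: "C \<ge> 1"
    and pack: "\<forall>(G :: ((nat \<Rightarrow> nat) \<times> nat \<times> nat) set) y r R p. finite G \<longrightarrow> p \<in> Rn n \<longrightarrow> 0 \<le> R \<longrightarrow>
      (\<forall>g\<in>G. y g \<in> Rn n \<and> 0 < r g \<and> r g \<le> R \<and> rho n (y g - p) \<le> R) \<longrightarrow>
      (\<forall>g\<in>G. \<forall>h\<in>G. g \<noteq> h \<longrightarrow> r g \<le> rho n (y g - y h)) \<longrightarrow>
      (\<Sum>g\<in>G. r g ^ n) \<le> C * R ^ n"
    using weighted_packing[of n, where 'a = "(nat \<Rightarrow> nat) \<times> nat \<times> nat"] n by auto
  \<comment> \<open>The packing inequality for one fixed T. The left side grows linearly in T, so a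
    large T gives the contradiction. The conditions on T keep the mesh, one step and the sideways
    drift of a column small against \<epsilon> and |s|.\<close>
  have bounded: "\<epsilon> * \<alpha> * T / (8 * H1 * (\<bar>s\<bar> * fact d)) \<le> C * (M * R0)"
    if T: "T \<ge> 1" and T1: "T ^ d * exp (- T) \<le> \<epsilon> / 2" and T2: "T ^ d * exp (- T) \<le> \<bar>s\<bar>"
      and T3: "\<bar>s\<bar> * fact d / T \<le> \<epsilon> / 2" for T
  proof -
    define \<delta> where "\<delta> = exp (- T)"
    have \<delta>: "\<delta> > 0" by (simp add: \<delta>_def)
    have Td: "T \<le> T ^ d" using T d by (metis power_increasing power_one_right)
    have "\<delta> \<le> T ^ d * \<delta>" using T \<delta> by simp
    also have "\<dots> \<le> \<epsilon> / 2" using T1 by (simp add: \<delta>_def)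
    finally have \<delta>le: "\<delta> \<le> \<epsilon> / 2" .
    have \<delta>1: "\<delta> \<le> 1" using T by (simp add: \<delta>_def)
    \<comment> \<open>The advance in coordinate k per step; m steps lead from p to within h of
      q.\<close>
    define h where "h = \<delta> * T ^ d / fact d"
    have h: "h > 0" using \<delta> T by (simp add: h_def)
    have "h \<le> \<delta> * T ^ d / 1" unfolding h_def using \<delta> T by (intro divide_left_mono) auto
    then have h_le: "h \<le> \<epsilon> / 2" "h \<le> \<bar>s\<bar>" using T1 T2 by (auto simp: \<delta>_def mult.commute)
    define m where "m = nat \<lfloor>\<bar>s\<bar> / h\<rfloor>"
    have "1 \<le> \<bar>s\<bar> / h" using h h_le by simp
    then have m: "m \<ge> 1" and "real m \<le> \<bar>s\<bar> / h" "\<bar>s\<bar> / h < real m + 1" unfolding m_def by linarith+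
    then have mh: "real m * h \<le> \<bar>s\<bar>" "\<bar>s\<bar> - real m * h \<le> h" using h by (simp_all add: field_simps)
    have m\<delta>: "real m * \<delta> * T ^ d \<le> \<bar>s\<bar> * fact d" using mh(1) by (simp add: h_def field_simps)
    \<comment> \<open>In the coordinates after k a step is at most of order
      \<open>\<delta> T^i\<close> with \<open>i < d\<close>, so a whole column drifts there by at
      most a multiple of 1/T.\<close>
    have m\<delta>i: "real m * \<delta> * T ^ i \<le> \<epsilon> / 2" if "i < d" for i
    proof -
      have "T ^ Suc i \<le> T ^ d" using T that by (intro power_increasing) auto
      then have "real m * \<delta> * (T ^ i * T) \<le> real m * \<delta> * T ^ d"
        using \<delta> by (intro mult_left_mono) (auto simp: mult.commute)
      then have "real m * \<delta> * T ^ i * T \<le> real m * \<delta> * T ^ d" by (simp only: mult.assoc)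
      also note m\<delta>
      finally have "real m * \<delta> * T ^ i \<le> \<bar>s\<bar> * fact d / T" using T by (simp add: field_simps)
      then show ?thesis using T3 by linarith
    qed
    have m\<delta>1: "real m * \<delta> \<le> \<epsilon> / 2" using m\<delta>i[of 0] d by simp
    \<comment> \<open>A counts the starting values in each coordinate before the last, with spacing
      \<delta>. B counts those in the last one, where a single column already occupies m consecutive
      multiples of \<delta>.\<close>
    define A where "A = nat \<lfloor>\<epsilon> / (2 * \<delta>)\<rfloor>"
    define B where "B = nat \<lfloor>\<epsilon> / (2 * (real m * \<delta>))\<rfloor>"
    have "1 \<le> \<epsilon> / (2 * \<delta>)" using \<delta>le \<delta> by (simp add: field_simps)
    then have A: "\<epsilon> / (4 * \<delta>) \<le> real A" and "real A \<le> \<epsilon> / (2 * \<delta>)"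
      using half_le_nat_floor[of "\<epsilon> / (2 * \<delta>)"] by (simp_all add: A_def)
    then have A\<delta>: "real A * \<delta> \<le> \<epsilon> / 2" using \<delta> by (simp add: field_simps)
    have "1 \<le> \<epsilon> / (2 * (real m * \<delta>))" using m\<delta>1 \<delta> m by (simp add: field_simps)
    then have B: "\<epsilon> / (4 * (real m * \<delta>)) \<le> real B" and "real B \<le> \<epsilon> / (2 * (real m * \<delta>))"
      using half_le_nat_floor[of "\<epsilon> / (2 * (real m * \<delta>))"] by (simp_all add: B_def)
    then have B\<delta>: "real B * real m * \<delta> \<le> \<epsilon> / 2" using \<delta> m by (simp add: field_simps)
    define w where "w = scale \<delta> (nexp n (- T) (scale \<sigma> (basis (n - 1))))"
    have w: "w \<in> Rn n" using n by (simp add: w_def)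
    have rho_w: "rho n w = \<delta>"
      unfolding w_def using rho_dilate[of "scale \<sigma> (basis (n - 1))" n \<delta>] n \<delta> \<sigma> by (simp add: nrm_scale \<delta>_def)
    have w_i: "w i = \<sigma> * \<delta> * ((- T) ^ (n - 1 - i) / fact (n - 1 - i))" if "i < n" for i
      using that n by (simp add: w_def nexp_scale nexp_basis)
    have w_abs: "\<bar>w i\<bar> = \<delta> * (T ^ (n - 1 - i) / fact (n - 1 - i))" if "i < n" for i
      using that \<sigma> \<delta> T by (simp add: w_i abs_mult power_abs)
    have w_last: "w (n - 1) = \<sigma> * \<delta>" using w_i[of "n - 1"] n by simp
    have w_k: "w k = sgn s * h"
    proof -
      have "(-1 :: real) ^ d * (- T) ^ d = T ^ d" by (simp flip: power_mult_distrib)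
      moreover have "w k = sgn s * \<delta> * ((-1) ^ d * (- T) ^ d) / fact d"
      proof -
        have "n - 1 - k = d" by (simp add: d_def)
        then show ?thesis using k w_i[of k] by (simp only: \<sigma>_def) simp
      qed
      ultimately show ?thesis by (simp add: h_def)
    qed
    have w_small: "real m * \<bar>w i\<bar> \<le> \<epsilon> / 2" if "i < n" "i > k" for i
    proof -
      have "\<bar>w i\<bar> \<le> \<delta> * T ^ (n - 1 - i)"
      proof -
        have "T ^ (n - 1 - i) / fact (n - 1 - i) \<le> T ^ (n - 1 - i) / 1"
          using T by (intro divide_left_mono) auto
        then show ?thesis unfolding w_abs[OF that(1)] using \<delta> by (intro mult_left_mono) auto
      qed
      then have "real m * \<bar>w i\<bar> \<le> real m * \<delta> * T ^ (n - 1 - i)"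
        by (simp add: mult.assoc mult_left_mono)
      moreover have "real m * \<delta> * T ^ (n - 1 - i) \<le> \<epsilon> / 2"
      proof (rule m\<delta>i)
        show "n - 1 - i < d" unfolding d_def using that by arith
      qed
      ultimately show ?thesis by linarith
    qed
    \<comment> \<open>Column (a, b), step j. Coordinates before k keep their starting value; from k
      to the one before the last they follow w. In the last one \<open>b m + j\<close> takes
      distinct values for distinct (b, j), so such points differ there by at least \<delta>.\<close>
    define x where "x = (\<lambda>(a :: nat \<Rightarrow> nat, b :: nat, j :: nat) i.
      if i < k then p i + \<delta> * real (a i)
      else if i < n - 1 then p i + \<delta> * real (a i) + real j * w i
      else if i = n - 1 then p i + real (b * m + j) * w i else 0)"
    define G where "G = PiE {..<n-1} (\<lambda>_. {..<A}) \<times> {..<B} \<times> {..<m}"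
    have finG: "finite G" by (auto simp: G_def intro: finite_PiE)
    have x: "x (a, b, j) \<in> Rn n" for a b j using k by (auto simp: x_def Rn_def)
    have x_Suc: "u (x (a, b, Suc j)) = u (x (a, b, j) + w)" for a b j
    proof -
      have "x (a, b, Suc j) i = (x (a, b, j) + w) i" if "i \<ge> k" for i
        using that w by (auto simp: x_def algebra_simps Rn_def)
      then show ?thesis unfolding u_def using x w by (intro indep) auto
    qed
    have start: "\<bar>x (a, b, 0) i - p i\<bar> \<le> \<epsilon>" and finish: "\<bar>x (a, b, m) i - q i\<bar> \<le> \<epsilon>"
      and between: "j \<le> m \<Longrightarrow> \<bar>x (a, b, j) i - p i\<bar> \<le> \<bar>s\<bar> + \<epsilon>"
      if a: "a \<in> PiE {..<n-1} (\<lambda>_. {..<A})" and b: "b < B" and i: "i < n" for a b i j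
    proof -
      define \<beta> where "\<beta> = (if i < n - 1 then \<delta> * real (a i) else real (b * m) * w (n - 1))"
      have \<beta>: "\<bar>\<beta>\<bar> \<le> \<epsilon> / 2"
      proof (cases "i < n - 1")
        case True
        then have "a i < A" using PiE_mem[OF a, of i] by simp
        then have "real (a i) * \<delta> \<le> real A * \<delta>" using \<delta> by (intro mult_right_mono) auto
        moreover have "\<bar>\<beta>\<bar> = real (a i) * \<delta>" using True \<delta> by (simp add: \<beta>_def)
        ultimately show ?thesis using A\<delta> by linarith
      next
        case False
        have "real b * (real m * \<delta>) \<le> real B * (real m * \<delta>)"
          using b \<delta> by (intro mult_right_mono) auto
        moreover have "\<bar>\<beta>\<bar> = real b * (real m * \<delta>)"
          unfolding \<beta>_def w_last using False \<delta> \<sigma> by (simp add: abs_mult)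
        ultimately show ?thesis using B\<delta> by (simp only: mult.assoc)
      qed
      have x_i: "x (a, b, j) i = p i + \<beta> + (if i < k then 0 else real j * w i)" for j
      proof (cases "i < n - 1")
        case True
        then show ?thesis by (simp add: x_def \<beta>_def)
      next
        case False
        then have "i = n - 1" "\<not> i < k" using i k by linarith+
        then show ?thesis by (simp add: x_def \<beta>_def algebra_simps)
      qed
      have jw: "\<bar>real j * w i\<bar> \<le> \<epsilon> / 2" if "j \<le> m" "i > k" for j
      proof -
        have "\<bar>real j * w i\<bar> \<le> real m * \<bar>w i\<bar>" using that by (simp add: abs_mult mult_right_mono)
        then show ?thesis using w_small[OF i that(2)] by linarith
      qed
      have jwk: "\<bar>real j * w k\<bar> \<le> \<bar>s\<bar>" if "j \<le> m" for j
      proof -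
        have "\<bar>real j * w k\<bar> = real j * h" using s h by (simp add: w_k abs_mult)
        also have "\<dots> \<le> real m * h" using that h by (intro mult_right_mono) auto
        finally show ?thesis using mh by simp
      qed
      have endk: "\<bar>real m * w k - s\<bar> \<le> \<epsilon> / 2"
      proof -
        have "real m * w k - s = sgn s * (real m * h - \<bar>s\<bar>)" by (simp add: w_k algebra_simps abs_mult_sgn)
        then have "\<bar>real m * w k - s\<bar> = \<bar>s\<bar> - real m * h" using s mh by (simp add: abs_mult)
        then show ?thesis using mh h_le by simp
      qed
      have "x (a, b, 0) i - p i = \<beta>" by (simp add: x_i)
      then show "\<bar>x (a, b, 0) i - p i\<bar> \<le> \<epsilon>" using \<beta> \<epsilon> by linarith
      consider "i < k" | "i = k" | "k < i" by linarith
      then show "\<bar>x (a, b, m) i - q i\<bar> \<le> \<epsilon>"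
      proof cases
        case 1
        then have "x (a, b, m) i - q i = \<beta>" by (simp add: x_i q_def basis_def)
        then show ?thesis using \<beta> \<epsilon> by linarith
      next
        case 2
        then have "x (a, b, m) i - q i = \<beta> + (real m * w k - s)"
          using x_i[of m] by (simp add: q_def basis_def)
        then show ?thesis using \<beta> endk by linarith
      next
        case 3
        then have "x (a, b, m) i - q i = \<beta> + real m * w i" by (simp add: x_i q_def basis_def)
        then show ?thesis using \<beta> jw[of m] 3 by linarith
      qed
      show "\<bar>x (a, b, j) i - p i\<bar> \<le> \<bar>s\<bar> + \<epsilon>" if "j \<le> m"
      proof -
        have "x (a, b, j) i - p i = \<beta> + (if i < k then 0 else real j * w i)" by (simp add: x_i)
        moreover have "\<bar>if i < k then 0 else real j * w i\<bar> \<le> \<bar>s\<bar> + \<epsilon> / 2"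
          using jw[OF that] jwk[OF that] \<epsilon> by (cases "i < k"; cases "i = k") auto
        ultimately show ?thesis using \<beta> by linarith
      qed
    qed
    have near: "rho n (x (a, b, j) - p) \<le> c0"
      if "a \<in> PiE {..<n-1} (\<lambda>_. {..<A})" "b < B" "j \<le> m" for a b j
      using that x p between by (intro c0(2)) auto
    \<comment> \<open>If (b, j) differs, the last coordinates are \<delta> apart. Otherwise the
      multiples of w cancel, and the last index at which a and a' differ is that of the topmost
      nonzero coordinate of the difference.\<close>
    have sep: "\<delta> \<le> rho n (x g - x g')" if g: "g \<in> G" "g' \<in> G" "g \<noteq> g'" for g g'
    proof -
      obtain a b j a' b' j' where gg: "g = (a, b, j)" "g' = (a', b', j')" by (metis prod_cases3)
      have jj: "j < m" "j' < m" using g by (auto simp: gg G_def)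
      define v where "v = x g - x g'"
      have v: "v \<in> Rn n" using x by (simp add: v_def gg)
      show ?thesis
      proof (cases "b * m + j = b' * m + j'")
        case False
        then have "1 \<le> \<bar>real (b * m + j) - real (b' * m + j')\<bar>" by linarith
        then have "\<delta> \<le> \<bar>real (b * m + j) - real (b' * m + j')\<bar> * \<delta>" using \<delta> by simp
        also have "\<dots> = \<bar>v (n - 1)\<bar>"
        proof -
          have "\<not> n - 1 < k" using k by linarith
          then have "v (n - 1) = (real (b * m + j) - real (b' * m + j')) * w (n - 1)"
            unfolding v_def gg x_def by (simp add: left_diff_distrib)
          then show ?thesis unfolding w_last using \<sigma> \<delta> by (simp add: abs_mult)
        qed
        also have "\<dots> \<le> rho n v" by (rule abs_last_le_rho[OF v])
        finally show ?thesis by (simp add: v_def)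
      next
        case True
        have "(b * m + j) mod m = (b' * m + j') mod m" "(b * m + j) div m = (b' * m + j') div m"
          using True by auto
        then have bj: "b = b'" "j = j'" using jj by auto
        then have "a \<noteq> a'" using g gg by auto
        then have ne: "{i \<in> {..<n-1}. a i \<noteq> a' i} \<noteq> {}"
          using g gg by (auto simp: G_def dest: PiE_ext)
        define l where "l = Max {i \<in> {..<n-1}. a i \<noteq> a' i}"
        have l: "l < n - 1" "a l \<noteq> a' l" using Max_in[OF _ ne] by (auto simp: l_def)
        have vi: "v i = (if i < n - 1 then \<delta> * (real (a i) - real (a' i)) else 0)" for i
          using k by (auto simp: v_def x_def gg bj algebra_simps)
        have "v i = 0" if "i > l" for i
        proof -
          have "i \<le> l" if "i < n - 1" "a i \<noteq> a' i"
            unfolding l_def by (intro Max_ge) (use that in auto)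
          then show ?thesis using that by (auto simp: vi)
        qed
        then have "\<bar>v l\<bar> \<le> rho n v" by (intro abs_top_le_rho v)
        moreover have "1 \<le> \<bar>real (a l) - real (a' l)\<bar>" using l by linarith
        then have "\<delta> \<le> \<bar>v l\<bar>" using l \<delta> by (simp add: vi abs_mult)
        ultimately show ?thesis by (simp add: v_def)
      qed
    qed
    \<comment> \<open>The oscillation of f over the step w. As \<open>rho n w = \<delta>\<close> is
      at most the distance to any other point of G, the factor 1/H1 makes r a lower bound for the
      distance between images, as packing requires.\<close>
    define r where "r = (\<lambda>g. rho n (f (x g + w) - f (x g)) / H1)"
    have total: "(\<Sum>g\<in>G. r g ^ n) \<le> C * (M * R0) ^ n"
    proof (rule pack[rule_format, where y = "\<lambda>g. f (x g)" and p = "f p"])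
      show "finite G" by (rule finG)
      show "f p \<in> Rn n" using p by simp
      show "0 \<le> M * R0" using M(1) R0_nonneg by simp
    next
      fix g assume g: "g \<in> G"
      then obtain a b j where gg: "g = (a, b, j)" "a \<in> PiE {..<n-1} (\<lambda>_. {..<A})" "b < B" "j \<le> m"
        by (auto simp: G_def)
      have xg: "x g \<in> Rn n" using x gg by simp
      have "x g + w \<noteq> x g" using rho_w \<delta> by auto
      then have "f (x g + w) \<noteq> f (x g)" using xg w f_inj by auto
      then have pos: "0 < r g" using H1 by (auto simp: r_def)
      have "rho n (x g - p) \<le> 1 * c0" using near gg by auto
      also have "\<dots> \<le> M * c0" using M(1) c0 by (intro mult_right_mono) auto
      finally have r1: "rho n (f (x g) - f p) \<le> R0" using R0 xg by simp
      have "rho n (x g + w - p) = rho n ((x g - p) + w)" by (simp add: algebra_simps)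
      also have "\<dots> \<le> M * max (rho n (x g - p)) (rho n w)" using xg p w by (intro M(2)) auto
      also have "\<dots> \<le> M * c0"
        using M(1) near gg \<delta>1 c0 by (intro mult_left_mono) (auto simp: rho_w)
      finally have r2: "rho n (f (x g + w) - f p) \<le> R0" using R0 xg w by simp
      have "rho n (f (x g + w) - f (x g)) = rho n ((f (x g + w) - f p) + - (f (x g) - f p))" by simp
      also have "\<dots> \<le> M * max (rho n (f (x g + w) - f p)) (rho n (- (f (x g) - f p)))"
        using xg w p by (intro M(2)) auto
      also have "\<dots> \<le> M * R0" using r1 r2 M(1) unfolding rho_uminus by (intro mult_left_mono) auto
      finally have "rho n (f (x g + w) - f (x g)) \<le> M * R0" .
      moreover have "r g \<le> rho n (f (x g + w) - f (x g))"
        using divide_left_mono[of 1 H1 "rho n (f (x g + w) - f (x g))"] H1(1) by (simp add: r_def)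
      moreover have "R0 \<le> M * R0" using M(1) R0_nonneg mult_right_mono[of 1 M R0] by simp
      ultimately show "f (x g) \<in> Rn n \<and> 0 < r g \<and> r g \<le> M * R0 \<and> rho n (f (x g) - f p) \<le> M * R0"
        using xg pos r1 by auto
    next
      fix g g' assume g: "g \<in> G" "g' \<in> G" "g \<noteq> g'"
      have xg: "x g \<in> Rn n" "x g' \<in> Rn n" using x by (metis prod_cases3)+
      have "rho n (x g + w - x g) \<le> 1 * rho n (x g' - x g)"
        using sep[OF g] rho_w by (simp add: rho_commute)
      then have "rho n (f (x g + w) - f (x g)) \<le> H1 * rho n (f (x g') - f (x g))"
        using xg w by (intro H1(2)) auto
      then show "r g \<le> rho n (f (x g) - f (x g'))"
        using H1(1) by (simp add: r_def field_simps rho_commute)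
    qed
    \<comment> \<open>At the ends of a column u is within \<alpha>/4 of its values at p and q, so it
      changes by at least \<alpha>/2 in between. Its change over one step is at most
      \<open>H1 r\<close>, since the last coordinate is 1-Lipschitz for the gauge.\<close>
    have chain: "real m * (\<alpha> / (2 * H1) / real m) ^ n \<le> (\<Sum>j<m. r (a, b, j) ^ n)"
      if ab: "a \<in> PiE {..<n-1} (\<lambda>_. {..<A})" "b < B" for a b
    proof (rule sum_power_ge)
      show "m > 0" using m by simp
      show "0 \<le> r (a, b, j)" for j using H1 by (simp add: r_def)
      show "0 < \<alpha> / (2 * H1)" using \<alpha> H1 by simp
      have "\<bar>u (x (a, b, 0)) - u p\<bar> \<le> \<alpha> / 4" "\<bar>u (x (a, b, m)) - u q\<bar> \<le> \<alpha> / 4"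
        by (rule \<epsilon>p[OF x] \<epsilon>q[OF x]; rule start[OF ab] finish[OF ab]; assumption)+
      moreover have "\<bar>u q - u p\<bar> \<le> \<bar>u (x (a, b, m)) - u q\<bar> + \<bar>u (x (a, b, m)) - u p\<bar>"
        using abs_triangle_ineq4[of "u (x (a, b, m)) - u p" "u (x (a, b, m)) - u q"] by simp
      moreover have "\<bar>u (x (a, b, m)) - u p\<bar>
          \<le> \<bar>u (x (a, b, m)) - u (x (a, b, 0))\<bar> + \<bar>u (x (a, b, 0)) - u p\<bar>"
        using abs_triangle_ineq[of "u (x (a, b, m)) - u (x (a, b, 0))" "u (x (a, b, 0)) - u p"] by simp
      ultimately have "\<alpha> / 2 \<le> \<bar>u (x (a, b, m)) - u (x (a, b, 0))\<bar>"
        using \<alpha>_def by linarith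
      also have "\<dots> = \<bar>\<Sum>j<m. u (x (a, b, Suc j)) - u (x (a, b, j))\<bar>"
        using sum_lessThan_telescope[of "\<lambda>j. u (x (a, b, j))" m] by simp
      also have "\<dots> \<le> (\<Sum>j<m. \<bar>u (x (a, b, Suc j)) - u (x (a, b, j))\<bar>)"
        by (rule sum_abs)
      also have "\<dots> \<le> (\<Sum>j<m. H1 * r (a, b, j))"
      proof (rule sum_mono)
        fix j
        have "f (x (a, b, j) + w) - f (x (a, b, j)) \<in> Rn n" by (intro Rn_diff f_Rn Rn_add x w)
        from abs_last_le_rho[OF this] show "\<bar>u (x (a, b, Suc j)) - u (x (a, b, j))\<bar> \<le> H1 * r (a, b, j)"
          unfolding x_Suc using H1 by (simp add: r_def u_def)
      qed
      finally show "\<alpha> / (2 * H1) \<le> (\<Sum>j<m. r (a, b, j))"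
        using H1 by (simp add: field_simps flip: sum_distrib_left)
    qed
    have "real A ^ (n - 1) * (real B * (real m * (\<alpha> / (2 * H1) / real m) ^ n))
        = (\<Sum>a\<in>PiE {..<n-1} (\<lambda>_. {..<A}). \<Sum>b<B. real m * (\<alpha> / (2 * H1) / real m) ^ n)"
      by (simp add: card_PiE)
    also have "\<dots> \<le> (\<Sum>a\<in>PiE {..<n-1} (\<lambda>_. {..<A}). \<Sum>b<B. \<Sum>j<m. r (a, b, j) ^ n)"
      using chain by (intro sum_mono) auto
    also have "\<dots> = (\<Sum>g\<in>G. r g ^ n)"
      unfolding G_def by (simp add: sum.cartesian_product split_def)
    also note total
    finally have "real A ^ (n - 1) * (real B * (real m * (\<alpha> / (2 * H1) / real m) ^ n)) \<le> C * (M * R0) ^ n" .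
    moreover have "(\<epsilon> / (4 * \<delta>)) ^ (n - 1) * (\<epsilon> / (4 * (real m * \<delta>)) * (real m * (\<alpha> / (2 * H1) / real m) ^ n))
        \<le> real A ^ (n - 1) * (real B * (real m * (\<alpha> / (2 * H1) / real m) ^ n))"
      using A B \<epsilon> \<delta> \<alpha> H1 by (intro mult_mono power_mono mult_nonneg_nonneg zero_le_power) auto
    moreover have "(\<epsilon> / (4 * \<delta>)) ^ (n - 1) * (\<epsilon> / (4 * (real m * \<delta>)) * (real m * (\<alpha> / (2 * H1) / real m) ^ n))
        = (\<epsilon> * \<alpha> / (8 * H1 * (real m * \<delta>))) ^ n"
    proof -
      have "\<epsilon> / (4 * (real m * \<delta>)) * (real m * z) = \<epsilon> / (4 * \<delta>) * z" for z
        using m by simp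
      then have "(\<epsilon> / (4 * \<delta>)) ^ (n - 1) * (\<epsilon> / (4 * (real m * \<delta>)) * (real m * (\<alpha> / (2 * H1) / real m) ^ n))
        = (\<epsilon> / (4 * \<delta>)) ^ (n - 1) * (\<epsilon> / (4 * \<delta>) * (\<alpha> / (2 * H1) / real m) ^ n)"
        by (simp only:)
      also have "\<dots> = (\<epsilon> / (4 * \<delta>)) ^ Suc (n - 1) * (\<alpha> / (2 * H1) / real m) ^ n"
        by (simp only: power_Suc mult_ac)
      also have "Suc (n - 1) = n" using n by simp
      finally show ?thesis by (simp add: mult_ac flip: power_mult_distrib)
    qed
    moreover have "C * (M * R0) ^ n \<le> (C * (M * R0)) ^ n"
    proof -
      have "C ^ 1 \<le> C ^ n" using C n by (intro power_increasing) auto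
      then show ?thesis using M(1) R0_nonneg by (simp add: power_mult_distrib mult_right_mono)
    qed
    ultimately have "(\<epsilon> * \<alpha> / (8 * H1 * (real m * \<delta>))) ^ n \<le> (C * (M * R0)) ^ n" by linarith
    then have le: "\<epsilon> * \<alpha> / (8 * H1 * (real m * \<delta>)) \<le> C * (M * R0)"
      using C M(1) R0_nonneg n by (subst (asm) power_mono_iff) (use \<epsilon> \<alpha> H1 \<delta> in auto)
    have "real m * \<delta> * T \<le> real m * \<delta> * T ^ d" using Td \<delta> by (intro mult_left_mono) auto
    then have mT: "real m * \<delta> \<le> \<bar>s\<bar> * fact d / T" using m\<delta> T by (simp add: field_simps)
    have "\<epsilon> * \<alpha> * T / (8 * H1 * (\<bar>s\<bar> * fact d)) = \<epsilon> * \<alpha> / (8 * H1 * (\<bar>s\<bar> * fact d / T))"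
      using T by simp
    also have "\<dots> \<le> \<epsilon> * \<alpha> / (8 * H1 * (real m * \<delta>))"
      using mT m \<delta> \<epsilon> \<alpha> H1 s T by (intro divide_left_mono mult_left_mono mult_pos_pos) auto
    also note le
    finally show ?thesis .
  qed
  have lim: "((\<lambda>T::real. T ^ d * exp (- T)) \<longlongrightarrow> 0) at_top"
    using tendsto_power_div_exp_0[of d] by (simp add: exp_minus divide_inverse)
  have lim': "((\<lambda>T. \<bar>s\<bar> * fact d / T) \<longlongrightarrow> 0) at_top"
    by (intro tendsto_divide_0[OF tendsto_const] filterlim_at_top_imp_at_infinity filterlim_ident)
  define K where "K = C * (M * R0) * (8 * H1 * (\<bar>s\<bar> * fact d)) / (\<epsilon> * \<alpha>)"
  have "eventually (\<lambda>T. T > K \<and> T \<ge> 1 \<and> T ^ d * exp (- T) < \<epsilon> / 2 \<and> T ^ d * exp (- T) < \<bar>s\<bar>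
      \<and> \<bar>s\<bar> * fact d / T < \<epsilon> / 2) (at_top :: real filter)"
    using \<epsilon> s
    by (intro eventually_conj eventually_gt_at_top eventually_ge_at_top order_tendstoD(2)[OF lim]
        order_tendstoD(2)[OF lim']) auto
  from eventually_happens[OF this] obtain T where T: "T > K" "T \<ge> 1" "T ^ d * exp (- T) < \<epsilon> / 2" "T ^ d * exp (- T) < \<bar>s\<bar>"
      "\<bar>s\<bar> * fact d / T < \<epsilon> / 2"
    by auto
  then have "\<epsilon> * \<alpha> * T / (8 * H1 * (\<bar>s\<bar> * fact d)) \<le> C * (M * R0)" by (intro bounded) auto
  then have "T \<le> K" using \<epsilon> \<alpha> H1 s unfolding K_def by (simp add: field_simps)
  then show False using T(1) by simp
qed

text \<open>Starting from points that agree everywhere, each application of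
  \<open>last_coord_step\<close> frees one more coordinate, until only the last is left.\<close>

lemma last_coord_indep:
  assumes "x \<in> Rn n" "y \<in> Rn n" "x (n - 1) = y (n - 1)"
  shows "f x (n - 1) = f y (n - 1)"
proof -
  have main: "k < n \<Longrightarrow> x \<in> Rn n \<Longrightarrow> y \<in> Rn n \<Longrightarrow> (\<And>i. i \<ge> k \<Longrightarrow> x i = y i) \<Longrightarrow>
      f x (n - 1) = f y (n - 1)" for k x y
  proof (induction k arbitrary: x y)
    case 0
    then have "x = y" by auto
    then show ?case by simp
  next
    case (Suc k)
    show ?case
    proof (rule last_coord_step[OF Suc.prems(1) _ Suc.prems(2,3)])
      show "f x (n - 1) = f y (n - 1)" if "x \<in> Rn n" "y \<in> Rn n" "\<And>i. i \<ge> k \<Longrightarrow> x i = y i" for x y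
        by (rule Suc.IH[OF Suc_lessD[OF Suc.prems(1)] that])
    qed (rule Suc.prems(4))
  qed
  have "x i = y i" if "i \<ge> n - 1" for i
    using that assms by (cases "i = n - 1") (auto simp: Rn_def)
  then show ?thesis using main[of "n - 1" x y] assms n by auto
qed

end

section \<open>Quasisymmetric maps are Lipschitz\<close>

context qs_pair begin

text \<open>Let x be the preimage of \<open>f p + v\<close>, where v has the same last coordinate as
  \<open>f q - f p\<close> and gauge d equal to its absolute value. As g also preserves the
  hyperplanes, x lies in the hyperplane of q, hence is at least as far from p as q is. Weak
  quasisymmetry then bounds \<open>rho n (f q - f p)\<close> by \<open>H1 d\<close>.\<close>

lemma vertical_step:
  assumes H1: "H1 \<ge> 1" "\<And>x y z. x \<in> Rn n \<Longrightarrow> y \<in> Rn n \<Longrightarrow> z \<in> Rn n \<Longrightarrow>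
     rho n (y - x) \<le> 1 * rho n (z - x) \<Longrightarrow> rho n (f y - f x) \<le> H1 * rho n (f z - f x)"
    and p: "p \<in> Rn n" and r: "r > 0"
  defines "q \<equiv> p + scale r (nexp n (ln r) (basis (n - 1)))"
  shows "rho n (q - p) = r" and "rho n (f q - f p) \<le> H1 * \<bar>f q (n - 1) - f p (n - 1)\<bar>"
proof -
  interpret inv: qs_pair n g f by (rule qs_pair_inverse)
  have q: "q \<in> Rn n" using p n by (simp add: q_def)
  show rho_q: "rho n (q - p) = r"
    using rho_dilate[of "basis (n - 1)" n r] n r by (simp add: q_def)
  have q_last: "q (n - 1) = p (n - 1) + r"
    using n by (simp add: q_def nexp_basis)
  define d where "d = \<bar>f q (n - 1) - f p (n - 1)\<bar>"
  define \<sigma> where "\<sigma> = sgn (f q (n - 1) - f p (n - 1))"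
  have "f q (n - 1) \<noteq> f p (n - 1)"
    using inv.last_coord_indep[of "f q" "f p"] p q q_last r by auto
  then have d: "d > 0" and \<sigma>: "\<bar>\<sigma>\<bar> = 1" by (auto simp: d_def \<sigma>_def sgn_if)
  define v where "v = scale d (nexp n (ln d) (scale \<sigma> (basis (n - 1))))"
  have v: "v \<in> Rn n" using n by (simp add: v_def)
  have rho_v: "rho n v = d"
    unfolding v_def using n d \<sigma> by (intro rho_dilate) (auto simp: nrm_scale)
  have v_last: "v (n - 1) = f q (n - 1) - f p (n - 1)"
  proof -
    have "v (n - 1) = d * \<sigma>" using n by (simp add: v_def nexp_scale nexp_basis)
    then show ?thesis by (simp add: d_def \<sigma>_def abs_mult_sgn)
  qed
  define x where "x = g (f p + v)"
  have x: "x \<in> Rn n" using p v by (simp add: x_def)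
  have "g (f p + v) (n - 1) = g (f q) (n - 1)"
    using p q v v_last by (intro inv.last_coord_indep) auto
  then have "x (n - 1) = p (n - 1) + r" using q q_last by (simp add: x_def)
  moreover have "\<bar>(x - p) (n - 1)\<bar> \<le> rho n (x - p)"
    using x p by (intro abs_last_le_rho Rn_diff)
  ultimately have "rho n (q - p) \<le> 1 * rho n (x - p)" using rho_q r by simp
  then have "rho n (f q - f p) \<le> H1 * rho n (f x - f p)"
    using H1(2) p q x by blast
  also have "f x - f p = v" using p v by (simp add: x_def)
  finally show "rho n (f q - f p) \<le> H1 * \<bar>f q (n - 1) - f p (n - 1)\<bar>"
    by (simp only: rho_v d_def)
qed

text \<open>The base points p and p' are compared through vertical steps of equal length. Since
  hyperplanes go to hyperplanes, the images of these steps change the last coordinate by the same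
  amount, and by \<open>vertical_step\<close> this amount controls the gauge of the image.\<close>

lemma same_hyperplane_qs:
  "\<exists>H\<ge>1. \<forall>p\<in>Rn n. \<forall>p'\<in>Rn n. \<forall>z\<in>Rn n. \<forall>z'\<in>Rn n. p (n - 1) = p' (n - 1) \<longrightarrow> z' \<noteq> p' \<longrightarrow>
     rho n (z - p) \<le> rho n (z' - p') \<longrightarrow> rho n (f z - f p) \<le> H * rho n (f z' - f p')"
proof -
  obtain H1 where H1: "H1 \<ge> 1" "\<And>x y z. x \<in> Rn n \<Longrightarrow> y \<in> Rn n \<Longrightarrow> z \<in> Rn n \<Longrightarrow>
     rho n (y - x) \<le> 1 * rho n (z - x) \<Longrightarrow> rho n (f y - f x) \<le> H1 * rho n (f z - f x)"
    using weakly_qsE[OF qs_f, where c = 1] by blast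
  have "rho n (f z - f p) \<le> (H1 * H1 * H1) * rho n (f z' - f p')"
    if pz: "p \<in> Rn n" "p' \<in> Rn n" "z \<in> Rn n" "z' \<in> Rn n" and same: "p (n - 1) = p' (n - 1)"
      and ne: "z' \<noteq> p'" and le: "rho n (z - p) \<le> rho n (z' - p')" for p p' z z'
  proof -
    define r where "r = rho n (z' - p')"
    have r: "r > 0" using ne by (simp add: r_def)
    define s where "s = scale r (nexp n (ln r) (basis (n - 1)))"
    have s: "s \<in> Rn n" using n by (simp add: s_def)
    have step: "rho n (p + s - p) = r" "rho n (f (p + s) - f p) \<le> H1 * \<bar>f (p + s) (n - 1) - f p (n - 1)\<bar>"
      and step': "rho n (p' + s - p') = r"
      using vertical_step[OF H1, of p r] vertical_step(1)[OF H1, of p' r] pz r unfolding s_def by blast+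
    have H1_mono: "H1 * a \<le> H1 * b" if "a \<le> b" for a b
      using that H1(1) by (intro mult_left_mono) auto
    have "rho n (f z - f p) \<le> H1 * rho n (f (p + s) - f p)"
      using le step pz s by (intro H1(2)) (auto simp: r_def)
    also have "\<dots> \<le> H1 * (H1 * \<bar>f (p + s) (n - 1) - f p (n - 1)\<bar>)"
      by (rule H1_mono[OF step(2)])
    also have "\<bar>f (p + s) (n - 1) - f p (n - 1)\<bar> = \<bar>f (p' + s) (n - 1) - f p' (n - 1)\<bar>"
      using last_coord_indep[of p p'] last_coord_indep[of "p + s" "p' + s"] pz s same by simp
    also have "H1 * (H1 * \<bar>f (p' + s) (n - 1) - f p' (n - 1)\<bar>) \<le> H1 * (H1 * rho n (f (p' + s) - f p'))"
      using abs_last_le_rho[of "f (p' + s) - f p'" n] pz s by (intro H1_mono) simp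
    also have "H1 * (H1 * rho n (f (p' + s) - f p')) \<le> H1 * (H1 * (H1 * rho n (f z' - f p')))"
    proof (intro H1_mono)
      show "rho n (f (p' + s) - f p') \<le> H1 * rho n (f z' - f p')"
        using step' pz s by (intro H1(2)) (auto simp: r_def)
    qed
    finally show ?thesis by (simp only: mult.assoc)
  qed
  moreover have "1 * 1 * 1 \<le> H1 * H1 * H1" using H1(1) by (intro mult_mono) auto
  then have "H1 * H1 * H1 \<ge> 1" by simp
  ultimately show ?thesis by blast
qed

text \<open>Let r and r' be the two distances. The hyperplane through p contains about
  \<open>(r'/r)^(n-1)\<close> points that are r-separated and within a multiple of r' of p. Their
  images lie again in one hyperplane, are separated by a multiple of
  \<open>rho n (f z - f p)\<close> by \<open>same_hyperplane_qs\<close>, and stay within a multiple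
  of \<open>rho n (f z' - f p)\<close> of f p. Packing in dimension n-1 has the same exponent on
  both sides, so taking roots leaves a linear estimate.\<close>

lemma scale_growth:
  "\<exists>C\<ge>1. \<forall>p\<in>Rn n. \<forall>z\<in>Rn n. \<forall>z'\<in>Rn n. z \<noteq> p \<longrightarrow> rho n (z - p) \<le> rho n (z' - p) \<longrightarrow>
     rho n (f z - f p) * rho n (z' - p) \<le> C * (rho n (f z' - f p) * rho n (z - p))"
proof -
  have n1: "n - 1 > 0" using n by simp
  obtain H where H: "H \<ge> 1" "\<forall>p\<in>Rn n. \<forall>p'\<in>Rn n. \<forall>z\<in>Rn n. \<forall>z'\<in>Rn n. p (n - 1) = p' (n - 1) \<longrightarrow> z' \<noteq> p' \<longrightarrow>
     rho n (z - p) \<le> rho n (z' - p') \<longrightarrow> rho n (f z - f p) \<le> H * rho n (f z' - f p')"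
    using same_hyperplane_qs by blast
  obtain K where K: "K \<ge> 1" "\<forall>x\<in>Rn n. \<forall>r>0. nrm n (nexp n (- ln r) x) \<le> real n * r \<longrightarrow> rho n x \<le> K * r"
    using rho_le_of_nrm[of "real n" n] by auto
  obtain H' where H': "H' \<ge> 1" "\<And>x y z. x \<in> Rn n \<Longrightarrow> y \<in> Rn n \<Longrightarrow> z \<in> Rn n \<Longrightarrow>
     rho n (y - x) \<le> K * rho n (z - x) \<Longrightarrow> rho n (f y - f x) \<le> H' * rho n (f z - f x)"
    using weakly_qsE[OF qs_f, where c = K] by blast
  obtain C where C: "C \<ge> 1"
    and pack: "\<forall>(G :: (nat \<Rightarrow> nat) set) y r R p. finite G \<longrightarrow> p \<in> Rn (n - 1) \<longrightarrow> 0 \<le> R \<longrightarrow>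
      (\<forall>g\<in>G. y g \<in> Rn (n - 1) \<and> 0 < r g \<and> r g \<le> R \<and> rho (n - 1) (y g - p) \<le> R) \<longrightarrow>
      (\<forall>g\<in>G. \<forall>h\<in>G. g \<noteq> h \<longrightarrow> r g \<le> rho (n - 1) (y g - y h)) \<longrightarrow>
      (\<Sum>g\<in>G. r g ^ (n - 1)) \<le> C * R ^ (n - 1)"
    using weighted_packing[OF n1, where 'a = "nat \<Rightarrow> nat"] by blast
  have "rho n (f z - f p) * rho n (z' - p) \<le> (2 * H * C * H') * (rho n (f z' - f p) * rho n (z - p))"
    if pz: "p \<in> Rn n" "z \<in> Rn n" "z' \<in> Rn n" and ne: "z \<noteq> p" and le: "rho n (z - p) \<le> rho n (z' - p)" for p z z'
  proof -
    define r where "r = rho n (z - p)"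
    define r' where "r' = rho n (z' - p)"
    have r: "r > 0" "r \<le> r'" "r' > 0" 
    proof -
      show "r > 0" "r \<le> r'" using ne le by (simp_all add: r_def r'_def)
      then show "r' > 0" by linarith
    qed
    define A where "A = nat \<lfloor>r' / r\<rfloor>"
    have "1 \<le> r' / r" using r by simp
    then have A: "r' / r / 2 \<le> real A" "real A \<le> r' / r"
      using half_le_nat_floor[of "r' / r"] unfolding A_def by blast+
    define v where "v = (\<lambda>a :: nat \<Rightarrow> nat. \<lambda>i. if i < n - 1 then r * real (a i) else 0)"
    have v: "v a \<in> Rn (n - 1)" for a by (auto simp: v_def Rn_def)
    have v': "v a \<in> Rn n" for a using Rn_mono[OF v] by simp
    \<comment> \<open>Shearing the grid as at scale r' keeps it in a gauge ball of radius
      \<open>K r'\<close>; the topmost coordinate of a difference is untouched, so the points stay r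
      apart.\<close>
    define x where "x = (\<lambda>a. p + nexp n (ln r') (v a))"
    have x: "x a \<in> Rn n" for a using pz v' by (simp add: x_def)
    have x_last: "x a (n - 1) = p (n - 1)" for a
      using nexp_last[OF v'] n by (simp add: x_def v_def)
    define y where "y = (\<lambda>a. f (x a) - f p)"
    have y: "y a \<in> Rn (n - 1)" for a
    proof -
      have "y a \<in> Rn n" "y a (n - 1) = 0"
        using last_coord_indep[OF x pz(1) x_last, of a] x pz by (auto simp: y_def)
      then have "y a i = 0" if "i \<ge> n - 1" for i
        using that n by (cases "i = n - 1") (auto simp: Rn_def)
      then show ?thesis by (auto simp: Rn_def)
    qed
    define G where "G = PiE {..<n-1} (\<lambda>_. {..<A})"
    define \<rho> where "\<rho> = rho n (f z - f p)"
    define R where "R = H' * rho n (f z' - f p)"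
    have \<rho>: "\<rho> > 0" using ne pz f_inj by (auto simp: \<rho>_def)
    have R: "R \<ge> 0" using H' by (simp add: R_def)
    have "(\<Sum>a\<in>G. (\<rho> / H) ^ (n - 1)) \<le> C * R ^ (n - 1)"
    proof (rule pack[rule_format, where y = y and p = 0])
      show "finite G" by (auto simp: G_def intro: finite_PiE)
      show "0 \<in> Rn (n - 1)" "0 \<le> R" using R by auto
    next
      fix a assume a: "a \<in> G"
      have "nrm n (v a) \<le> real n * r'"
      proof (rule nrm_le_bound)
        fix i
        have "r * real (a i) \<le> r'" if "i < n - 1"
        proof -
          have "a i < A" using PiE_mem[of a "{..<n-1}" "\<lambda>_. {..<A}" i] a that by (simp add: G_def)
          then have "r * real (a i) \<le> r * real A" using r by simp
          also have "\<dots> \<le> r'" using A(2) r by (simp add: field_simps)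
          finally show ?thesis .
        qed
        then show "\<bar>v a i\<bar> \<le> r'" using r by (simp add: v_def)
      qed
      then have "rho n (x a - p) \<le> K * r'"
        using K(2)[rule_format, of "x a - p" r'] x pz r v' by (simp add: x_def nexp_nexp)
      then have "rho n (y a) \<le> R"
        unfolding y_def R_def using x pz by (intro H'(2)) (auto simp: r'_def)
      moreover have "rho n (z - p) \<le> K * rho n (z' - p)"
      proof -
        have "1 * r' \<le> K * r'" using r K(1) by (intro mult_right_mono) auto
        then show ?thesis using r unfolding r_def r'_def by linarith
      qed
      then have "\<rho> \<le> R" unfolding \<rho>_def R_def using pz by (intro H'(2)) auto
      moreover have "\<rho> / H \<le> \<rho>" using divide_left_mono[of 1 H \<rho>] H(1) \<rho> by simp
      ultimately show "y a \<in> Rn (n - 1) \<and> 0 < \<rho> / H \<and> \<rho> / H \<le> R \<and> rho (n - 1) (y a - 0) \<le> R"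
        using y H(1) \<rho> rho_eq_larger[OF y, of n a] by simp
    next
      fix a a' assume a: "a \<in> G" "a' \<in> G" "a \<noteq> a'"
      have ne: "{i \<in> {..<n-1}. a i \<noteq> a' i} \<noteq> {}"
        using a by (auto simp: G_def dest: PiE_ext)
      define l where "l = Max {i \<in> {..<n-1}. a i \<noteq> a' i}"
      have l: "l < n - 1" "a l \<noteq> a' l" using Max_in[OF _ ne] by (auto simp: l_def)
      have above: "(v a - v a') i = 0" if "i > l" for i
      proof -
        have "i \<le> l" if "i < n - 1" "a i \<noteq> a' i"
          unfolding l_def by (intro Max_ge) (use that in auto)
        then show ?thesis using that by (auto simp: v_def)
      qed
      have diff: "x a - x a' = nexp n (ln r') (v a - v a')"
        by (simp add: x_def nexp_diff)
      have "(x a - x a') l = r * (real (a l) - real (a' l))"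
        unfolding diff using n l above by (subst nexp_top) (auto simp: v_def algebra_simps)
      moreover have "1 \<le> \<bar>real (a l) - real (a' l)\<bar>" using l by linarith
      ultimately have "r \<le> \<bar>(x a - x a') l\<bar>" using r by (simp add: abs_mult del: minus_apply)
      also have "\<dots> \<le> rho n (x a - x a')"
      proof (rule abs_top_le_rho)
        show "x a - x a' \<in> Rn n" using x by simp
        show "(x a - x a') i = 0" if "i > l" for i
          unfolding diff nexp_def by (intro sum.neutral) (use above that in auto)
      qed
      finally have far: "r \<le> rho n (x a - x a')" .
      then have "x a \<noteq> x a'" using r by auto
      then have "\<rho> \<le> H * rho n (f (x a) - f (x a'))"
        unfolding \<rho>_def using far H(2)[rule_format, OF pz(1) x[of a'] pz(2) x[of a]] x_last[of a'] \<open>x a \<noteq> x a'\<close>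
        by (simp add: r_def)
      moreover have "f (x a) - f (x a') = y a - y a'" by (simp add: y_def)
      moreover have "rho n (y a - y a') = rho (n - 1) (y a - y a')"
        using y by (intro rho_eq_larger) auto
      ultimately show "\<rho> / H \<le> rho (n - 1) (y a - y a')"
        using H(1) by (simp add: field_simps)
    qed
    moreover have "(\<Sum>a\<in>G. (\<rho> / H) ^ (n - 1)) = (real A * (\<rho> / H)) ^ (n - 1)"
      unfolding power_mult_distrib by (simp add: G_def card_PiE)
    moreover have "C * R ^ (n - 1) \<le> (C * R) ^ (n - 1)"
    proof -
      have "C ^ 1 \<le> C ^ (n - 1)" using C n1 by (intro power_increasing) auto
      then show ?thesis using R by (simp add: power_mult_distrib mult_right_mono)
    qed
    ultimately have "(real A * (\<rho> / H)) ^ (n - 1) \<le> (C * R) ^ (n - 1)" by simp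
    then have "real A * (\<rho> / H) \<le> C * R"
      using C R \<rho> H(1) n1 by (subst (asm) power_mono_iff) auto
    moreover have "r' / r / 2 * (\<rho> / H) \<le> real A * (\<rho> / H)"
      using A \<rho> H(1) by (intro mult_right_mono) auto
    ultimately have "r' / r / 2 * (\<rho> / H) \<le> C * R" by simp
    then have "\<rho> * r' \<le> 2 * H * C * R * r"
      using r H(1) by (simp add: field_simps)
    then show ?thesis by (simp add: \<rho>_def r'_def r_def R_def mult_ac)
  qed
  moreover have "2 * H * C * H' \<ge> 1"
  proof -
    have "1 * 1 * 1 \<le> H * C * H'" using H(1) C H'(1) by (intro mult_mono) auto
    then show ?thesis by simp
  qed
  ultimately show ?thesis by blast
qed

text \<open>\<open>scale_growth\<close> for f covers the case where z is the nearer point, and for g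
  the case where f z' is the nearer image. Otherwise both factors on the left are the smaller
  ones.\<close>

lemma ratio_comparable:
  "\<exists>C\<ge>1. \<forall>p\<in>Rn n. \<forall>z\<in>Rn n. \<forall>z'\<in>Rn n. z \<noteq> p \<longrightarrow> z' \<noteq> p \<longrightarrow>
     rho n (f z - f p) * rho n (z' - p) \<le> C * (rho n (f z' - f p) * rho n (z - p))"
proof -
  interpret inv: qs_pair n g f by (rule qs_pair_inverse)
  obtain C1 where C1: "C1 \<ge> 1" "\<forall>p\<in>Rn n. \<forall>z\<in>Rn n. \<forall>z'\<in>Rn n. z \<noteq> p \<longrightarrow> rho n (z - p) \<le> rho n (z' - p) \<longrightarrow>
     rho n (f z - f p) * rho n (z' - p) \<le> C1 * (rho n (f z' - f p) * rho n (z - p))"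
    using scale_growth by blast
  obtain C2 where C2: "C2 \<ge> 1" "\<forall>p\<in>Rn n. \<forall>z\<in>Rn n. \<forall>z'\<in>Rn n. z \<noteq> p \<longrightarrow> rho n (z - p) \<le> rho n (z' - p) \<longrightarrow>
     rho n (g z - g p) * rho n (z' - p) \<le> C2 * (rho n (g z' - g p) * rho n (z - p))"
    using inv.scale_growth by blast
  have "rho n (f z - f p) * rho n (z' - p) \<le> max C1 C2 * (rho n (f z' - f p) * rho n (z - p))"
    if pz: "p \<in> Rn n" "z \<in> Rn n" "z' \<in> Rn n" and ne: "z \<noteq> p" "z' \<noteq> p" for p z z'
  proof -
    have mono: "c * (rho n (f z' - f p) * rho n (z - p)) \<le> max C1 C2 * (rho n (f z' - f p) * rho n (z - p))"
      if "c \<le> max C1 C2" for c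
      using that by (intro mult_right_mono) auto
    consider "rho n (z - p) \<le> rho n (z' - p)" | "rho n (f z' - f p) \<le> rho n (f z - f p)"
      | "rho n (z' - p) \<le> rho n (z - p)" "rho n (f z - f p) \<le> rho n (f z' - f p)" by linarith
    then show ?thesis
    proof cases
      case 1
      have "rho n (f z - f p) * rho n (z' - p) \<le> C1 * (rho n (f z' - f p) * rho n (z - p))"
        using C1(2) pz ne 1 by blast
      also note mono[of C1]
      finally show ?thesis by simp
    next
      case 2
      have "rho n (g (f z') - g (f p)) * rho n (f z - f p) \<le> C2 * (rho n (g (f z) - g (f p)) * rho n (f z' - f p))"
        using pz ne 2 by (intro C2(2)[rule_format]) (auto simp: f_inj)
      then have "rho n (f z - f p) * rho n (z' - p) \<le> C2 * (rho n (f z' - f p) * rho n (z - p))"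
        using pz by (simp add: mult_ac)
      also note mono[of C2]
      finally show ?thesis by simp
    next
      case 3
      have "rho n (f z - f p) * rho n (z' - p) \<le> 1 * (rho n (f z' - f p) * rho n (z - p))"
        using mult_mono[OF 3(2,1)] by simp
      also note mono[of 1]
      finally show ?thesis using C1(1) by (simp add: le_max_iff_disj)
    qed
  qed
  moreover have "max C1 C2 \<ge> 1" using C1(1) by simp
  ultimately show ?thesis by blast
qed

text \<open>The stretch of f is comparable for any two pairs with a common point. Going from
  \<open>(0, e_1)\<close> to (0, p) and then to (p, z) bounds it uniformly.\<close>

lemma rho_lipschitz:
  "\<exists>K>0. \<forall>p\<in>Rn n. \<forall>z\<in>Rn n. rho n (f z - f p) \<le> K * rho n (z - p)"
proof -
  obtain C where C: "C \<ge> 1" "\<forall>p\<in>Rn n. \<forall>z\<in>Rn n. \<forall>z'\<in>Rn n. z \<noteq> p \<longrightarrow> z' \<noteq> p \<longrightarrow>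
     rho n (f z - f p) * rho n (z' - p) \<le> C * (rho n (f z' - f p) * rho n (z - p))"
    using ratio_comparable by blast
  define \<kappa> where "\<kappa> = rho n (f (basis 0) - f 0)"
  have b: "basis 0 \<in> Rn n" "basis 0 \<noteq> 0"
    using n by simp (auto simp: basis_def fun_eq_iff)
  have \<kappa>: "\<kappa> > 0" using b f_inj[of "basis 0" 0] by (simp add: \<kappa>_def)
  have at0: "rho n (f p - f 0) \<le> C * \<kappa> * rho n p" if "p \<in> Rn n" for p
  proof (cases "p = 0")
    case False
    have "rho n (f p - f 0) * rho n (basis 0 - 0) \<le> C * (rho n (f (basis 0) - f 0) * rho n (p - 0))"
      using that b False by (intro C(2)[rule_format]) auto
    then show ?thesis by (simp add: \<kappa>_def mult_ac)
  qed simp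
  have "rho n (f z - f p) \<le> C * C * \<kappa> * rho n (z - p)" if pz: "p \<in> Rn n" "z \<in> Rn n" for p z
  proof (cases "p = 0 \<or> z = p")
    case True
    have "1 * (C * \<kappa>) \<le> C * (C * \<kappa>)" using C(1) \<kappa> by (intro mult_right_mono) auto
    then have "C * \<kappa> * rho n z \<le> C * C * \<kappa> * rho n z" 
      using mult_right_mono[of "C * \<kappa>" "C * (C * \<kappa>)" "rho n z"] by (simp add: mult_ac)
    then show ?thesis using True at0[OF pz(2)] by auto
  next
    case False
    have "rho n (f z - f p) * rho n (0 - p) \<le> C * (rho n (f 0 - f p) * rho n (z - p))"
      using pz False by (intro C(2)[rule_format]) auto
    also have "\<dots> = C * rho n (z - p) * rho n (f p - f 0)"
      by (simp add: rho_commute[of n "f 0"])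
    also have "\<dots> \<le> C * rho n (z - p) * (C * \<kappa> * rho n p)"
      using at0[OF pz(1)] C(1) by (intro mult_left_mono) auto
    finally have "rho n (f z - f p) * rho n p \<le> (C * C * \<kappa> * rho n (z - p)) * rho n p"
      by (simp add: mult_ac)
    then show ?thesis using False by (subst (asm) mult_le_cancel_right_pos) auto
  qed
  moreover have "C * C * \<kappa> > 0" using C(1) \<kappa> by simp
  ultimately show ?thesis by blast
qed

end

definition coarse_lipschitz :: "nat \<Rightarrow> ((nat \<Rightarrow> real) \<Rightarrow> nat \<Rightarrow> real) \<Rightarrow> bool" where
  "coarse_lipschitz n f \<longleftrightarrow> (\<exists>K\<ge>0. \<forall>T\<ge>0. \<forall>x\<in>Rn n. \<forall>y\<in>Rn n.
     nrm n (nexp n T (f x - f y)) \<le> K * (nrm n (nexp n T (x - y)) + exp (- T)))"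

text \<open>At scale \<open>exp (- T)\<close> the function \<open>rho\<close> is comparable to the norm of \<open>nexp n T\<close>;
  subdividing a segment into pieces of that size removes the logarithmic distortion.\<close>

lemma coarse_lipschitz_of_rho_lipschitz:
  assumes f: "\<And>x. x \<in> Rn n \<Longrightarrow> f x \<in> Rn n"
    and K: "K > 0" "\<forall>p\<in>Rn n. \<forall>z\<in>Rn n. rho n (f z - f p) \<le> K * rho n (z - p)"
  shows "coarse_lipschitz n f"
proof -
  obtain K1 where K1: "K1 \<ge> 1" "\<forall>x\<in>Rn n. \<forall>r>0. rho n x \<le> K * r \<longrightarrow> nrm n (nexp n (- ln r) x) \<le> K1 * r"
    using nrm_le_of_rho[OF K(1)] by blast
  have "nrm n (nexp n T (f x - f p)) \<le> (2 * K1) * (nrm n (nexp n T (x - p)) + exp (- T))"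
    if x: "x \<in> Rn n" and p: "p \<in> Rn n" for T x p
  proof -
    define \<delta> where "\<delta> = exp (- T)"
    have \<delta>: "\<delta> > 0" "- ln \<delta> = T" by (auto simp: \<delta>_def)
    define len where "len = nrm n (nexp n T (x - p))"
    have len: "len \<ge> 0" by (simp add: len_def)
    \<comment> \<open>Each piece then has norm at most \<delta> after the shear; the added 1 keeps m
      positive when \<open>len\<close> is 0.\<close>
    define m where "m = nat \<lceil>len / \<delta>\<rceil> + 1"
    have "0 \<le> len / \<delta>" using len \<delta> by simp
    then have "len / \<delta> \<le> real m" "real m \<le> len / \<delta> + 2" unfolding m_def by linarith+
    then have m: "m > 0" "len \<le> real m * \<delta>" "real m * \<delta> \<le> len + 2 * \<delta>"
      using \<delta> by (auto simp: m_def field_simps)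
    define q where "q = (\<lambda>j :: nat. p + scale (real j / real m) (x - p))"
    have q: "q j \<in> Rn n" for j using x p by (simp add: q_def)
    have step: "nrm n (nexp n T (f (q (Suc j)) - f (q j))) \<le> K1 * \<delta>" for j
    proof -
      have "q (Suc j) - q j = scale (1 / real m) (x - p)"
      proof
        fix i
        have "real (Suc j) / real m - real j / real m = 1 / real m"
          by (simp flip: diff_divide_distrib)
        moreover have "(q (Suc j) - q j) i = (real (Suc j) / real m - real j / real m) * (x i - p i)"
          by (simp only: q_def left_diff_distrib plus_fun_apply minus_apply scale_apply)
        ultimately show "(q (Suc j) - q j) i = scale (1 / real m) (x - p) i"
          by (simp only: scale_apply minus_apply)
      qed
      then have "nrm n (nexp n (- ln \<delta>) (q (Suc j) - q j)) = len / real m"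
        by (simp add: nexp_scale nrm_scale \<delta>(2) len_def)
      also have "\<dots> \<le> \<delta>" using m by (simp add: field_simps)
      finally have "rho n (q (Suc j) - q j) \<le> \<delta>"
        using q \<delta> by (subst rho_le_iff) auto
      then have "K * rho n (q (Suc j) - q j) \<le> K * \<delta>" using K(1) by simp
      then have "rho n (f (q (Suc j)) - f (q j)) \<le> K * \<delta>"
        using K(2) q order_trans by blast
      then show ?thesis using K1(2)[rule_format, of "f (q (Suc j)) - f (q j)" \<delta>] \<delta> q f by simp
    qed
    have "nrm n (nexp n T (f (q j) - f (q 0))) \<le> real j * (K1 * \<delta>)" for j
    proof (induction j)
      case (Suc j)
      have "f (q (Suc j)) - f (q 0) = (f (q (Suc j)) - f (q j)) + (f (q j) - f (q 0))" by simp
      then have "nrm n (nexp n T (f (q (Suc j)) - f (q 0)))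
          \<le> nrm n (nexp n T (f (q (Suc j)) - f (q j))) + nrm n (nexp n T (f (q j) - f (q 0)))"
        by (simp only: nexp_add nrm_triangle)
      also have "\<dots> \<le> K1 * \<delta> + real j * (K1 * \<delta>)" using step[of j] Suc.IH by linarith
      finally show ?case by (simp add: algebra_simps fun_diff_def)
    next
      case 0
      show ?case by (simp add: nexp_def nrm_def L2_set_def)
    qed
    from this[of m] have "nrm n (nexp n T (f x - f p)) \<le> real m * (K1 * \<delta>)"
      using m(1) by (simp add: q_def scale_def plus_fun_def fun_diff_def)
    also have "\<dots> = K1 * (real m * \<delta>)" by simp
    also have "\<dots> \<le> K1 * (2 * (len + \<delta>))"
      using m(3) len K1(1) by (intro mult_left_mono) auto
    finally show ?thesis by (simp add: len_def \<delta>_def algebra_simps)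
  qed
  then show ?thesis unfolding coarse_lipschitz_def using K1(1) by (intro exI[of _ "2 * K1"]) auto
qed

section \<open>Rigidity of coarsely Lipschitz maps\<close>

lemma abs_diff_le_add:
  fixes x y z :: real
  assumes "\<bar>x - y\<bar> \<le> a" "\<bar>x - z\<bar> \<le> b" shows "\<bar>y - z\<bar> \<le> a + b"
  using assms by linarith

lemma linear_growth_imp_zero:
  fixes c C T0 :: real
  assumes "\<And>T. T \<ge> T0 \<Longrightarrow> \<bar>c\<bar> * T \<le> C"
  shows "c = 0"
proof (rule ccontr)
  assume "c \<noteq> 0"
  then have c: "\<bar>c\<bar> > 0" by simp
  have "\<bar>c\<bar> * max T0 ((C + 1) / \<bar>c\<bar>) \<le> C" by (intro assms) simp
  moreover have "\<bar>c\<bar> * ((C + 1) / \<bar>c\<bar>) \<le> \<bar>c\<bar> * max T0 ((C + 1) / \<bar>c\<bar>)"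
    by (intro mult_left_mono) auto
  ultimately show False using c by simp
qed

lemma poly_growth_top_coeff:
  fixes d :: "nat \<Rightarrow> real"
  assumes m: "m > 0" and le: "\<And>T. T \<ge> 1 \<Longrightarrow> \<bar>\<Sum>k<Suc m. T ^ k / fact k * d k\<bar> \<le> C * T ^ (m - 1)"
  shows "d m = 0"
proof -
  have "\<bar>d m / fact m\<bar> * T \<le> C + (\<Sum>k<m. \<bar>d k\<bar>)" if T: "T \<ge> 1" for T
  proof -
    have low: "\<bar>\<Sum>k<m. T ^ k / fact k * d k\<bar> \<le> (\<Sum>k<m. \<bar>d k\<bar>) * T ^ (m - 1)"
    proof -
      have "\<bar>\<Sum>k<m. T ^ k / fact k * d k\<bar> \<le> (\<Sum>k<m. \<bar>T ^ k / fact k * d k\<bar>)" by (rule sum_abs)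
      also have "\<dots> \<le> (\<Sum>k<m. T ^ (m - 1) * \<bar>d k\<bar>)"
      proof (rule sum_mono)
        fix k assume k: "k \<in> {..<m}"
        have "T ^ k / fact k \<le> T ^ k / 1" using T by (intro divide_left_mono) auto
        also have "\<dots> \<le> T ^ (m - 1)" using T k by (auto intro: power_increasing)
        finally have "T ^ k / fact k * \<bar>d k\<bar> \<le> T ^ (m - 1) * \<bar>d k\<bar>"
          by (rule mult_right_mono) simp
        then show "\<bar>T ^ k / fact k * d k\<bar> \<le> T ^ (m - 1) * \<bar>d k\<bar>"
          using T by (simp add: abs_mult)
      qed
      also have "\<dots> = (\<Sum>k<m. \<bar>d k\<bar>) * T ^ (m - 1)"
        unfolding sum_distrib_right by (intro sum.cong) (auto simp: mult.commute)
      finally show ?thesis .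
    qed
    have "\<bar>T ^ m / fact m * d m\<bar> \<le> C * T ^ (m - 1) + (\<Sum>k<m. \<bar>d k\<bar>) * T ^ (m - 1)"
      using le[OF T] low by simp
    also have "\<bar>T ^ m / fact m * d m\<bar> = (\<bar>d m / fact m\<bar> * T) * T ^ (m - 1)"
      using m T by (cases m) (auto simp: abs_mult)
    finally have "(\<bar>d m / fact m\<bar> * T) * T ^ (m - 1) \<le> (C + (\<Sum>k<m. \<bar>d k\<bar>)) * T ^ (m - 1)"
      by (simp add: distrib_right)
    then show ?thesis by (rule mult_right_le_imp_le) (use T in simp)
  qed
  then have "d m / fact m = 0" by (rule linear_growth_imp_zero)
  then show ?thesis by simp
qed

lemma abs_nexp_poly_le:
  assumes x: "x \<in> Rn m" and "m \<le> n" and T: "\<bar>T\<bar> \<ge> 1"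
  shows "\<bar>nexp n T x i\<bar> \<le> real m * \<bar>T\<bar> ^ (m - 1) * nrm m x"
proof -
  have "\<bar>nexp m T x i\<bar> \<le> (\<Sum>k<m. \<bar>T ^ k / fact k * x (i + k)\<bar>)"
    unfolding nexp_def by (rule sum_abs)
  also have "\<dots> \<le> (\<Sum>k<m. \<bar>T\<bar> ^ (m - 1) * nrm m x)"
  proof (rule sum_mono)
    fix k assume k: "k \<in> {..<m}"
    have "\<bar>T\<bar> ^ k / fact k \<le> \<bar>T\<bar> ^ k / 1" using T by (intro divide_left_mono) auto
    also have "\<dots> \<le> \<bar>T\<bar> ^ (m - 1)" using T k by (auto intro: power_increasing)
    finally have a: "\<bar>T\<bar> ^ k / fact k \<le> \<bar>T\<bar> ^ (m - 1)" .
    have b: "\<bar>x (i + k)\<bar> \<le> nrm m x"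
      using x abs_le_nrm[of "i + k" m x] by (cases "i + k < m") (auto simp: Rn_def)
    have "\<bar>T\<bar> ^ k / fact k * \<bar>x (i + k)\<bar> \<le> \<bar>T\<bar> ^ (m - 1) * nrm m x"
      by (rule mult_mono[OF a b]) auto
    then show "\<bar>T ^ k / fact k * x (i + k)\<bar> \<le> \<bar>T\<bar> ^ (m - 1) * nrm m x"
      by (simp add: abs_mult power_abs)
  qed
  also have "\<dots> = real m * \<bar>T\<bar> ^ (m - 1) * nrm m x" by simp
  finally show ?thesis using nexp_eq_larger[OF assms(1,2)] by simp
qed

locale coarse_map =
  fixes m :: nat and f :: "(nat \<Rightarrow> real) \<Rightarrow> nat \<Rightarrow> real" and K :: real
  assumes m: "m > 0"
    and f_Rn [simp]: "x \<in> Rn (Suc m) \<Longrightarrow> f x \<in> Rn (Suc m)"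
    and K: "K \<ge> 0"
    and coarse: "T \<ge> 0 \<Longrightarrow> x \<in> Rn (Suc m) \<Longrightarrow> y \<in> Rn (Suc m) \<Longrightarrow>
      nrm (Suc m) (nexp (Suc m) T (f x - f y)) \<le> K * (nrm (Suc m) (nexp (Suc m) T (x - y)) + exp (- T))"
begin

abbreviation "n \<equiv> Suc m"

text \<open>For points with equal last coordinate, \<open>e^(TN) (x - y)\<close> grows no faster
  than T^(m-1), but a nonzero coordinate m of \<open>f x - f y\<close> would put a term of order T^m
  into coordinate 0. This is proved afresh because the maps reached in the induction need not be
  injective.\<close>

lemma last_coord_indep:
  assumes x: "x \<in> Rn n" and y: "y \<in> Rn n" and eq: "x m = y m"
  shows "f x m = f y m"
proof -
  define d where "d = f x - f y"
  have xy: "x - y \<in> Rn m"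
    using x y eq by (auto simp: Rn_def) (metis Suc_leI le_neq_implies_less)
  define C where "C = K * (real n * (real m * nrm m (x - y)) + 1)"
  have "\<bar>\<Sum>k<Suc m. T ^ k / fact k * d k\<bar> \<le> C * T ^ (m - 1)" if T: "T \<ge> 1" for T
  proof -
    have "(\<Sum>k<Suc m. T ^ k / fact k * d k) = nexp n T d 0" by (simp add: nexp_def)
    then have "\<bar>\<Sum>k<Suc m. T ^ k / fact k * d k\<bar> \<le> nrm n (nexp n T d)"
      using abs_le_nrm[of 0 n "nexp n T d"] by simp
    also have "\<dots> \<le> K * (nrm n (nexp n T (x - y)) + exp (- T))"
      unfolding d_def using coarse x y T by simp
    also have "\<dots> \<le> K * (real n * (real m * T ^ (m - 1) * nrm m (x - y)) + T ^ (m - 1))"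
    proof (intro mult_left_mono add_mono K nrm_le_bound)
      show "\<bar>nexp n T (x - y) i\<bar> \<le> real m * T ^ (m - 1) * nrm m (x - y)" for i
        using abs_nexp_poly_le[OF xy, of n T i] T by simp
      have "exp (- T) \<le> 1" using T by simp
      also have "1 \<le> T ^ (m - 1)" using T by (rule one_le_power)
      finally show "exp (- T) \<le> T ^ (m - 1)" .
    qed
    also have "\<dots> = C * T ^ (m - 1)" by (simp add: C_def algebra_simps)
    finally show ?thesis .
  qed
  then have "d m = 0" by (rule poly_growth_top_coeff[OF m])
  then show ?thesis by (simp add: d_def)
qed

text \<open>The vector \<open>z = h e^(-TN) e_n\<close> is long, with coordinate 0 equal to s of
  order T^m, but \<open>e^(TN)\<close> takes it to \<open>h e_n\<close>. So
  \<open>V = e^(TN) (f p - f (p - z))\<close> is bounded, and pulling V back shows that its last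
  coordinate dominates coordinate 0 of \<open>f p - f (p - z)\<close> up to O(T^(m-1)). The other
  coordinates of z are O(T^(m-1)) too, so coarseness at time 0 allows z to be replaced by its part
  along the first axis.\<close>

lemma large_scale_slope:
  assumes p: "p \<in> Rn n" and h: "h > 0" and T: "T \<ge> 1"
  defines "s \<equiv> h * (- T) ^ m / fact m"
    and "q \<equiv> p - scale h (basis m)"
  shows "\<bar>f p 0 - f (p - scale s (basis 0)) 0 - s / h * (f p m - f q m)\<bar>
    \<le> (real m * (K * (h + 1)) + K * (real n * h + 1)) * T ^ (m - 1)"
proof -
  define z where "z = scale h (nexp n (- T) (basis m))"
  have z: "z \<in> Rn n" by (simp add: z_def)
  have z_i: "z i = h * (- T) ^ (m - i) / fact (m - i)" if "i \<le> m" for i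
    using that by (simp add: z_def nexp_basis)
  have Tz: "nexp n T z = scale h (basis m)" by (simp add: z_def nexp_scale nexp_nexp)
  define d where "d = f p - f (p - z)"
  have d: "d \<in> Rn n" using p z by (simp add: d_def)
  define V where "V = nexp n T d"
  have V: "V \<in> Rn n" using d by (simp add: V_def)
  have "nrm n V \<le> K * (nrm n (nexp n T (p - (p - z))) + exp (- T))"
    unfolding V_def d_def using p z T by (intro coarse) auto
  also have "\<dots> \<le> K * (h + 1)"
    using T h K by (intro mult_left_mono add_mono) (auto simp: Tz nrm_scale)
  finally have V_le: "nrm n V \<le> K * (h + 1)" .
  have d_m: "d m = f p m - f q m"
  proof -
    have "f (p - z) m = f q m"
      using last_coord_indep[of "p - z" q] p z by (simp add: q_def z_i)
    then show ?thesis by (simp add: d_def)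
  qed
  have V_m: "V m = d m" unfolding V_def using d nexp_last[of d n T] by simp
  have "d = nexp n (- T) V" using d by (simp add: V_def nexp_nexp)
  then have "d 0 = (\<Sum>k<Suc m. (- T) ^ k / fact k * V k)" by (simp add: nexp_def)
  also have "\<dots> = (\<Sum>k<m. (- T) ^ k / fact k * V k) + s / h * (f p m - f q m)"
    using h by (simp add: s_def V_m d_m)
  finally have "\<bar>d 0 - s / h * (f p m - f q m)\<bar> = \<bar>\<Sum>k<m. (- T) ^ k / fact k * V k\<bar>" by simp
  also have "\<dots> \<le> (\<Sum>k<m. \<bar>(- T) ^ k / fact k * V k\<bar>)" by (rule sum_abs)
  also have "\<dots> \<le> (\<Sum>k<m. T ^ (m - 1) * (K * (h + 1)))"
  proof (rule sum_mono)
    fix k assume k: "k \<in> {..<m}"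
    have "T ^ k / fact k \<le> T ^ k / 1" using T by (intro divide_left_mono) auto
    also have "\<dots> \<le> T ^ (m - 1)" using T k by (auto intro: power_increasing)
    finally have a: "T ^ k / fact k \<le> T ^ (m - 1)" .
    have b: "\<bar>V k\<bar> \<le> K * (h + 1)" using abs_le_nrm[of k n V] V_le k by simp
    have "T ^ k / fact k * \<bar>V k\<bar> \<le> T ^ (m - 1) * (K * (h + 1))"
      by (rule mult_mono[OF a b]) (use T in auto)
    then show "\<bar>(- T) ^ k / fact k * V k\<bar> \<le> T ^ (m - 1) * (K * (h + 1))"
      using T by (simp add: abs_mult power_abs)
  qed
  finally have A: "\<bar>d 0 - s / h * (f p m - f q m)\<bar> \<le> real m * (K * (h + 1)) * T ^ (m - 1)"
    by (simp add: mult_ac)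
  define \<zeta> where "\<zeta> = z - scale s (basis 0)"
  have "\<bar>\<zeta> i\<bar> \<le> h * T ^ (m - 1)" if i: "i < n" for i
  proof (cases "i = 0")
    case True
    then show ?thesis using h T by (simp add: \<zeta>_def z_i s_def basis_def)
  next
    case False
    have "T ^ (m - i) / fact (m - i) \<le> T ^ (m - i) / 1" using T by (intro divide_left_mono) auto
    also have "\<dots> \<le> T ^ (m - 1)" using T False by (auto intro: power_increasing)
    finally have "h * (T ^ (m - i) / fact (m - i)) \<le> h * T ^ (m - 1)"
      using h by (intro mult_left_mono) auto
    then show ?thesis using False i h T by (simp add: \<zeta>_def z_i basis_def abs_mult power_abs)
  qed
  then have \<zeta>: "nrm n \<zeta> \<le> real n * (h * T ^ (m - 1))" by (rule nrm_le_bound)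
  have \<zeta>_Rn: "\<zeta> \<in> Rn n" using z by (simp add: \<zeta>_def)
  have "(p - z) - (p - scale s (basis 0)) = - \<zeta>" by (simp add: \<zeta>_def)
  from coarse[of 0 "p - z" "p - scale s (basis 0)", unfolded this]
  have "nrm n (f (p - z) - f (p - scale s (basis 0))) \<le> K * (nrm n \<zeta> + 1)"
    using p z \<zeta>_Rn by simp
  also have "\<dots> \<le> K * (real n * (h * T ^ (m - 1)) + T ^ (m - 1))"
    using \<zeta> K T by (intro mult_left_mono add_mono) auto
  also have "\<dots> = K * (real n * h + 1) * T ^ (m - 1)"
    by (simp add: algebra_simps)
  finally have "nrm n (f (p - z) - f (p - scale s (basis 0))) \<le> K * (real n * h + 1) * T ^ (m - 1)" .
  then have B: "\<bar>f (p - z) 0 - f (p - scale s (basis 0)) 0\<bar> \<le> K * (real n * h + 1) * T ^ (m - 1)"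
    using abs_le_nrm[of 0 n "f (p - z) - f (p - scale s (basis 0))"] by simp
  have "d 0 = f p 0 - f (p - z) 0" by (simp add: d_def)
  then have "\<bar>f p 0 - f (p - scale s (basis 0)) 0 - s / h * (f p m - f q m)\<bar>
     \<le> real m * (K * (h + 1)) * T ^ (m - 1) + K * (real n * h + 1) * T ^ (m - 1)"
    using A B by linarith
  then show ?thesis by (simp only: distrib_right)
qed

text \<open>For h at time T and h' at time rT, with r^m = h/h', the displacement s is the same. So
  \<open>large_scale_slope\<close> estimates one difference of f along the first axis by both
  quotients, and dividing by s, of order T^m, removes the errors.\<close>

lemma slopes_eq:
  assumes p: "p \<in> Rn n" and h: "h > 0" and h': "h' > 0"
  shows "(f p m - f (p - scale h (basis m)) m) / h = (f p m - f (p - scale h' (basis m)) m) / h'"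
proof -
  define r where "r = root m (h / h')"
  have r: "r > 0" "r ^ m = h / h'" using m h h' by (auto simp: r_def)
  define D where "D = (f p m - f (p - scale h (basis m)) m) / h - (f p m - f (p - scale h' (basis m)) m) / h'"
  define C where "C = (\<lambda>h. real m * (K * (h + 1)) + K * (real n * h + 1))"
  have "\<bar>h / fact m * D\<bar> * T \<le> C h + C h' * r ^ (m - 1)" if "T \<ge> max 1 (1 / r)" for T
  proof -
    have T: "T \<ge> 1" "r * T \<ge> 1" using that r by (auto simp: field_simps)
    define s where "s = h * (- T) ^ m / fact m"
    have s': "h' * (- (r * T)) ^ m / fact m = s"
    proof -
      have "(- (r * T)) ^ m = r ^ m * (- T) ^ m" by (simp flip: power_mult_distrib)
      then show ?thesis using h' by (simp add: s_def r(2))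
    qed
    have e1: "\<bar>f p 0 - f (p - scale s (basis 0)) 0 - s / h * (f p m - f (p - scale h (basis m)) m)\<bar> \<le> C h * T ^ (m - 1)"
      using large_scale_slope[OF p h T(1)] by (simp only: s_def C_def)
    have e2: "\<bar>f p 0 - f (p - scale s (basis 0)) 0 - s / h' * (f p m - f (p - scale h' (basis m)) m)\<bar> \<le> C h' * (r * T) ^ (m - 1)"
      using large_scale_slope[OF p h' T(2)] by (simp only: s' C_def)
    have e3: "s / h * (f p m - f (p - scale h (basis m)) m) - s / h' * (f p m - f (p - scale h' (basis m)) m) = s * D"
      by (simp add: D_def right_diff_distrib diff_divide_distrib)
    have "\<bar>s * D\<bar> \<le> C h * T ^ (m - 1) + C h' * (r * T) ^ (m - 1)"
      unfolding e3[symmetric] by (rule abs_diff_le_add[OF e1 e2])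
    moreover have "\<bar>s * D\<bar> = \<bar>h / fact m * D\<bar> * T * T ^ (m - 1)"
      using m T h by (cases m) (auto simp: s_def abs_mult power_abs)
    ultimately have "\<bar>h / fact m * D\<bar> * T * T ^ (m - 1) \<le> (C h + C h' * r ^ (m - 1)) * T ^ (m - 1)"
      by (simp add: power_mult_distrib algebra_simps)
    then show ?thesis by (rule mult_right_le_imp_le) (use T in simp)
  qed
  then have "h / fact m * D = 0" by (rule linear_growth_imp_zero)
  then show ?thesis using h by (simp add: D_def)
qed

text \<open>By \<open>slopes_eq\<close> the backward quotient at y does not depend on the step; it
  is \<open>\<mu> y\<close>. For x < y the increments from x - 1 and from x up to y both have slope
  \<open>\<mu> y\<close>, hence so has the one from x - 1 to x.\<close>

lemma last_coord_affine:
  "\<exists>a b. \<forall>x\<in>Rn n. f x m = a * x m + b"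
proof -
  define \<phi> where "\<phi> = (\<lambda>t. f (scale t (basis m)) m)"
  have f_last: "f x m = \<phi> (x m)" if "x \<in> Rn n" for x
    unfolding \<phi>_def using last_coord_indep[of x "scale (x m) (basis m)"] that by simp
  define \<mu> where "\<mu> = (\<lambda>y. \<phi> y - \<phi> (y - 1))"
  have \<mu>: "\<phi> y - \<phi> (y - h) = h * \<mu> y" if "h > 0" for y h
  proof -
    have "scale y (basis m) - scale h (basis m) = scale (y - h) (basis m)" for h
      by (auto simp: fun_eq_iff algebra_simps)
    then have "(\<phi> y - \<phi> (y - h)) / h = (\<phi> y - \<phi> (y - 1)) / 1"
      using slopes_eq[of "scale y (basis m)" h 1] that by (simp add: \<phi>_def)
    then show ?thesis using that by (simp add: \<mu>_def field_simps)
  qed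
  have le: "\<mu> x = \<mu> y" if "x < y" for x y
  proof -
    have "\<phi> y - \<phi> (x - 1) = (y - x + 1) * \<mu> y" "\<phi> y - \<phi> x = (y - x) * \<mu> y"
      using \<mu>[of "y - x + 1" y] \<mu>[of "y - x" y] that by (simp_all add: algebra_simps)
    then have "\<phi> x - \<phi> (x - 1) = \<mu> y" by (simp add: algebra_simps)
    then show ?thesis by (simp add: \<mu>_def)
  qed
  then have const: "\<mu> y = \<mu> 0" for y by (metis linorder_neqE_linordered_idom)
  have "\<phi> y = \<mu> 0 * y + \<phi> 0" for y
    using \<mu>[of y y] \<mu>[of "- y" 0] const[of y]
    by (cases y "0 :: real" rule: linorder_cases) (auto simp: algebra_simps)
  note eq = this
  show ?thesis
  proof (intro exI ballI)
    fix x assume "x \<in> Rn n"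
    from f_last[OF this] eq[of "x m"] show "f x m = \<mu> 0 * x m + \<phi> 0" by (rule trans)
  qed
qed

text \<open>At time 0 the additive error is of order 1. At time T it is of order e^-T, and returning
  by \<open>e^(-TN)\<close> costs only a factor T^m. So T is fixed large first, then \<delta> small
  in terms of T.\<close>

lemma coarse_continuous:
  assumes e: "e > 0"
  shows "\<exists>\<delta>>0. \<forall>x\<in>Rn n. \<forall>y\<in>Rn n. (\<forall>i<n. \<bar>x i - y i\<bar> \<le> \<delta>) \<longrightarrow> (\<forall>i. \<bar>f x i - f y i\<bar> \<le> e)"
proof -
  have "((\<lambda>T::real. real n * K * (T ^ m * exp (- T))) \<longlongrightarrow> real n * K * 0) at_top"
    using tendsto_power_div_exp_0[of m]
    by (intro tendsto_mult tendsto_const) (simp add: exp_minus divide_inverse)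
  then have "eventually (\<lambda>T. T \<ge> 1 \<and> real n * K * (T ^ m * exp (- T)) < e / 2) (at_top :: real filter)"
    using e by (intro eventually_conj eventually_ge_at_top order_tendstoD(2)) auto
  from eventually_happens[OF this] obtain T where T: "T \<ge> 1" "real n * K * (T ^ m * exp (- T)) < e / 2"
    by auto
  define A where "A = real n * T ^ m * K * (real n * (real n * T ^ m * real n)) + 1"
  have A: "A > 0" using T K by (auto simp: A_def intro!: add_nonneg_pos)
  have "\<bar>f x i - f y i\<bar> \<le> e"
    if x: "x \<in> Rn n" and y: "y \<in> Rn n" and le: "\<forall>i<n. \<bar>x i - y i\<bar> \<le> e / (2 * A)" for x y i
  proof -
    define d where "d = f x - f y"
    have d: "d \<in> Rn n" using x y by (simp add: d_def)
    have "nrm n (x - y) \<le> real n * (e / (2 * A))" using le by (intro nrm_le_bound) auto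
    have "\<bar>nexp n T (x - y) j\<bar> \<le> real n * T ^ m * (real n * (e / (2 * A)))" for j
    proof -
      have "\<bar>nexp n T (x - y) j\<bar> \<le> real n * T ^ m * nrm n (x - y)"
        using abs_nexp_poly_le[of "x - y" n n T j] x y T by simp
      also have "\<dots> \<le> real n * T ^ m * (real n * (e / (2 * A)))"
        using T by (intro mult_left_mono) (use \<open>nrm n (x - y) \<le> _\<close> in auto)
      finally show ?thesis .
    qed
    then have "nrm n (nexp n T (x - y)) \<le> real n * (real n * T ^ m * (real n * (e / (2 * A))))"
      by (rule nrm_le_bound)
    then have small: "nrm n (nexp n T d) \<le> K * (real n * (real n * T ^ m * (real n * (e / (2 * A)))) + exp (- T))"
      using coarse[of T x y] x y T K order_trans unfolding d_def by (smt (verit) mult_left_mono)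
    have "\<bar>nexp n (- T) (nexp n T d) i\<bar> \<le> real n * T ^ m * nrm n (nexp n T d)"
      using abs_nexp_poly_le[of "nexp n T d" n n "- T" i] d T by simp
    also have "\<dots> \<le> real n * T ^ m * (K * (real n * (real n * T ^ m * (real n * (e / (2 * A)))) + exp (- T)))"
      using T by (intro mult_left_mono small) auto
    also have "\<dots> = (A - 1) * (e / (2 * A)) + real n * K * (T ^ m * exp (- T))"
      by (simp add: A_def algebra_simps)
    also have "\<dots> \<le> e / 2 + e / 2"
    proof (intro add_mono)
      show "(A - 1) * (e / (2 * A)) \<le> e / 2" using A e by (simp add: field_simps)
    qed (use T in simp)
    finally show ?thesis using d by (simp add: nexp_nexp) (simp add: d_def)
  qed
  then show ?thesis using A e by (intro exI[of _ "e / (2 * A)"]) auto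
qed

text \<open>A constant last coordinate saves one power of T: the difference of images lies in
  dimension m, so returning by \<open>e^(-TN)\<close> costs T^(m-1), while a displacement by s along
  the first axis needs only h of order T^-m. As T grows, \<open>f (p + z) - f p\<close> tends to 0
  and z tends to \<open>s e_1\<close>; continuity concludes.\<close>

lemma translation_invariant:
  assumes const: "\<And>x y. x \<in> Rn n \<Longrightarrow> y \<in> Rn n \<Longrightarrow> f x m = f y m"
    and p: "p \<in> Rn n"
  shows "f (p + scale s (basis 0)) = f p"
proof
  fix i
  define p' where "p' = p + scale s (basis 0)"
  have p': "p' \<in> Rn n" using p by (simp add: p'_def)
  have "\<bar>f p' i - f p i\<bar> \<le> 2 * e" if e: "e > 0" for e
  proof -
    obtain \<delta> where \<delta>: "\<delta> > 0" "\<And>x y i. x \<in> Rn n \<Longrightarrow> y \<in> Rn n \<Longrightarrow> (\<forall>i<n. \<bar>x i - y i\<bar> \<le> \<delta>) \<Longrightarrow> \<bar>f x i - f y i\<bar> \<le> e"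
      using coarse_continuous[OF e] by blast
    have inv: "((\<lambda>T::real. c / T) \<longlongrightarrow> 0) at_top" for c
      by (intro tendsto_divide_0[OF tendsto_const] filterlim_at_top_imp_at_infinity filterlim_ident)
    have "((\<lambda>T::real. real m * K * (\<bar>s\<bar> * fact m / T + T ^ (m - 1) * exp (- T))) \<longlongrightarrow> real m * K * (0 + 0)) at_top"
      using tendsto_power_div_exp_0[of "m - 1"]
      by (intro tendsto_mult tendsto_const tendsto_add inv) (simp add: exp_minus divide_inverse)
    then have "eventually (\<lambda>T. T \<ge> 1 \<and> \<bar>s\<bar> * fact m / T < \<delta> \<and>
        real m * K * (\<bar>s\<bar> * fact m / T + T ^ (m - 1) * exp (- T)) < e) (at_top :: real filter)"
      using e \<delta>(1) by (intro eventually_conj eventually_ge_at_top order_tendstoD(2)[OF inv] order_tendstoD(2)) auto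
    from eventually_happens[OF this] obtain T where T: "T \<ge> 1" "\<bar>s\<bar> * fact m / T < \<delta>"
        "real m * K * (\<bar>s\<bar> * fact m / T + T ^ (m - 1) * exp (- T)) < e"
      by auto
    \<comment> \<open>The size for which coordinate 0 of z is exactly s.\<close>
    define h where "h = s * fact m / (- T) ^ m"
    have h_abs: "\<bar>h\<bar> * T ^ (m - 1) = \<bar>s\<bar> * fact m / T"
      using T m by (cases m) (auto simp: h_def abs_mult power_abs)
    define z where "z = scale h (nexp n (- T) (basis m))"
    have z: "z \<in> Rn n" by (simp add: z_def)
    have z_i: "z i = h * (- T) ^ (m - i) / fact (m - i)" if "i \<le> m" for i
      using that by (simp add: z_def nexp_basis)
    have Tz: "nexp n T z = scale h (basis m)" by (simp add: z_def nexp_scale nexp_nexp)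
    define d where "d = f (p + z) - f p"
    have d: "d \<in> Rn n" using p z by (simp add: d_def)
    have "d m = 0" using const[of "p + z" p] p z by (simp add: d_def)
    then have d': "d \<in> Rn m" using d by (auto simp: Rn_def) (metis Suc_leI le_neq_implies_less)
    define V where "V = nexp n T d"
    have V: "V \<in> Rn m" using d' by (simp add: V_def)
    have "nrm n V \<le> K * (nrm n (nexp n T (p + z - p)) + exp (- T))"
      unfolding V_def d_def using p z T by (intro coarse) auto
    also have "\<dots> = K * (\<bar>h\<bar> + exp (- T))" by (simp add: Tz nrm_scale)
    finally have V_le: "nrm m V \<le> K * (\<bar>h\<bar> + exp (- T))" using nrm_eq_larger[OF V, of n] by simp
    have "\<bar>nexp n (- T) V i\<bar> \<le> real m * T ^ (m - 1) * nrm m V"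
      using abs_nexp_poly_le[OF V, of n "- T" i] T by simp
    also have "\<dots> \<le> real m * T ^ (m - 1) * (K * (\<bar>h\<bar> + exp (- T)))"
      using T by (intro mult_left_mono V_le) auto
    also have "\<dots> = real m * K * (\<bar>h\<bar> * T ^ (m - 1) + T ^ (m - 1) * exp (- T))"
      by (simp add: algebra_simps)
    also have "\<dots> < e" using T by (simp only: h_abs)
    finally have A: "\<bar>f (p + z) i - f p i\<bar> < e"
      using d by (simp add: V_def nexp_nexp) (simp add: d_def)
    have "\<bar>(p + z) i - p' i\<bar> \<le> \<delta>" if i: "i < n" for i
    proof (cases "i = 0")
      case True
      then show ?thesis using \<delta>(1) T by (simp add: p'_def z_i h_def basis_def)
    next
      case False
      have "T ^ (m - i) / fact (m - i) \<le> T ^ (m - i) / 1" using T by (intro divide_left_mono) auto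
      also have "\<dots> \<le> T ^ (m - 1)" using T False by (auto intro: power_increasing)
      finally have "\<bar>h\<bar> * (T ^ (m - i) / fact (m - i)) \<le> \<bar>h\<bar> * T ^ (m - 1)"
        by (intro mult_left_mono) auto
      also have "\<dots> < \<delta>" using T by (simp only: h_abs)
      finally show ?thesis using False i T by (simp add: p'_def z_i basis_def abs_mult power_abs)
    qed
    then have "\<bar>f (p + z) i - f p' i\<bar> \<le> e" using \<delta>(2)[of "p + z" p' i] p z p' by simp
    then show ?thesis using A by linarith
  qed
  note close = this
  have "\<bar>f p' i - f p i\<bar> \<le> 0"
  proof (rule field_le_epsilon)
    fix e :: real assume "e > 0"
    with close[of "e / 2"] show "\<bar>f p' i - f p i\<bar> \<le> 0 + e" by simp
  qed
  then show "f (p + scale s (basis 0)) i = f p i" by (simp add: p'_def)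
qed

end

section \<open>Induction on the dimension\<close>

lemma coarse_lipschitz_diff_scale:
  assumes "coarse_lipschitz n f"
  shows "coarse_lipschitz n (\<lambda>x. f x - scale a x)"
proof -
  obtain K where K: "K \<ge> 0" "\<forall>T\<ge>0. \<forall>x\<in>Rn n. \<forall>y\<in>Rn n.
     nrm n (nexp n T (f x - f y)) \<le> K * (nrm n (nexp n T (x - y)) + exp (- T))"
    using assms unfolding coarse_lipschitz_def by blast
  have "nrm n (nexp n T ((f x - scale a x) - (f y - scale a y))) \<le> (K + \<bar>a\<bar>) * (nrm n (nexp n T (x - y)) + exp (- T))"
    if "T \<ge> 0" "x \<in> Rn n" "y \<in> Rn n" for T x y
  proof -
    have "(f x - scale a x) - (f y - scale a y) = (f x - f y) - scale a (x - y)"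
      by (auto simp: fun_eq_iff algebra_simps)
    then have "nexp n T ((f x - scale a x) - (f y - scale a y))
        = nexp n T (f x - f y) - scale a (nexp n T (x - y))"
      by (simp only: nexp_diff nexp_scale)
    then have "nrm n (nexp n T ((f x - scale a x) - (f y - scale a y)))
        \<le> nrm n (nexp n T (f x - f y)) + \<bar>a\<bar> * nrm n (nexp n T (x - y))"
      by (metis nrm_triangle_diff nrm_scale)
    also have "\<dots> \<le> K * (nrm n (nexp n T (x - y)) + exp (- T)) + \<bar>a\<bar> * (nrm n (nexp n T (x - y)) + exp (- T))"
      using K(2) that by (intro add_mono mult_left_mono) auto
    finally show ?thesis by (simp only: distrib_right)
  qed
  then show ?thesis unfolding coarse_lipschitz_def using K(1) by (intro exI[of _ "K + \<bar>a\<bar>"]) auto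
qed

lemma nexp_case_nat:
  assumes "x \<in> Rn m"
  shows "nexp (Suc m) T (case_nat c x) (Suc i) = nexp m T x i"
proof -
  have "nexp (Suc m) T (case_nat c x) (Suc i) = nexp (Suc m) T x i"
    by (simp add: nexp_def)
  then show ?thesis using nexp_eq_larger[OF assms, of "Suc m"] by simp
qed

text \<open>The source loses its first coordinate, on which f does not depend, and the image its
  last, which is constant. Since the first coordinate of the displacement is free, it is chosen as
  the c that makes coordinate 0 vanish after the shear; what remains is the sheared norm in
  dimension m.\<close>

lemma coarse_lipschitz_descend:
  assumes m: "m > 0" and f: "\<And>x. x \<in> Rn (Suc m) \<Longrightarrow> f x \<in> Rn (Suc m)"
    and coarse: "coarse_lipschitz (Suc m) f"
    and const: "\<And>x y. x \<in> Rn (Suc m) \<Longrightarrow> y \<in> Rn (Suc m) \<Longrightarrow> f x m = f y m"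
    and inv: "\<And>x s. x \<in> Rn (Suc m) \<Longrightarrow> f (x + scale s (basis 0)) = f x"
  shows "coarse_lipschitz m (\<lambda>x i. if i < m then f (case_nat 0 x) i else 0)"
proof -
  define g where "g = (\<lambda>x i. if i < m then f (case_nat 0 x) i else 0)"
  obtain K where K: "K \<ge> 0" "\<forall>T\<ge>0. \<forall>x\<in>Rn (Suc m). \<forall>y\<in>Rn (Suc m).
     nrm (Suc m) (nexp (Suc m) T (f x - f y)) \<le> K * (nrm (Suc m) (nexp (Suc m) T (x - y)) + exp (- T))"
    using coarse unfolding coarse_lipschitz_def by blast
  have up: "case_nat c x \<in> Rn (Suc m)" if "x \<in> Rn m" for x and c :: real
    using that by (auto simp: Rn_def split: nat.splits)
  have "nrm m (nexp m T (g x - g y)) \<le> K * (nrm m (nexp m T (x - y)) + exp (- T))"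
    if T: "T \<ge> 0" and x: "x \<in> Rn m" and y: "y \<in> Rn m" for T x y
  proof -
    have xy: "x - y \<in> Rn m" using x y by simp
    define d where "d = f (case_nat 0 x) - f (case_nat 0 y)"
    have d: "d \<in> Rn (Suc m)" using f[OF up[OF x]] f[OF up[OF y]] by (simp add: d_def)
    have "d m = 0" using const[OF up[OF x] up[OF y]] by (simp add: d_def)
    then have d': "d \<in> Rn m" using d by (auto simp: Rn_def) (metis Suc_leI le_neq_implies_less)
    have "(g x - g y) i = d i" for i
      using d' by (auto simp: g_def d_def Rn_def)
    then have gd: "g x - g y = d" by (rule ext)
    define c where "c = - (nexp (Suc m) T (case_nat 0 (x - y)) 0)"
    have w: "case_nat 0 x + scale c (basis 0) - case_nat 0 y = case_nat c (x - y)"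
      by (auto simp: fun_eq_iff basis_def split: nat.splits)
    have w0: "nexp (Suc m) T (case_nat c (x - y)) 0 = 0"
    proof -
      have "case_nat c (x - y) = case_nat 0 (x - y) + scale c (basis 0)"
        by (auto simp: fun_eq_iff basis_def split: nat.splits)
      then have "nexp (Suc m) T (case_nat c (x - y)) 0
          = nexp (Suc m) T (case_nat 0 (x - y)) 0 + c * nexp (Suc m) T (basis 0) 0"
        by (simp only: nexp_add nexp_scale plus_fun_apply scale_apply)
      then show ?thesis by (simp add: c_def nexp_basis)
    qed
    have norm: "nrm (Suc m) (nexp (Suc m) T (case_nat c (x - y))) = nrm m (nexp m T (x - y))"
      unfolding nrm_def L2_set_def
      by (subst sum.lessThan_Suc_shift) (simp add: w0 nexp_case_nat[OF xy] del: sum.lessThan_Suc)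
    have "f (case_nat 0 x + scale c (basis 0)) - f (case_nat 0 y) = d"
      unfolding d_def using inv[OF up[OF x]] by simp
    then have "nrm (Suc m) (nexp (Suc m) T d) \<le> K * (nrm m (nexp m T (x - y)) + exp (- T))"
      using K(2)[rule_format, OF T, of "case_nat 0 x + scale c (basis 0)" "case_nat 0 y"] up[OF x] up[OF y]
      by (simp add: w norm del: fun_diff_def)
    moreover have "nrm (Suc m) (nexp (Suc m) T d) = nrm m (nexp m T d)"
      using nexp_eq_larger[OF d', of "Suc m" T] nrm_eq_larger[of "nexp m T d" m "Suc m"] d' by simp
    ultimately show ?thesis by (simp only: gd)
  qed
  then have "coarse_lipschitz m g" unfolding coarse_lipschitz_def using K(1) by blast
  then show ?thesis by (simp only: g_def)
qed

text \<open>C arises in dimension 1, where the shear is trivial and T \<rightarrow> \<infinity>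
  removes the additive error. Going up, a source coordinate is added in front and an image
  coordinate at the end, so C still depends on the last coordinate and acts in coordinate 0. The
  resulting index shift makes the coefficients of the descended map those of the next higher powers
  of N, and the slope \<open>a0\<close> takes the front place.\<close>

theorem coarse_rigidity:
  assumes "n > 0" and "\<And>x. x \<in> Rn n \<Longrightarrow> f x \<in> Rn n" and "coarse_lipschitz n f"
  shows "\<exists>(a :: nat \<Rightarrow> real) (v :: nat \<Rightarrow> real) (C :: real \<Rightarrow> real). (\<exists>L. L-lipschitz_on UNIV C) \<and>
    (\<forall>x\<in>Rn n. \<forall>i<n. f x i = (\<Sum>k<n-1. a k * x (i + k)) + v i + (if i = 0 then C (x (n - 1)) else 0))"
  using assms
proof (induction n arbitrary: f rule: nat_induct_non_zero)
  case 1
  obtain K where K: "K \<ge> 0" "\<forall>T\<ge>0. \<forall>x\<in>Rn 1. \<forall>y\<in>Rn 1.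
     nrm 1 (nexp 1 T (f x - f y)) \<le> K * (nrm 1 (nexp 1 T (x - y)) + exp (- T))"
    using 1(2) unfolding coarse_lipschitz_def by blast
  have lip: "\<bar>f x 0 - f y 0\<bar> \<le> K * \<bar>x 0 - y 0\<bar>" if "x \<in> Rn 1" "y \<in> Rn 1" for x y
  proof -
    have one: "nrm 1 (nexp 1 T z) = \<bar>z 0\<bar>" for T z
      by (simp add: nrm_def L2_set_def nexp_def)
    have "\<bar>f x 0 - f y 0\<bar> \<le> K * (\<bar>x 0 - y 0\<bar> + exp (- T))" if "T \<ge> 0" for T
      using K(2)[rule_format, OF that \<open>x \<in> Rn 1\<close> \<open>y \<in> Rn 1\<close>] unfolding one by simp
    then have "eventually (\<lambda>T. \<bar>f x 0 - f y 0\<bar> \<le> K * (\<bar>x 0 - y 0\<bar> + exp (- T))) at_top"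
      using eventually_ge_at_top[of 0] by (rule eventually_mono[rotated])
    moreover have "((\<lambda>T::real. K * (\<bar>x 0 - y 0\<bar> + exp (- T))) \<longlongrightarrow> K * (\<bar>x 0 - y 0\<bar> + 0)) at_top"
      by (intro tendsto_intros filterlim_compose[OF exp_at_bot] filterlim_uminus_at_bot_at_top)
    ultimately show ?thesis by (intro tendsto_lowerbound) auto
  qed
  define C where "C = (\<lambda>t. f (scale t (basis 0)) 0)"
  have "K-lipschitz_on UNIV C"
  proof (rule lipschitz_onI)
    show "dist (C s) (C t) \<le> K * dist s t" for s t
      using lip[of "scale s (basis 0)" "scale t (basis 0)"] by (simp add: C_def dist_real_def)
  qed (rule K(1))
  moreover have "x = scale (x 0) (basis 0)" if "x \<in> Rn 1" for x
    using that by (subst Rn_eq_iff[of _ 1]) auto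
  then have "\<forall>x\<in>Rn 1. \<forall>i<1. f x i = (\<Sum>k<1-1. (0::real) * x (i + k)) + 0 + (if i = 0 then C (x (1 - 1)) else 0)"
    by (simp add: C_def)
  ultimately show ?case by (intro exI[of _ "\<lambda>_. 0"] exI[of _ C]) auto
next
  case (Suc m)
  obtain K where "K \<ge> 0" "\<forall>T\<ge>0. \<forall>x\<in>Rn (Suc m). \<forall>y\<in>Rn (Suc m).
     nrm (Suc m) (nexp (Suc m) T (f x - f y)) \<le> K * (nrm (Suc m) (nexp (Suc m) T (x - y)) + exp (- T))"
    using Suc.prems(2) unfolding coarse_lipschitz_def by blast
  then interpret f: coarse_map m f K
    using Suc by unfold_locales auto
  obtain a0 b where ab: "\<forall>x\<in>Rn (Suc m). f x m = a0 * x m + b"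
    using f.last_coord_affine by blast
  define g where "g = (\<lambda>x. f x - scale a0 x)"
  have g_Rn: "g x \<in> Rn (Suc m)" if "x \<in> Rn (Suc m)" for x
    using that Suc.prems(1) by (simp add: g_def)
  have g_coarse: "coarse_lipschitz (Suc m) g"
    unfolding g_def by (rule coarse_lipschitz_diff_scale[OF Suc.prems(2)])
  have g_const: "g x m = b" if "x \<in> Rn (Suc m)" for x
    using ab that by (simp add: g_def)
  obtain K' where "K' \<ge> 0" "\<forall>T\<ge>0. \<forall>x\<in>Rn (Suc m). \<forall>y\<in>Rn (Suc m).
     nrm (Suc m) (nexp (Suc m) T (g x - g y)) \<le> K' * (nrm (Suc m) (nexp (Suc m) T (x - y)) + exp (- T))"
    using g_coarse unfolding coarse_lipschitz_def by blast
  then interpret g: coarse_map m g K'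
    using Suc(1) g_Rn by unfold_locales auto
  have g_inv: "g (x + scale s (basis 0)) = g x" if "x \<in> Rn (Suc m)" for x s
    using that g_const by (intro g.translation_invariant) auto
  have "coarse_lipschitz m (\<lambda>x i. if i < m then g (case_nat 0 x) i else 0)"
  proof (rule coarse_lipschitz_descend)
    show "g x \<in> Rn (Suc m)" if "x \<in> Rn (Suc m)" for x using that by (rule g_Rn)
    show "g x m = g y m" if "x \<in> Rn (Suc m)" "y \<in> Rn (Suc m)" for x y using that by (simp add: g_const)
    show "g (x + scale s (basis 0)) = g x" if "x \<in> Rn (Suc m)" for x s using that by (rule g_inv)
  qed (rule Suc(1), rule g_coarse)
  then obtain a v C where C: "\<exists>L. L-lipschitz_on UNIV C"
    and form: "\<forall>x\<in>Rn m. \<forall>i<m. (if i < m then g (case_nat 0 x) i else 0) =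
      (\<Sum>k<m-1. a k * x (i + k)) + v i + (if i = 0 then C (x (m - 1)) else 0)"
    using Suc.IH[of "\<lambda>x i. if i < m then g (case_nat 0 x) i else 0"] by (auto simp: Rn_def)
  define a' where "a' = case_nat a0 a"
  define v' where "v' = (\<lambda>i. if i < m then v i else b)"
  have "f x i = (\<Sum>k<m. a' k * x (i + k)) + v' i + (if i = 0 then C (x m) else 0)"
    if x: "x \<in> Rn (Suc m)" and i: "i < Suc m" for x i
  proof -
    obtain m' where m': "m = Suc m'" using Suc(1) by (cases m) auto
    have sum: "(\<Sum>k<m. a' k * x (i + k)) = a0 * x i + (\<Sum>k<m-1. a k * x (Suc (i + k)))"
      unfolding m' by (subst sum.lessThan_Suc_shift) (simp add: a'_def)
    show ?thesis
    proof (cases "i < m")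
      case True
      define y where "y = (\<lambda>j. x (Suc j))"
      have y: "y \<in> Rn m" using x by (auto simp: y_def Rn_def)
      have "x + scale (- x 0) (basis 0) = case_nat 0 y"
        by (auto simp: fun_eq_iff y_def basis_def split: nat.splits)
      then have "g x = g (case_nat 0 y)" using g_inv[OF x, of "- x 0"] by simp
      then have "g x i = (\<Sum>k<m-1. a k * x (Suc (i + k))) + v i + (if i = 0 then C (x m) else 0)"
        using form[rule_format, OF y True] True Suc(1) by (simp add: y_def)
      moreover have "f x i = a0 * x i + g x i" by (simp add: g_def)
      ultimately show ?thesis using True by (simp add: sum v'_def)
    next
      case False
      then have "i = m" using i by simp
      then have "(\<Sum>k<m-1. a k * x (Suc (i + k))) = 0" using x by (simp add: Rn_def)
      then have "(\<Sum>k<m. a' k * x (i + k)) = a0 * x i" using sum by simp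
      then show ?thesis using ab x Suc(1) \<open>i = m\<close> by (simp add: v'_def)
    qed
  qed
  then show ?case using C by (intro exI[of _ a'] exI[of _ v'] exI[of _ C]) auto
qed

section \<open>Affine-shift maps are bilipschitz\<close>

lemma nexp_shift_poly:
  "nexp n s (\<lambda>i. \<Sum>k<l. a k * x (i + k)) = (\<lambda>i. \<Sum>k<l. a k * nexp n s x (i + k))"
proof
  fix i
  have "nexp n s (\<lambda>i. \<Sum>k<l. a k * x (i + k)) i = (\<Sum>j<n. \<Sum>k<l. s ^ j / fact j * (a k * x (i + j + k)))"
    by (simp add: nexp_def sum_distrib_left)
  also have "\<dots> = (\<Sum>k<l. \<Sum>j<n. s ^ j / fact j * (a k * x (i + j + k)))"
    by (rule sum.swap)
  also have "\<dots> = (\<Sum>k<l. a k * nexp n s x (i + k))"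
    unfolding nexp_def sum_distrib_left by (intro sum.cong) (auto simp: mult_ac add_ac)
  finally show "nexp n s (\<lambda>i. \<Sum>k<l. a k * x (i + k)) i = (\<Sum>k<l. a k * nexp n s x (i + k))" .
qed

text \<open>Polynomials in N commute with the shear. The contribution of C is a multiple of
  \<open>e_1\<close>, fixed by the shear, and is bounded by L times the last coordinate, also fixed.
  So the same triangular relation links \<open>x - y\<close> and \<open>f x - f y\<close> at every
  scale: reading it forwards gives the upper bound, solving it gives the lower one.\<close>

lemma shift_poly_bilipschitz:
  fixes a v :: "nat \<Rightarrow> real" and C :: "real \<Rightarrow> real"
  assumes n: "n \<ge> 2" and a0: "a 0 \<noteq> 0" and C: "L-lipschitz_on UNIV C"
    and f_Rn: "\<And>x. x \<in> Rn n \<Longrightarrow> f x \<in> Rn n"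
    and f: "\<And>x i. x \<in> Rn n \<Longrightarrow> i < n \<Longrightarrow>
      f x i = (\<Sum>k<n-1. a k * x (i + k)) + v i + (if i = 0 then C (x (n - 1)) else 0)"
  shows "\<exists>K\<ge>1. \<forall>x\<in>Rn n. \<forall>y\<in>Rn n. rho n (f x - f y) \<le> K * rho n (x - y) \<and> rho n (x - y) \<le> K * rho n (f x - f y)"
proof -
  define A where "A = (\<Sum>k<n-1. \<bar>a k\<bar>)"
  have A: "A \<ge> 0" by (simp add: A_def sum_nonneg)
  have L: "L \<ge> 0" using C by (rule lipschitz_on_nonneg)
  \<comment> \<open>The factor lost in solving for one more coordinate: the given value, the other
    coefficients and C contribute 1, A and L, divided by |a 0|.\<close>
  define M where "M = (1 + A + L) / \<bar>a 0\<bar> + 1"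
  have M: "M \<ge> 1" "(1 + A + L) \<le> \<bar>a 0\<bar> * M" using A L a0 by (auto simp: M_def field_simps)
  have key: "\<exists>c. \<bar>c\<bar> \<le> L * \<bar>nexp n s (x - y) (n - 1)\<bar> \<and>
      (\<forall>i. nexp n s (f x - f y) i = (\<Sum>k<n-1. a k * nexp n s (x - y) (i + k)) + (if i = 0 then c else 0))"
    if x: "x \<in> Rn n" and y: "y \<in> Rn n" for s x y
  proof -
    define z where "z = x - y"
    have z: "z \<in> Rn n" using x y by (simp add: z_def)
    define c where "c = C (x (n - 1)) - C (y (n - 1))"
    have "(f x - f y) i = ((\<lambda>i. \<Sum>k<n-1. a k * z (i + k)) + scale c (basis 0)) i" for i
    proof (cases "i < n")
      case True
      then show ?thesis using x y
        by (simp add: f z_def c_def basis_def sum_subtractf right_diff_distrib)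
    next
      case False
      then have "(\<Sum>k<n-1. a k * z (i + k)) = 0" using z by (simp add: Rn_def)
      then show ?thesis using False n f_Rn[OF x] f_Rn[OF y] by (simp add: Rn_def basis_def)
    qed
    then have "f x - f y = (\<lambda>i. \<Sum>k<n-1. a k * z (i + k)) + scale c (basis 0)" by (rule ext)
    then have d: "nexp n s (f x - f y) = (\<lambda>i. \<Sum>k<n-1. a k * nexp n s z (i + k)) + scale c (nexp n s (basis 0))"
      by (simp only: nexp_add nexp_scale nexp_shift_poly)
    have "\<bar>c\<bar> \<le> L * \<bar>z (n - 1)\<bar>"
      using lipschitz_onD[OF C, of "x (n - 1)" "y (n - 1)"] by (simp add: c_def z_def dist_real_def)
    also have "z (n - 1) = nexp n s z (n - 1)" using nexp_last[OF z] n by simp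
    finally show ?thesis
      using n by (intro exI[of _ c]) (simp add: d nexp_basis flip: z_def)
  qed
  obtain K1 where K1: "K1 \<ge> 1" "\<forall>x\<in>Rn n. \<forall>r>0. nrm n (nexp n (- ln r) x) \<le> (real n * (A + L)) * r \<longrightarrow> rho n x \<le> K1 * r"
    using rho_le_of_nrm[of "real n * (A + L)" n] A L by auto
  obtain K2 where K2: "K2 \<ge> 1" "\<forall>x\<in>Rn n. \<forall>r>0. nrm n (nexp n (- ln r) x) \<le> (real n * M ^ n) * r \<longrightarrow> rho n x \<le> K2 * r"
    using rho_le_of_nrm[of "real n * M ^ n" n] M by auto
  have upper: "rho n (f x - f y) \<le> K1 * rho n (x - y)" if x: "x \<in> Rn n" and y: "y \<in> Rn n" for x y
  proof (cases "x = y")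
    case False
    define r where "r = rho n (x - y)"
    have r: "r > 0" using False by (simp add: r_def)
    define w where "w = nexp n (- ln r) (x - y)"
    have w: "w \<in> Rn n" using x y by (simp add: w_def)
    have w_le: "\<bar>w i\<bar> \<le> r" for i
      using abs_le_nrm[of i n w] nrm_nexp_rho[of "x - y" n] w x y False
      by (cases "i < n") (auto simp: w_def r_def Rn_def)
    obtain c where c: "\<bar>c\<bar> \<le> L * \<bar>w (n - 1)\<bar>"
      and d: "\<forall>i. nexp n (- ln r) (f x - f y) i = (\<Sum>k<n-1. a k * w (i + k)) + (if i = 0 then c else 0)"
      using key[OF x y, of "- ln r"] unfolding w_def by blast
    have "\<bar>nexp n (- ln r) (f x - f y) i\<bar> \<le> (A + L) * r" for i
    proof -
      have "\<bar>\<Sum>k<n-1. a k * w (i + k)\<bar> \<le> (\<Sum>k<n-1. \<bar>a k * w (i + k)\<bar>)" by (rule sum_abs)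
      also have "\<dots> \<le> (\<Sum>k<n-1. \<bar>a k\<bar> * r)"
        using w_le by (intro sum_mono) (simp add: abs_mult mult_left_mono)
      also have "\<dots> = A * r" by (simp only: A_def sum_distrib_right)
      finally have 1: "\<bar>\<Sum>k<n-1. a k * w (i + k)\<bar> \<le> A * r" .
      have "L * \<bar>w (n - 1)\<bar> \<le> L * r" using w_le L by (intro mult_left_mono) auto
      then have "\<bar>if i = 0 then c else 0\<bar> \<le> L * r" using c L r by auto
      then show ?thesis using 1 unfolding d[rule_format] distrib_right by linarith
    qed
    then have "nrm n (nexp n (- ln r) (f x - f y)) \<le> (real n * (A + L)) * r"
      using nrm_le_bound[of n "nexp n (- ln r) (f x - f y)" "(A + L) * r"] by (simp only: mult.assoc)
    then show ?thesis using K1(2) f_Rn x y r unfolding r_def by (meson Rn_diff)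
  qed simp
  have lower: "rho n (x - y) \<le> K2 * rho n (f x - f y)" if x: "x \<in> Rn n" and y: "y \<in> Rn n" for x y
  proof -
    have bound: "nrm n (nexp n s (x - y)) \<le> (real n * M ^ n) * r"
      if r: "nrm n (nexp n s (f x - f y)) \<le> r" for s r
    proof -
      define w where "w = nexp n s (x - y)"
      have w: "w \<in> Rn n" using x y by (simp add: w_def)
      define u where "u = nexp n s (f x - f y)"
      have u: "u \<in> Rn n" using x y f_Rn by (simp add: u_def)
      have r0: "r \<ge> 0" using r nrm_nonneg order_trans by blast
      have u_le: "\<bar>u i\<bar> \<le> r" for i
        using abs_le_nrm[of i n u] r r0 u by (cases "i < n") (auto simp: u_def Rn_def)
      obtain c where c: "\<bar>c\<bar> \<le> L * \<bar>w (n - 1)\<bar>"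
        and d: "\<forall>i. u i = (\<Sum>k<n-1. a k * w (i + k)) + (if i = 0 then c else 0)"
        using key[OF x y, of s] unfolding w_def u_def by blast
      obtain n' where n': "n - 1 = Suc n'" using n by (cases "n - 1") auto
      \<comment> \<open>Back substitution from the last coordinate, beginning with the padding
        zeros. In coordinate 0 the C term needs the bound on coordinate n-1, which is known by then
        because \<open>n \<ge> 2\<close>.\<close>
      have "\<forall>i. i + j \<ge> n \<longrightarrow> \<bar>w i\<bar> \<le> M ^ j * r" for j
      proof (induction j)
        case 0
        then show ?case using w r0 by (auto simp: Rn_def)
      next
        case (Suc j)
        show ?case
        proof (intro allI impI)
          fix i assume ij: "n \<le> i + Suc j"
          have A': "(\<Sum>k<n'. \<bar>a (Suc k)\<bar>) \<le> A"
            unfolding A_def n' by (subst sum.lessThan_Suc_shift) simp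
          have MJ: "0 \<le> M ^ j * r" "r \<le> M ^ j * r"
            using M(1) r0 mult_right_mono[OF one_le_power[OF M(1), of j] r0] by auto
          have "\<bar>\<Sum>k<n'. a (Suc k) * w (i + Suc k)\<bar> \<le> (\<Sum>k<n'. \<bar>a (Suc k) * w (i + Suc k)\<bar>)"
            by (rule sum_abs)
          also have "\<dots> \<le> (\<Sum>k<n'. \<bar>a (Suc k)\<bar> * (M ^ j * r))"
            unfolding abs_mult using Suc.IH ij by (intro sum_mono mult_left_mono) auto
          also have "\<dots> = (\<Sum>k<n'. \<bar>a (Suc k)\<bar>) * (M ^ j * r)" by (simp only: sum_distrib_right)
          also have "\<dots> \<le> A * (M ^ j * r)" using A' MJ by (intro mult_right_mono) auto
          finally have 1: "\<bar>\<Sum>k<n'. a (Suc k) * w (i + Suc k)\<bar> \<le> A * (M ^ j * r)" .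
          have 2: "\<bar>if i = 0 then c else 0\<bar> \<le> L * (M ^ j * r)"
          proof (cases "i = 0")
            case True
            then have "n \<le> (n - 1) + j" using ij n by linarith
            then have "L * \<bar>w (n - 1)\<bar> \<le> L * (M ^ j * r)"
              using Suc.IH L by (intro mult_left_mono) auto
            then show ?thesis using c True by simp
          qed (use L MJ in auto)
          have "a 0 * w i = u i - (\<Sum>k<n'. a (Suc k) * w (i + Suc k)) - (if i = 0 then c else 0)"
            using d[rule_format, of i] unfolding n' by (subst (asm) sum.lessThan_Suc_shift) simp
          then have "\<bar>a 0 * w i\<bar> \<le> M ^ j * r + A * (M ^ j * r) + L * (M ^ j * r)"
            using 1 2 u_le[of i] MJ(2) by linarith
          also have "\<dots> = (1 + A + L) * (M ^ j * r)" by (simp add: algebra_simps)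
          also have "\<dots> \<le> \<bar>a 0\<bar> * M * (M ^ j * r)" using M(2) MJ by (intro mult_right_mono) auto
          finally have "\<bar>a 0\<bar> * \<bar>w i\<bar> \<le> \<bar>a 0\<bar> * (M ^ Suc j * r)" by (simp add: abs_mult mult_ac)
          then show "\<bar>w i\<bar> \<le> M ^ Suc j * r" using a0 by simp
        qed
      qed
      from this[of n] have "\<bar>w i\<bar> \<le> M ^ n * r" for i by simp
      then show ?thesis using nrm_le_bound[of n w "M ^ n * r"] by (simp add: w_def mult.assoc)
    qed
    show ?thesis
    proof (cases "f x = f y")
      case True
      then have "nrm n (nexp n 0 (x - y)) \<le> (real n * M ^ n) * 0"
        by (intro bound) simp
      then have "nrm n (x - y) = 0" using x y nrm_nonneg[of n "x - y"] by simp
      then show ?thesis using x y True by (simp add: nrm_eq_0_iff)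
    next
      case False
      define r where "r = rho n (f x - f y)"
      have r: "r > 0" using False by (simp add: r_def)
      have "nrm n (nexp n (- ln r) (f x - f y)) \<le> r"
        using nrm_nexp_rho[of "f x - f y" n] x y f_Rn False by (simp add: r_def)
      then show ?thesis using bound[of "- ln r" r] K2(2) x y r unfolding r_def by (meson Rn_diff)
    qed
  qed
  have "rho n (f x - f y) \<le> max K1 K2 * rho n (x - y) \<and> rho n (x - y) \<le> max K1 K2 * rho n (f x - f y)"
    if "x \<in> Rn n" "y \<in> Rn n" for x y
    using upper[OF that] lower[OF that]
      mult_right_mono[of K1 "max K1 K2" "rho n (x - y)"] mult_right_mono[of K2 "max K1 K2" "rho n (f x - f y)"]
    by auto
  then show ?thesis using K1(1) by (intro exI[of _ "max K1 K2"]) auto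
qed

section \<open>Transfer between matrix vectors and padded sequences\<close>

definition vec_fun :: "real Matrix.vec \<Rightarrow> nat \<Rightarrow> real" where
  "vec_fun x = (\<lambda>i. if i < dim_vec x then x $ i else 0)"

lemma vec_fun_Rn [simp]: "x \<in> carrier_vec n \<Longrightarrow> vec_fun x \<in> Rn n"
  by (auto simp: vec_fun_def Rn_def)

lemma vec_vec_fun [simp]: "x \<in> carrier_vec n \<Longrightarrow> Matrix.vec n (vec_fun x) = x"
  by (intro eq_vecI) (auto simp: vec_fun_def)

lemma vec_fun_vec [simp]: "x \<in> Rn n \<Longrightarrow> vec_fun (Matrix.vec n x) = x"
  by (auto simp: vec_fun_def Rn_def fun_eq_iff)

lemma vec_fun_inj: "x \<in> carrier_vec n \<Longrightarrow> y \<in> carrier_vec n \<Longrightarrow> vec_fun x = vec_fun y \<longleftrightarrow> x = y"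
  by (metis vec_vec_fun)

lemma vec_fun_diff: "x \<in> carrier_vec n \<Longrightarrow> y \<in> carrier_vec n \<Longrightarrow> vec_fun (x - y) = vec_fun x - vec_fun y"
  by (auto simp: vec_fun_def fun_eq_iff)

lemma euclid_norm_eq_nrm: "x \<in> carrier_vec n \<Longrightarrow> euclid_norm x = nrm n (vec_fun x)"
  by (auto simp: euclid_norm_def nrm_def L2_set_def vec_fun_def)

lemma pow_smult_mat:
  fixes A :: "real mat"
  assumes A: "A \<in> carrier_mat n n"
  shows "(c \<cdot>\<^sub>m A) ^\<^sub>m k = c ^ k \<cdot>\<^sub>m (A ^\<^sub>m k)"
proof (induction k)
  case 0
  then show ?case using A by (intro eq_matI) auto
next
  case (Suc k)
  have Ak: "A ^\<^sub>m k \<in> carrier_mat n n" using A by simp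
  have "(c \<cdot>\<^sub>m A) ^\<^sub>m Suc k = (c ^ k \<cdot>\<^sub>m (A ^\<^sub>m k)) * (c \<cdot>\<^sub>m A)" by (simp add: Suc)
  also have "\<dots> = c ^ k \<cdot>\<^sub>m (c \<cdot>\<^sub>m (A ^\<^sub>m k * A))"
    by (simp only: mult_smult_assoc_mat[OF Ak smult_carrier_mat[OF A]] mult_smult_distrib[OF Ak A])
  also have "\<dots> = c ^ Suc k \<cdot>\<^sub>m (A ^\<^sub>m Suc k)"
    by (intro eq_matI) (auto simp: mult_ac)
  finally show ?case .
qed

text \<open>The entry of J^k lying d places above the diagonal is \<open>k choose d\<close>, so this
  evaluates one entry of the matrix exponential. For \<open>k \<ge> d\<close> the terms are
  \<open>s^d / d!\<close> times those of the exponential series shifted by d.\<close>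

lemma exp_binomial_sums: "(\<lambda>k. s ^ k * real (k choose d) / fact k) sums (exp s * (s ^ d / fact d))"
proof -
  have "(\<lambda>k. s ^ k / fact k) sums exp s"
    using exp_converges[of s] by (simp add: divide_inverse mult.commute)
  then have "(\<lambda>k. s ^ k / fact k * (s ^ d / fact d)) sums (exp s * (s ^ d / fact d))"
    by (rule sums_mult2)
  moreover have "s ^ k / fact k * (s ^ d / fact d) = s ^ (k + d) * real ((k + d) choose d) / fact (k + d)" for k
    by (simp add: binomial_fact power_add)
  ultimately have "(\<lambda>k. s ^ (k + d) * real ((k + d) choose d) / fact (k + d)) sums (exp s * (s ^ d / fact d))"
    by simp
  moreover have "(\<Sum>k<d. s ^ k * real (k choose d) / fact k) = 0"
    by (intro sum.neutral) (auto simp: binomial_eq_0)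
  ultimately show ?thesis
    by (subst (asm) sums_iff_shift) simp
qed

lemma mat_exp_J_index:
  assumes "i < n" "j < n"
  shows "mat_exp (s \<cdot>\<^sub>m J n) $$ (i, j) = (if i \<le> j then exp s * (s ^ (j - i) / fact (j - i)) else 0)"
proof -
  have J: "J n \<in> carrier_mat n n" by (simp add: J_eq_jordan_block)
  have "((s \<cdot>\<^sub>m J n) ^\<^sub>m k) $$ (i, j) / fact k = (if i \<le> j then s ^ k * real (k choose (j - i)) / fact k else 0)" for k
    using assms by (simp add: pow_smult_mat[OF J]) (simp add: J_eq_jordan_block jordan_block_pow)
  then have "(\<Sum>k. ((s \<cdot>\<^sub>m J n) ^\<^sub>m k) $$ (i, j) / fact k) = (if i \<le> j then exp s * (s ^ (j - i) / fact (j - i)) else 0)"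
    using sums_unique[OF exp_binomial_sums[of s "j - i"]] by simp
  moreover have "dim_row (s \<cdot>\<^sub>m J n) = n" using J by simp
  ultimately show ?thesis using assms by (simp add: mat_exp_def)
qed

lemma vec_fun_mat_exp_J:
  assumes x: "x \<in> carrier_vec n"
  shows "vec_fun (mat_exp (s \<cdot>\<^sub>m J n) *\<^sub>v x) = scale (exp s) (nexp n s (vec_fun x))"
proof
  fix i
  have dims: "dim_row (mat_exp (s \<cdot>\<^sub>m J n)) = n" "dim_col (mat_exp (s \<cdot>\<^sub>m J n)) = n"
    by (simp_all add: mat_exp_def J_eq_jordan_block)
  show "vec_fun (mat_exp (s \<cdot>\<^sub>m J n) *\<^sub>v x) i = scale (exp s) (nexp n s (vec_fun x)) i"
  proof (cases "i < n")
    case True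
    have "vec_fun (mat_exp (s \<cdot>\<^sub>m J n) *\<^sub>v x) i = (\<Sum>j<n. mat_exp (s \<cdot>\<^sub>m J n) $$ (i, j) * x $ j)"
      using True x dims by (simp add: vec_fun_def scalar_prod_def atLeast0LessThan)
    also have "\<dots> = (\<Sum>j<n. if i \<le> j then exp s * (s ^ (j - i) / fact (j - i)) * x $ j else 0)"
      using True by (intro sum.cong) (auto simp: mat_exp_J_index)
    also have "\<dots> = (\<Sum>j\<in>{i..<n}. exp s * (s ^ (j - i) / fact (j - i)) * x $ j)"
      by (intro sum.mono_neutral_cong_right) auto
    also have "\<dots> = (\<Sum>k\<in>{..<n-i}. exp s * (s ^ k / fact k) * x $ (i + k))"
      by (rule sum.reindex_bij_witness[of _ "\<lambda>k. i + k" "\<lambda>j. j - i"]) auto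
    also have "\<dots> = (\<Sum>k<n. exp s * (s ^ k / fact k) * vec_fun x (i + k))"
      using x by (intro sum.mono_neutral_cong_left) (auto simp: vec_fun_def)
    finally show ?thesis by (simp add: nexp_def sum_distrib_left mult_ac)
  next
    case False
    then have "nexp n s (vec_fun x) i = 0"
      using Rn_nexp[OF vec_fun_Rn[OF x], of n s] by (simp add: Rn_def)
    then show ?thesis using False dims by (simp add: vec_fun_def)
  qed
qed

lemma D_J_eq_rho:
  assumes x: "x \<in> carrier_vec n" and y: "y \<in> carrier_vec n"
  shows "D (J n) x y = rho n (vec_fun x - vec_fun y)"
proof -
  have xy: "x - y \<in> carrier_vec n" using x y by simp
  have "euclid_norm (mat_exp ((- t) \<cdot>\<^sub>m J n) *\<^sub>v (x - y)) = decay n (vec_fun x - vec_fun y) t" for t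
  proof -
    have "mat_exp ((- t) \<cdot>\<^sub>m J n) *\<^sub>v (x - y) \<in> carrier_vec n"
      by (rule carrier_vecI) (simp add: mat_exp_def J_eq_jordan_block)
    then have "euclid_norm (mat_exp ((- t) \<cdot>\<^sub>m J n) *\<^sub>v (x - y))
        = nrm n (scale (exp (- t)) (nexp n (- t) (vec_fun (x - y))))"
      using xy by (simp add: euclid_norm_eq_nrm vec_fun_mat_exp_J)
    then show ?thesis by (simp add: nrm_scale decay_def vec_fun_diff[OF x y])
  qed
  then show ?thesis
    using vec_fun_inj[OF x y] by (simp add: D_def rho_def)
qed

lemma superdiag_pow_index:
  assumes "i < n" "j < n"
  shows "(superdiag n ^\<^sub>m k) $$ (i, j) = (if j = i + k then 1 else 0)"
  using assms(2)
proof (induction k arbitrary: j)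
  case 0
  then show ?case using assms by (auto simp: superdiag_def)
next
  case (Suc k)
  have car: "superdiag n \<in> carrier_mat n n" by (simp add: superdiag_def)
  have "(superdiag n ^\<^sub>m Suc k) $$ (i, j) = (\<Sum>l<n. (superdiag n ^\<^sub>m k) $$ (i, l) * superdiag n $$ (l, j))"
    using assms(1) Suc.prems car pow_carrier_mat[OF car, of k]
    by (simp add: scalar_prod_def atLeast0LessThan)
  also have "\<dots> = (\<Sum>l<n. if l = i + k \<and> j = Suc l then 1 else 0)"
    using Suc by (intro sum.cong) (auto simp: superdiag_def)
  also have "\<dots> = (if j = i + Suc k then 1 else 0)"
  proof (cases "j = i + Suc k")
    case True
    then have "(\<Sum>l<n. if l = i + k \<and> j = Suc l then 1 else 0) = (\<Sum>l<n. if l = i + k then 1 else (0::real))"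
      by (intro sum.cong) auto
    then show ?thesis using True Suc.prems by (simp add: sum.delta)
  next
    case False
    then show ?thesis by (intro trans[OF sum.neutral]) auto
  qed
  finally show ?case .
qed

lemma superdiag_poly_mult_vec:
  assumes x: "x \<in> carrier_vec n" and i: "i < n"
  shows "(superdiag_poly n m a *\<^sub>v x) $ i = (\<Sum>k\<le>m. a k * vec_fun x (i + k))"
proof -
  have "(superdiag_poly n m a *\<^sub>v x) $ i = (\<Sum>j<n. (\<Sum>k\<le>m. a k * (superdiag n ^\<^sub>m k) $$ (i, j)) * x $ j)"
    using x i by (simp add: superdiag_poly_def scalar_prod_def atLeast0LessThan)
  also have "\<dots> = (\<Sum>j<n. \<Sum>k\<le>m. if j = i + k then a k * x $ j else 0)"
    using i by (intro sum.cong refl) (auto simp: superdiag_pow_index sum_distrib_right intro!: sum.cong)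
  also have "\<dots> = (\<Sum>k\<le>m. \<Sum>j<n. if j = i + k then a k * x $ j else 0)"
    by (rule sum.swap)
  also have "\<dots> = (\<Sum>k\<le>m. a k * vec_fun x (i + k))"
    using x by (intro sum.cong) (auto simp: sum.delta vec_fun_def)
  finally show ?thesis .
qed

lemma superdiag_form_iff:
  assumes n: "n \<ge> 2" and x: "x \<in> carrier_vec n" and v: "v \<in> carrier_vec n" and y: "y \<in> carrier_vec n"
  shows "y = superdiag_poly n (n - 2) a *\<^sub>v x + v + C_tilde n C x \<longleftrightarrow>
    (\<forall>i<n. vec_fun y i = (\<Sum>k<n-1. a k * vec_fun x (i + k)) + vec_fun v i
       + (if i = 0 then C (vec_fun x (n - 1)) else 0))"
proof -
  have sets: "{..n - 2} = {..<n - 1}" using n by auto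
  have P: "dim_row (superdiag_poly n (n - 2) a) = n" by (simp add: superdiag_poly_def)
  have "(superdiag_poly n (n - 2) a *\<^sub>v x + v + C_tilde n C x) $ i =
      (\<Sum>k<n-1. a k * vec_fun x (i + k)) + vec_fun v i + (if i = 0 then C (vec_fun x (n - 1)) else 0)"
    if "i < n" for i
  proof -
    have "vec_fun x (n - 1) = x $ (n - 1)" "vec_fun v i = v $ i"
      using x v that by (auto simp: vec_fun_def)
    then show ?thesis
      using that v by (simp add: superdiag_poly_mult_vec[OF x that] sets C_tilde_def P del: One_nat_def)
  qed
  moreover have "dim_vec (superdiag_poly n (n - 2) a *\<^sub>v x + v + C_tilde n C x) = n"
    by (simp add: C_tilde_def)
  moreover have "vec_fun y i = y $ i" if "i < n" for i using y that by (simp add: vec_fun_def)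
  ultimately show ?thesis using y by (auto simp: vec_eq_iff)
qed

section \<open>Consequences of quasisymmetry and the bilipschitz criterion\<close>

lemma homeomorphism_half_line_zero:
  fixes \<eta> :: "real \<Rightarrow> real"
  assumes "homeomorphism {0..} {0..} \<eta> \<eta>'"
  shows "\<eta> 0 = 0"
proof -
  define t where "t = \<eta>' 0"
  have t: "t \<ge> 0" "\<eta> t = 0"
    using assms by (auto simp: homeomorphism_def t_def)
  have inj: "inj_on \<eta> {0..}"
    using assms by (auto simp: homeomorphism_def intro: inj_on_inverseI)
  have nonneg: "\<eta> s \<ge> 0" if "s \<ge> 0" for s
    using assms that by (auto simp: homeomorphism_def)
  \<comment> \<open>If the value 0 were attained at an interior point t, \<eta>, being continuous
    and injective, would be strictly monotone around t and take a negative value.\<close>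
  have "t = 0"
  proof (rule ccontr)
    assume "t \<noteq> 0"
    moreover have "continuous_on {0..t + 1} \<eta>"
      using assms by (auto simp: homeomorphism_def intro: continuous_on_subset)
    moreover have "inj_on \<eta> {0..t + 1}" by (rule inj_on_subset[OF inj]) auto
    ultimately have "(\<eta> 0 < \<eta> t \<and> \<eta> t < \<eta> (t + 1)) \<or> (\<eta> (t + 1) < \<eta> t \<and> \<eta> t < \<eta> 0)"
      using continuous_inj_imp_mono[of 0 t "t + 1" \<eta>] t by simp
    then show False using nonneg[of 0] nonneg[of "t + 1"] t by auto
  qed
  then show ?thesis using t by simp
qed

text \<open>\<eta> is bounded on the compact interval \<open>{0..max c 0}\<close>, which gives H.
  Triples with a coincidence, which the definition leaves out, are settled by \<rho> and \<sigma>
  being nonnegative and vanishing exactly on the diagonal.\<close>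

lemma eta_quasisymmetric_upper:
  assumes qs: "eta_quasisymmetric \<eta> X \<rho> Y \<sigma> F"
    and \<rho>: "\<And>x y. x \<in> X \<Longrightarrow> y \<in> X \<Longrightarrow> 0 \<le> \<rho> x y \<and> (\<rho> x y = 0 \<longleftrightarrow> x = y)"
    and \<sigma>: "\<And>x y. x \<in> Y \<Longrightarrow> y \<in> Y \<Longrightarrow> 0 \<le> \<sigma> x y \<and> (\<sigma> x y = 0 \<longleftrightarrow> x = y)"
  shows "\<exists>H\<ge>1. \<forall>x\<in>X. \<forall>y\<in>X. \<forall>z\<in>X. \<rho> x y \<le> c * \<rho> x z \<longrightarrow> \<sigma> (F x) (F y) \<le> H * \<sigma> (F x) (F z)"
proof -
  obtain \<eta>' where \<eta>: "homeomorphism {0..} {0..} \<eta> \<eta>'"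
    using qs by (auto simp: eta_quasisymmetric_def)
  have bij: "bij_betw F X Y" using qs by (simp add: eta_quasisymmetric_def)
  have FY: "F x \<in> Y" if "x \<in> X" for x using bij that by (rule bij_betw_apply)
  have "continuous_on {0..max c 0} \<eta>"
    using \<eta> by (auto simp: homeomorphism_def intro: continuous_on_subset)
  then have "bounded (\<eta> ` {0..max c 0})"
    by (intro compact_imp_bounded compact_continuous_image) auto
  then obtain B where B: "\<And>t. 0 \<le> t \<Longrightarrow> t \<le> max c 0 \<Longrightarrow> \<bar>\<eta> t\<bar> \<le> B"
    unfolding bounded_iff by force
  have "\<sigma> (F x) (F y) \<le> max 1 B * \<sigma> (F x) (F z)"
    if xyz: "x \<in> X" "y \<in> X" "z \<in> X" and le: "\<rho> x y \<le> c * \<rho> x z" for x y z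
  proof (cases "x = y \<or> y = z \<or> x = z")
    case True
    then consider "x = y" | "y = z" | "x = z" by blast
    then show ?thesis
    proof cases
      case 1
      then have "\<sigma> (F x) (F y) = 0" using \<sigma>[OF FY FY] xyz by simp
      then show ?thesis using \<sigma>[OF FY FY, of x z] xyz by simp
    next
      case 2
      then show ?thesis using \<sigma>[OF FY FY, of x z] xyz mult_right_mono[of 1 "max 1 B" "\<sigma> (F x) (F z)"] by simp
    next
      case 3
      then have "\<rho> x y \<le> 0" using le \<rho>[of x x] xyz by simp
      then have "x = y" using \<rho>[of x y] xyz by auto
      then have "\<sigma> (F x) (F y) = 0" using \<sigma>[OF FY FY] xyz by simp
      then show ?thesis using \<sigma>[OF FY FY, of x z] xyz by simp
    qed
  next
    case False
    have pos: "\<rho> x z > 0" "\<rho> x y \<ge> 0" using \<rho> xyz False by (metis order_le_less)+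
    have "F x \<noteq> F z" using bij xyz False by (auto simp: bij_betw_def inj_on_def)
    then have pos': "\<sigma> (F x) (F z) > 0" using \<sigma>[OF FY FY, of x z] xyz by auto
    have "\<sigma> (F x) (F y) / \<sigma> (F x) (F z) \<le> \<eta> (\<rho> x y / \<rho> x z)"
      using qs xyz False by (auto simp: eta_quasisymmetric_def)
    also have "\<dots> \<le> B"
    proof -
      have "\<rho> x y / \<rho> x z \<le> c" using le pos by (simp add: field_simps)
      then have "\<rho> x y / \<rho> x z \<le> max c 0" by simp
      then show ?thesis using B[of "\<rho> x y / \<rho> x z"] pos by simp
    qed
    also have "B \<le> max 1 B" by simp
    finally show ?thesis using pos' by (simp add: pos_divide_le_eq)
  qed
  then show ?thesis by (intro exI[of _ "max 1 B"]) auto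
qed

text \<open>This becomes weak quasisymmetry of the inverse. With y and z interchanged, a very small
  \<open>\<rho> x z / \<rho> x y\<close> would, as \<eta> is small near 0, make
  \<open>\<sigma> (F x) (F z) / \<sigma> (F x) (F y)\<close> less than \<open>1/(|c| + 1)\<close>,
  against the assumed ratio.\<close>

lemma eta_quasisymmetric_lower:
  assumes qs: "eta_quasisymmetric \<eta> X \<rho> Y \<sigma> F"
    and \<rho>: "\<And>x y. x \<in> X \<Longrightarrow> y \<in> X \<Longrightarrow> 0 \<le> \<rho> x y \<and> (\<rho> x y = 0 \<longleftrightarrow> x = y)"
    and \<sigma>: "\<And>x y. x \<in> Y \<Longrightarrow> y \<in> Y \<Longrightarrow> 0 \<le> \<sigma> x y \<and> (\<sigma> x y = 0 \<longleftrightarrow> x = y)"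
  shows "\<exists>H\<ge>1. \<forall>x\<in>X. \<forall>y\<in>X. \<forall>z\<in>X. \<sigma> (F x) (F y) \<le> c * \<sigma> (F x) (F z) \<longrightarrow> \<rho> x y \<le> H * \<rho> x z"
proof -
  obtain \<eta>' where \<eta>: "homeomorphism {0..} {0..} \<eta> \<eta>'"
    using qs by (auto simp: eta_quasisymmetric_def)
  have bij: "bij_betw F X Y" using qs by (simp add: eta_quasisymmetric_def)
  have FY: "F x \<in> Y" if "x \<in> X" for x using bij that by (rule bij_betw_apply)
  define e where "e = 1 / (\<bar>c\<bar> + 1)"
  have e: "e > 0" by (simp add: e_def)
  have "continuous_on {0..} \<eta>" using \<eta> by (simp add: homeomorphism_def)
  then obtain \<delta> where \<delta>: "\<delta> > 0" "\<And>t. t \<ge> 0 \<Longrightarrow> t < \<delta> \<Longrightarrow> \<bar>\<eta> t\<bar> < e"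
    unfolding continuous_on_iff using e homeomorphism_half_line_zero[OF \<eta>]
    by (force simp: dist_real_def)
  define H where "H = max 1 (1 / \<delta>)"
  have "\<rho> x y \<le> H * \<rho> x z"
    if xyz: "x \<in> X" "y \<in> X" "z \<in> X" and le: "\<sigma> (F x) (F y) \<le> c * \<sigma> (F x) (F z)" for x y z
  proof (cases "x = y \<or> y = z \<or> x = z")
    case True
    then consider "x = y" | "y = z" | "x = z" by blast
    then show ?thesis
    proof cases
      case 1
      then have "\<rho> x y = 0" using \<rho>[of x y] xyz by simp
      then show ?thesis using \<rho>[of x z] xyz by (simp add: H_def)
    next
      case 2
      then show ?thesis using \<rho>[of x z] xyz mult_right_mono[of 1 H "\<rho> x z"] by (simp add: H_def)
    next
      case 3
      then have "\<sigma> (F x) (F y) \<le> 0" using le \<sigma>[OF FY FY, of x x] xyz by simp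
      then have "F x = F y" using \<sigma>[OF FY FY, of x y] xyz by auto
      then have "x = y" using bij xyz by (auto simp: bij_betw_def inj_on_def)
      then have "\<rho> x y = 0" using \<rho>[of x y] xyz by simp
      then show ?thesis using \<rho>[of x z] xyz by (simp add: H_def)
    qed
  next
    case False
    have pos: "\<rho> x z > 0" "\<rho> x y > 0" using \<rho> xyz False by (metis order_le_less)+
    have "F x \<noteq> F z" "F x \<noteq> F y" using bij xyz False by (auto simp: bij_betw_def inj_on_def)
    then have pos': "\<sigma> (F x) (F z) > 0" "\<sigma> (F x) (F y) > 0"
      using \<sigma>[OF FY FY, of x z] \<sigma>[OF FY FY, of x y] xyz by auto
    have "\<delta> \<le> \<rho> x z / \<rho> x y"
    proof (rule ccontr)
      assume "\<not> \<delta> \<le> \<rho> x z / \<rho> x y"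
      then have "\<eta> (\<rho> x z / \<rho> x y) < e" using \<delta>(2)[of "\<rho> x z / \<rho> x y"] pos by simp
      moreover have "\<sigma> (F x) (F z) / \<sigma> (F x) (F y) \<le> \<eta> (\<rho> x z / \<rho> x y)"
        using qs xyz False by (auto simp: eta_quasisymmetric_def)
      ultimately have "\<sigma> (F x) (F z) / \<sigma> (F x) (F y) < e" by simp
      then have "(\<bar>c\<bar> + 1) * \<sigma> (F x) (F z) < \<sigma> (F x) (F y)" using pos' by (simp add: e_def field_simps)
      moreover have "c * \<sigma> (F x) (F z) \<le> (\<bar>c\<bar> + 1) * \<sigma> (F x) (F z)"
        using pos' by (intro mult_right_mono) auto
      ultimately show False using le by linarith
    qed
    then have "\<rho> x y \<le> 1 / \<delta> * \<rho> x z" using pos \<delta>(1) by (simp add: field_simps)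
    also have "\<dots> \<le> H * \<rho> x z" using pos by (intro mult_right_mono) (auto simp: H_def)
    finally show ?thesis .
  qed
  then show ?thesis by (intro exI[of _ H]) (auto simp: H_def)
qed

lemma quasisymmetric_of_bilipschitz:
  assumes bij: "bij_betw F X Y" and K: "K \<ge> 1"
    and \<rho>: "\<And>x y. x \<in> X \<Longrightarrow> y \<in> X \<Longrightarrow> 0 \<le> \<rho> x y \<and> (\<rho> x y = 0 \<longleftrightarrow> x = y)"
    and bilip: "\<And>x y. x \<in> X \<Longrightarrow> y \<in> X \<Longrightarrow> \<sigma> (F x) (F y) \<le> K * \<rho> x y \<and> \<rho> x y \<le> K * \<sigma> (F x) (F y)"
  shows "quasisymmetric X \<rho> Y \<sigma> F"
proof -
  have K2: "K * K > 0" using K by simp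
  have "eta_quasisymmetric (\<lambda>t. K * K * t) X \<rho> Y \<sigma> F"
    unfolding eta_quasisymmetric_def
  proof (intro conjI ballI impI bij)
    have "homeomorphism {0..} {0..} (\<lambda>t. K * K * t) (\<lambda>t. t / (K * K))"
    proof (rule homeomorphismI)
      show "continuous_on {0..} (\<lambda>t. K * K * t)" "continuous_on {0..} (\<lambda>t. t / (K * K))"
        using K2 by (auto intro!: continuous_intros)
    qed (use K2 in \<open>auto simp: less_imp_le\<close>)
    then show "\<exists>\<eta>'. homeomorphism {0..} {0..} (\<lambda>t. K * K * t) \<eta>'" by blast
  next
    fix x y z assume xyz: "x \<in> X" "y \<in> X" "z \<in> X" and ne: "x \<noteq> y" "x \<noteq> z" "y \<noteq> z"
    have pos: "\<rho> x z > 0" using \<rho>[of x z] xyz ne by (metis order_le_less)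
    have low: "\<rho> x z / K \<le> \<sigma> (F x) (F z)" using bilip[of x z] xyz K by (simp add: field_simps)
    have "\<sigma> (F x) (F y) / \<sigma> (F x) (F z) \<le> (K * \<rho> x y) / (\<rho> x z / K)"
      using bilip[of x y] low xyz pos K \<rho>[of x y] by (intro frac_le) auto
    also have "\<dots> = K * K * (\<rho> x y / \<rho> x z)" by simp
    finally show "\<sigma> (F x) (F y) / \<sigma> (F x) (F z) \<le> K * K * (\<rho> x y / \<rho> x z)" .
  qed
  then show ?thesis unfolding quasisymmetric_def by blast
qed

theorem theorem7p1:
  fixes n :: nat and F :: "real Matrix.vec \<Rightarrow> real Matrix.vec"
  assumes "n \<ge> 2"
    and "bij_betw F (carrier_vec n) (carrier_vec n)"
  shows "quasisymmetric (carrier_vec n) (D (J n)) (carrier_vec n) (D (J n)) F \<longleftrightarrow>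
    (\<exists>(a :: nat \<Rightarrow> real) (v :: real Matrix.vec) (C :: real \<Rightarrow> real).
      a 0 \<noteq> 0 \<and> v \<in> carrier_vec n \<and> (\<exists>L. L-lipschitz_on UNIV C) \<and>
      (\<forall>x\<in>carrier_vec n. F x = superdiag_poly n (n - 2) a *\<^sub>v x + v + C_tilde n C x))"
proof -
  have D: "0 \<le> D (J n) x y \<and> (D (J n) x y = 0 \<longleftrightarrow> x = y)"
    if "x \<in> carrier_vec n" "y \<in> carrier_vec n" for x y
    using that vec_fun_inj[of x n y] by (simp add: D_J_eq_rho)
  have F_carrier: "F x \<in> carrier_vec n" if "x \<in> carrier_vec n" for x
    using assms(2) that by (rule bij_betw_apply)
  define f where "f = (\<lambda>x. vec_fun (F (Matrix.vec n x)))"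
  have f_Rn: "f x \<in> Rn n" for x using F_carrier by (simp add: f_def)
  have f_vec_fun: "f (vec_fun x) = vec_fun (F x)" if "x \<in> carrier_vec n" for x
    using that by (simp add: f_def)
  have D_F: "D (J n) (F (Matrix.vec n x)) (F (Matrix.vec n y)) = rho n (f x - f y)" for x y
    using F_carrier by (simp add: f_def D_J_eq_rho)
  have D_vec: "D (J n) (Matrix.vec n x) (Matrix.vec n y) = rho n (x - y)" if "x \<in> Rn n" "y \<in> Rn n" for x y
    using that by (simp add: D_J_eq_rho)
  show ?thesis
  proof
    assume "quasisymmetric (carrier_vec n) (D (J n)) (carrier_vec n) (D (J n)) F"
    then obtain \<eta> where \<eta>: "eta_quasisymmetric \<eta> (carrier_vec n) (D (J n)) (carrier_vec n) (D (J n)) F"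
      unfolding quasisymmetric_def by blast
    define G where "G = inv_into (carrier_vec n) F"
    have G: "G x \<in> carrier_vec n" "F (G x) = x" "G (F x) = x" if "x \<in> carrier_vec n" for x
      using assms(2) that unfolding G_def
      by (auto simp: bij_betw_def inv_into_into f_inv_into_f inv_into_f_f)
    define g where "g = (\<lambda>x. vec_fun (G (Matrix.vec n x)))"
    have g_Rn: "g x \<in> Rn n" for x using G by (simp add: g_def)
    have fg: "f (g x) = x" "g (f x) = x" if "x \<in> Rn n" for x
      using that G F_carrier by (simp_all add: f_def g_def)
    have "weakly_qs n f"
      unfolding weakly_qs_def
    proof
      fix c
      obtain H where "H \<ge> 1" and H: "\<forall>x\<in>carrier_vec n. \<forall>y\<in>carrier_vec n. \<forall>z\<in>carrier_vec n.
          D (J n) x y \<le> c * D (J n) x z \<longrightarrow> D (J n) (F x) (F y) \<le> H * D (J n) (F x) (F z)"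
        using eta_quasisymmetric_upper[OF \<eta> D D, of c] by blast
      have "rho n (f y - f x) \<le> H * rho n (f z - f x)"
        if "x \<in> Rn n" "y \<in> Rn n" "z \<in> Rn n" "rho n (y - x) \<le> c * rho n (z - x)" for x y z
        using H[rule_format, of "Matrix.vec n x" "Matrix.vec n y" "Matrix.vec n z"] that
        by (simp add: D_F D_vec rho_commute[of n x] rho_commute[of n "f x"])
      then show "\<exists>H\<ge>1. \<forall>x\<in>Rn n. \<forall>y\<in>Rn n. \<forall>z\<in>Rn n.
          rho n (y - x) \<le> c * rho n (z - x) \<longrightarrow> rho n (f y - f x) \<le> H * rho n (f z - f x)"
        using \<open>H \<ge> 1\<close> by blast
    qed
    moreover have "weakly_qs n g"
      unfolding weakly_qs_def
    proof
      fix c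
      obtain H where "H \<ge> 1" and H: "\<forall>x\<in>carrier_vec n. \<forall>y\<in>carrier_vec n. \<forall>z\<in>carrier_vec n.
          D (J n) (F x) (F y) \<le> c * D (J n) (F x) (F z) \<longrightarrow> D (J n) x y \<le> H * D (J n) x z"
        using eta_quasisymmetric_lower[OF \<eta> D D, of c] by blast
      have "rho n (g y - g x) \<le> H * rho n (g z - g x)"
        if "x \<in> Rn n" "y \<in> Rn n" "z \<in> Rn n" "rho n (y - x) \<le> c * rho n (z - x)" for x y z
        using H[rule_format, of "Matrix.vec n (g x)" "Matrix.vec n (g y)" "Matrix.vec n (g z)"] that
        by (simp add: D_F D_vec g_Rn fg rho_commute[of n x] rho_commute[of n "g x"])
      then show "\<exists>H\<ge>1. \<forall>x\<in>Rn n. \<forall>y\<in>Rn n. \<forall>z\<in>Rn n.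
          rho n (y - x) \<le> c * rho n (z - x) \<longrightarrow> rho n (g y - g x) \<le> H * rho n (g z - g x)"
        using \<open>H \<ge> 1\<close> by blast
    qed
    ultimately interpret qs_pair n f g
      using assms(1) f_Rn g_Rn fg by unfold_locales auto
    obtain K where "K > 0" "\<forall>p\<in>Rn n. \<forall>z\<in>Rn n. rho n (f z - f p) \<le> K * rho n (z - p)"
      using rho_lipschitz by blast
    then have "coarse_lipschitz n f"
      using f_Rn by (intro coarse_lipschitz_of_rho_lipschitz) auto
    then obtain a v C where C: "\<exists>L. L-lipschitz_on UNIV C"
      and form: "\<forall>x\<in>Rn n. \<forall>i<n. f x i = (\<Sum>k<n-1. a k * x (i + k)) + v i + (if i = 0 then C (x (n - 1)) else 0)"
      using coarse_rigidity[of n f] assms(1) f_Rn by auto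
    define v' where "v' = Matrix.vec n v"
    have v': "v' \<in> carrier_vec n" "\<And>i. i < n \<Longrightarrow> vec_fun v' i = v i" by (auto simp: v'_def vec_fun_def)
    \<comment> \<open>As \<open>n \<ge> 2\<close>, C does not enter the last coordinate, which is
      \<open>a 0\<close> times that of x plus a constant. For \<open>a 0 = 0\<close> it would be
      constant, against surjectivity.\<close>
    have "a 0 \<noteq> 0"
    proof
      assume "a 0 = 0"
      have "f x (n - 1) = v (n - 1)" if x: "x \<in> Rn n" for x
      proof -
        have "(\<Sum>k<n-1. a k * x (n - 1 + k)) = 0"
        proof (intro sum.neutral ballI)
          fix k
          have "x (n - 1 + k) = 0" if "k \<noteq> 0" using x that by (simp add: Rn_def)
          then show "a k * x (n - 1 + k) = 0" using \<open>a 0 = 0\<close> by (cases "k = 0") auto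
        qed
        then show ?thesis using form[rule_format, OF x, of "n - 1"] assms(1) by simp
      qed
      from this[OF g_Rn, of "scale (v (n - 1) + 1) (basis (n - 1))"] show False
        using assms(1) by (simp add: fg)
    qed
    moreover have "F x = superdiag_poly n (n - 2) a *\<^sub>v x + v' + C_tilde n C x" if x: "x \<in> carrier_vec n" for x
      unfolding superdiag_form_iff[OF assms(1) x v'(1) F_carrier[OF x]]
      using form[rule_format, OF vec_fun_Rn[OF x]] v'(2) by (simp add: f_vec_fun[OF x])
    ultimately show "\<exists>a v C. a 0 \<noteq> 0 \<and> v \<in> carrier_vec n \<and> (\<exists>L. L-lipschitz_on UNIV C) \<and>
      (\<forall>x\<in>carrier_vec n. F x = superdiag_poly n (n - 2) a *\<^sub>v x + v + C_tilde n C x)"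
      using C v'(1) by blast
  next
    assume "\<exists>a v C. a 0 \<noteq> 0 \<and> v \<in> carrier_vec n \<and> (\<exists>L. L-lipschitz_on UNIV C) \<and>
      (\<forall>x\<in>carrier_vec n. F x = superdiag_poly n (n - 2) a *\<^sub>v x + v + C_tilde n C x)"
    then obtain a v C L where a: "a 0 \<noteq> 0" and v: "v \<in> carrier_vec n" and C: "L-lipschitz_on UNIV C"
      and F: "\<forall>x\<in>carrier_vec n. F x = superdiag_poly n (n - 2) a *\<^sub>v x + v + C_tilde n C x"
      by blast
    have "f x i = (\<Sum>k<n-1. a k * x (i + k)) + vec_fun v i + (if i = 0 then C (x (n - 1)) else 0)"
      if x: "x \<in> Rn n" and i: "i < n" for x i
    proof -
      have c: "Matrix.vec n x \<in> carrier_vec n" by simp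
      show ?thesis
        using F[rule_format, OF c] unfolding superdiag_form_iff[OF assms(1) c v F_carrier[OF c]]
        using i x by (simp add: f_def)
    qed
    then obtain K where K: "K \<ge> 1" "\<forall>x\<in>Rn n. \<forall>y\<in>Rn n. rho n (f x - f y) \<le> K * rho n (x - y) \<and> rho n (x - y) \<le> K * rho n (f x - f y)"
      using shift_poly_bilipschitz[of n a L C f "vec_fun v", OF assms(1) a C f_Rn] by blast
    show "quasisymmetric (carrier_vec n) (D (J n)) (carrier_vec n) (D (J n)) F"
    proof (rule quasisymmetric_of_bilipschitz[OF assms(2) K(1)])
      fix x y :: "real Matrix.vec" assume xy: "x \<in> carrier_vec n" "y \<in> carrier_vec n"
      show "0 \<le> D (J n) x y \<and> (D (J n) x y = 0 \<longleftrightarrow> x = y)" using D xy by blast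
      show "D (J n) (F x) (F y) \<le> K * D (J n) x y \<and> D (J n) x y \<le> K * D (J n) (F x) (F y)"
        using K(2)[rule_format, OF vec_fun_Rn[OF xy(1)] vec_fun_Rn[OF xy(2)]] xy F_carrier
        by (simp add: D_J_eq_rho f_vec_fun)
    qed
  qed
qed

end
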